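(* Let $F\colon\mathcal{C}\to\mathcal{D}$ be a monoidal Quillen equivalence of cofibrantly generated monoidal model categories, with right adjoint $U$. Let $A$ be a monoid in $\mathcal{C}$ which is cofibrant as an object of $\mathcal{C}$. Then $F$ induces a Quillen equivalence $F\colon A\text{-mod}\to FA\text{-mod}$.
   Context: Model categories are bicomplete and have functorial factorizations; $Q$ denotes the functorial cofibrant replacement, with natural trivial fibration $q\colon QX\to X$. Monoidal model category: a model category $\mathcal{C}$ with a closed monoidal structure, with product $\wedge$ and unit $S$ (closed: both $X\wedge -$ and $-\wedge X$ have right adjoints natural in $X$), such that: (a) for cofibrations $f\colon A\to B$ and $g\colon X\to Y$, the pushout smash product $f\mathbin{\square} g\colon (A\wedge Y)\amalg_{A\wedge X}(B\wedge X)\to B\wedge Y$ is a cofibration, which is a weak equivalence if $f$ or $g$ is; (b) the maps $q\wedge X\colon QS\wedge X\to S\wedge X\cong X$ and $X\wedge q\colon X\wedge QS\to X$ are weak equivalences for all cofibrant $X$. The monoidal structure is not assumed symmetric. Smallness: an object $A$ of a cocomplete category $\mathcal{C}$ is small relative to a class of maps (subcategory) $\mathcal{D}$ if there is a cofinal class $\Sigma$ of ordinals (every ordinal is $\le$ some member of $\Sigma$) such that for all $\alpha\in \Sigma$ and all colimit-preserving functors $X\colon\alpha\to\mathcal{C}$ with each $X_\beta\to X_{\beta+1}$ in $\mathcal{D}$, the map $\operatorname{colim}_{\beta<\alpha}\mathcal{C}(A,X_\beta)\to\mathcal{C}(A,\operatorname{colim}_{\beta<\alpha}X_\beta)$ is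 an isomorphism. Cofibrantly generated: there are sets $I$ (generating cofibrations) and $J$ (generating trivial cofibrations) of maps such that the domains of $I$ are small relative to the cofibrations, the domains of $J$ are small relative to the trivial cofibrations, the fibrations are exactly the maps with the right lifting property with respect to $J$, and the trivial fibrations are exactly the maps with the right lifting property with respect to $I$. A functor $F$ between model categories with right adjoint $U$ is left Quillen if it preserves cofibrations and trivial cofibrations; it is a Quillen equivalence if moreover for all cofibrant $X$ in the source and fibrant $Y$ in the target, a map $FX\to Y$ is a weak equivalence if and only if its adjoint $X\to UY$ is. A left Quillen functor $F\colon\mathcal{C}\to\mathcal{D}$ between monoidal model categories is a monoidal Quillen functor if $F$ is monoidal (in the strong sense: with coherent natural isomorphisms $FX\wedge FY\cong F(X\wedge Y)$ and $FS\cong S$) and the induced map $F(QS)\to FS\cong S$ is a weak equivalence. A monoidal Quillen equivalence is a monoidal Quillen functor that is a Quillen equivalence. Here $A\text{-mod}$ is the category of left $A$-modules. For a monoid $A$ cofibrant in $\mathcal{C}$ it has the model structure in which a map is a weak equivalence (fibration) if and only if it is one in $\mathcal{C}$ (this is a cofibrantly generated model structure). Since $F$ is monoidal and left Quillen, $FA$ is a monoid in $\mathcal{D}$ that is cofibrant in $\mathcal{D}$, and $FA\text{-mod}$ has the analogous model structure. The induced functor sends an $A$-module $M$ to $FM$ with action $FA\wedge FM\cong F(A\wedge M)\to FM$. *)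

theory Defs
  imports Main
begin

unbundle cardinal_syntax

text \<open>
  Smallness is relative to a cardinal \<kappa> that is infinite, regular and a strong limit: a
  collection is small iff it has fewer than \<kappa> elements. The uncountable such \<kappa> are the strongly
  inaccessible cardinals, i.e. the Grothendieck universes; the countable one is allowed as well.
  Every small category is isomorphic to one whose objects and arrows are drawn from the type
  carrying \<kappa>, so small diagrams are indexed by categories on that type. The ordinals below \<kappa>
  are represented by the elements of \<^term>\<open>Field \<kappa>\<close>, each standing for its set of predecessors.
\<close>

definition universe :: "'u rel \<Rightarrow> bool" where
  "universe \<kappa> \<longleftrightarrow> Card_order \<kappa> \<and> infinite (Field \<kappa>) \<and> regularCard \<kappa> \<and>
     (\<forall>X :: 'u set. |X| <o \<kappa> \<longrightarrow> |Pow X| <o \<kappa>)"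

section \<open>Categories\<close>

record ('o, 'a) category =
  Obj :: "'o set"
  Arr :: "'a set"
  Dom :: "'a \<Rightarrow> 'o"
  Cod :: "'a \<Rightarrow> 'o"
  Ident :: "'o \<Rightarrow> 'a"
  Comp :: "'a \<Rightarrow> 'a \<Rightarrow> 'a"  (infixr "\<cdot>\<index>" 65)

definition Hom :: "('o, 'a, 'm) category_scheme \<Rightarrow> 'o \<Rightarrow> 'o \<Rightarrow> 'a set" where
  "Hom C X Y = {f \<in> Arr C. Dom C f = X \<and> Cod C f = Y}"

locale category =
  fixes C :: "('o, 'a, 'm) category_scheme" (structure)
  assumes Dom_in: "f \<in> Arr C \<Longrightarrow> Dom C f \<in> Obj C"
    and Cod_in: "f \<in> Arr C \<Longrightarrow> Cod C f \<in> Obj C"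
    and Ident_in: "X \<in> Obj C \<Longrightarrow> Ident C X \<in> Hom C X X"
    and Comp_in: "\<lbrakk>f \<in> Hom C X Y; g \<in> Hom C Y Z\<rbrakk> \<Longrightarrow> g \<cdot> f \<in> Hom C X Z"
    and Comp_Ident: "f \<in> Hom C X Y \<Longrightarrow> f \<cdot> Ident C X = f"
    and Ident_Comp: "f \<in> Hom C X Y \<Longrightarrow> Ident C Y \<cdot> f = f"
    and Comp_assoc: "\<lbrakk>f \<in> Hom C W X; g \<in> Hom C X Y; h \<in> Hom C Y Z\<rbrakk>
      \<Longrightarrow> (h \<cdot> g) \<cdot> f = h \<cdot> (g \<cdot> f)"

definition inverse_arrows :: "('o, 'a, 'm) category_scheme \<Rightarrow> 'a \<Rightarrow> 'a \<Rightarrow> bool" where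
  "inverse_arrows C f g \<longleftrightarrow> f \<in> Arr C \<and> g \<in> Hom C (Cod C f) (Dom C f) \<and>
     g \<cdot>\<^bsub>C\<^esub> f = Ident C (Dom C f) \<and> f \<cdot>\<^bsub>C\<^esub> g = Ident C (Cod C f)"

definition is_iso :: "('o, 'a, 'm) category_scheme \<Rightarrow> 'a \<Rightarrow> bool" where
  "is_iso C f \<longleftrightarrow> (\<exists>g. inverse_arrows C f g)"

definition inv_arr :: "('o, 'a, 'm) category_scheme \<Rightarrow> 'a \<Rightarrow> 'a" where
  "inv_arr C f = (THE g. inverse_arrows C f g)"

definition op_cat :: "('o, 'a, 'm) category_scheme \<Rightarrow> ('o, 'a) category" where
  "op_cat C = \<lparr>Obj = Obj C, Arr = Arr C, Dom = Cod C, Cod = Dom C, Ident = Ident C,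
     Comp = (\<lambda>g f. f \<cdot>\<^bsub>C\<^esub> g)\<rparr>"

definition prod_cat ::
  "('o, 'a, 'm) category_scheme \<Rightarrow> ('p, 'b, 'n) category_scheme \<Rightarrow> ('o \<times> 'p, 'a \<times> 'b) category" where
  "prod_cat C D = \<lparr>Obj = Obj C \<times> Obj D, Arr = Arr C \<times> Arr D,
     Dom = (\<lambda>(f, g). (Dom C f, Dom D g)), Cod = (\<lambda>(f, g). (Cod C f, Cod D g)),
     Ident = (\<lambda>(X, Y). (Ident C X, Ident D Y)),
     Comp = (\<lambda>(f', g') (f, g). (f' \<cdot>\<^bsub>C\<^esub> f, g' \<cdot>\<^bsub>D\<^esub> g))\<rparr>"

text \<open>In the arrow category, \<open>(f, g, u, v)\<close> is the commutative square from \<open>f\<close> to \<open>g\<close> with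
  \<open>u\<close> on domains and \<open>v\<close> on codomains.\<close>

definition arrow_cat :: "('o, 'a, 'm) category_scheme \<Rightarrow> ('a, 'a \<times> 'a \<times> 'a \<times> 'a) category" where
  "arrow_cat C = \<lparr>Obj = Arr C,
     Arr = {(f, g, u, v). f \<in> Arr C \<and> g \<in> Arr C \<and> u \<in> Hom C (Dom C f) (Dom C g) \<and>
       v \<in> Hom C (Cod C f) (Cod C g) \<and> g \<cdot>\<^bsub>C\<^esub> u = v \<cdot>\<^bsub>C\<^esub> f},
     Dom = (\<lambda>(f, g, u, v). f), Cod = (\<lambda>(f, g, u, v). g),
     Ident = (\<lambda>f. (f, f, Ident C (Dom C f), Ident C (Cod C f))),
     Comp = (\<lambda>(g, h, u', v') (f, _, u, v). (f, h, u' \<cdot>\<^bsub>C\<^esub> u, v' \<cdot>\<^bsub>C\<^esub> v))\<rparr>"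

record ('o, 'a, 'p, 'b) funct =
  obmap :: "'o \<Rightarrow> 'p"
  armap :: "'a \<Rightarrow> 'b"

locale is_functor = source: category C + target: category D
  for C :: "('o, 'a, 'm) category_scheme" and D :: "('p, 'b, 'n) category_scheme" +
  fixes F :: "('o, 'a, 'p, 'b, 'k) funct_scheme"
  assumes obmap_in: "X \<in> Obj C \<Longrightarrow> obmap F X \<in> Obj D"
    and armap_in: "f \<in> Hom C X Y \<Longrightarrow> armap F f \<in> Hom D (obmap F X) (obmap F Y)"
    and armap_Ident: "X \<in> Obj C \<Longrightarrow> armap F (Ident C X) = Ident D (obmap F X)"
    and armap_Comp: "\<lbrakk>f \<in> Hom C X Y; g \<in> Hom C Y Z\<rbrakk>
      \<Longrightarrow> armap F (g \<cdot>\<^bsub>C\<^esub> f) = armap F g \<cdot>\<^bsub>D\<^esub> armap F f"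

definition comp_funct ::
  "('p, 'b, 'q, 'c, 'k) funct_scheme \<Rightarrow> ('o, 'a, 'p, 'b, 'l) funct_scheme \<Rightarrow> ('o, 'a, 'q, 'c) funct" where
  "comp_funct G F = \<lparr>obmap = obmap G \<circ> obmap F, armap = armap G \<circ> armap F\<rparr>"

text \<open>\<open>F\<close> is left adjoint to \<open>U\<close>, with adjunction bijections \<open>\<Phi> X Y : D(F X, Y) \<rightarrow> C(X, U Y)\<close>.\<close>

definition adjunction ::
  "('o, 'a, 'm) category_scheme \<Rightarrow> ('p, 'b, 'n) category_scheme \<Rightarrow>
   ('o, 'a, 'p, 'b, 'k) funct_scheme \<Rightarrow> ('p, 'b, 'o, 'a, 'l) funct_scheme \<Rightarrow>
   ('o \<Rightarrow> 'p \<Rightarrow> 'b \<Rightarrow> 'a) \<Rightarrow> bool" where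
  "adjunction C D F U \<Phi> \<longleftrightarrow> is_functor C D F \<and> is_functor D C U \<and>
     (\<forall>X\<in>Obj C. \<forall>Y\<in>Obj D. bij_betw (\<Phi> X Y) (Hom D (obmap F X) Y) (Hom C X (obmap U Y))) \<and>
     (\<forall>X\<in>Obj C. \<forall>Y\<in>Obj D. \<forall>X'\<in>Obj C. \<forall>Y'\<in>Obj D.
        \<forall>f\<in>Hom C X' X. \<forall>g\<in>Hom D Y Y'. \<forall>h\<in>Hom D (obmap F X) Y.
          \<Phi> X' Y' (g \<cdot>\<^bsub>D\<^esub> (h \<cdot>\<^bsub>D\<^esub> armap F f)) = armap U g \<cdot>\<^bsub>C\<^esub> (\<Phi> X Y h \<cdot>\<^bsub>C\<^esub> f))"

section \<open>Limits and colimits\<close>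

definition is_cocone ::
  "('o, 'a, 'm) category_scheme \<Rightarrow> ('i, 'j, 'n) category_scheme \<Rightarrow> ('i, 'j, 'o, 'a, 'k) funct_scheme \<Rightarrow>
   'o \<Rightarrow> ('i \<Rightarrow> 'a) \<Rightarrow> bool" where
  "is_cocone C J D L \<iota> \<longleftrightarrow> L \<in> Obj C \<and> (\<forall>i\<in>Obj J. \<iota> i \<in> Hom C (obmap D i) L) \<and>
     (\<forall>u\<in>Arr J. \<iota> (Cod J u) \<cdot>\<^bsub>C\<^esub> armap D u = \<iota> (Dom J u))"

definition is_colimit ::
  "('o, 'a, 'm) category_scheme \<Rightarrow> ('i, 'j, 'n) category_scheme \<Rightarrow> ('i, 'j, 'o, 'a, 'k) funct_scheme \<Rightarrow>
   'o \<Rightarrow> ('i \<Rightarrow> 'a) \<Rightarrow> bool" where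
  "is_colimit C J D L \<iota> \<longleftrightarrow> is_cocone C J D L \<iota> \<and>
     (\<forall>M \<mu>. is_cocone C J D M \<mu> \<longrightarrow> (\<exists>!h. h \<in> Hom C L M \<and> (\<forall>i\<in>Obj J. h \<cdot>\<^bsub>C\<^esub> \<iota> i = \<mu> i)))"

definition is_limit ::
  "('o, 'a, 'm) category_scheme \<Rightarrow> ('i, 'j, 'n) category_scheme \<Rightarrow> ('i, 'j, 'o, 'a, 'k) funct_scheme \<Rightarrow>
   'o \<Rightarrow> ('i \<Rightarrow> 'a) \<Rightarrow> bool" where
  "is_limit C J D L \<pi> \<longleftrightarrow> is_colimit (op_cat C) (op_cat J) D L \<pi>"

definition small_cat :: "'u rel \<Rightarrow> ('i, 'j, 'n) category_scheme \<Rightarrow> bool" where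
  "small_cat \<kappa> J \<longleftrightarrow> category J \<and> |Obj J| <o \<kappa> \<and> |Arr J| <o \<kappa>"

definition bicomplete :: "'u rel \<Rightarrow> ('o, 'a, 'm) category_scheme \<Rightarrow> bool" where
  "bicomplete \<kappa> C \<longleftrightarrow>
     (\<forall>(J :: ('u, 'u) category) (D :: ('u, 'u, 'o, 'a) funct). small_cat \<kappa> J \<and> is_functor J C D \<longrightarrow>
        (\<exists>L \<iota>. is_colimit C J D L \<iota>) \<and> (\<exists>L \<pi>. is_limit C J D L \<pi>))"

definition initial :: "('o, 'a, 'm) category_scheme \<Rightarrow> 'o \<Rightarrow> bool" where
  "initial C X \<longleftrightarrow> X \<in> Obj C \<and> (\<forall>Y\<in>Obj C. \<exists>!f. f \<in> Hom C X Y)"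

definition terminal :: "('o, 'a, 'm) category_scheme \<Rightarrow> 'o \<Rightarrow> bool" where
  "terminal C X \<longleftrightarrow> X \<in> Obj C \<and> (\<forall>Y\<in>Obj C. \<exists>!f. f \<in> Hom C Y X)"

definition is_pushout ::
  "('o, 'a, 'm) category_scheme \<Rightarrow> 'a \<Rightarrow> 'a \<Rightarrow> 'a \<Rightarrow> 'a \<Rightarrow> bool" where
  "is_pushout C f g i j \<longleftrightarrow> f \<in> Arr C \<and> g \<in> Arr C \<and> i \<in> Arr C \<and> j \<in> Arr C \<and>
     Dom C f = Dom C g \<and> Dom C i = Cod C f \<and> Dom C j = Cod C g \<and> Cod C i = Cod C j \<and>
     i \<cdot>\<^bsub>C\<^esub> f = j \<cdot>\<^bsub>C\<^esub> g \<and>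
     (\<forall>Z\<in>Obj C. \<forall>p\<in>Hom C (Cod C f) Z. \<forall>q\<in>Hom C (Cod C g) Z. p \<cdot>\<^bsub>C\<^esub> f = q \<cdot>\<^bsub>C\<^esub> g \<longrightarrow>
        (\<exists>!h. h \<in> Hom C (Cod C i) Z \<and> h \<cdot>\<^bsub>C\<^esub> i = p \<and> h \<cdot>\<^bsub>C\<^esub> j = q))"

section \<open>Model categories\<close>

record 'a model_structure =
  Weq :: "'a set"
  Cof :: "'a set"
  Fib :: "'a set"

definition retract_of :: "('o, 'a, 'm) category_scheme \<Rightarrow> 'a \<Rightarrow> 'a \<Rightarrow> bool" where
  "retract_of C f g \<longleftrightarrow> f \<in> Arr C \<and> g \<in> Arr C \<and>
     (\<exists>i\<in>Hom C (Dom C f) (Dom C g). \<exists>r\<in>Hom C (Dom C g) (Dom C f).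
      \<exists>i'\<in>Hom C (Cod C f) (Cod C g). \<exists>r'\<in>Hom C (Cod C g) (Cod C f).
        r \<cdot>\<^bsub>C\<^esub> i = Ident C (Dom C f) \<and> r' \<cdot>\<^bsub>C\<^esub> i' = Ident C (Cod C f) \<and>
        g \<cdot>\<^bsub>C\<^esub> i = i' \<cdot>\<^bsub>C\<^esub> f \<and> f \<cdot>\<^bsub>C\<^esub> r = r' \<cdot>\<^bsub>C\<^esub> g)"

definition has_lift :: "('o, 'a, 'm) category_scheme \<Rightarrow> 'a \<Rightarrow> 'a \<Rightarrow> bool" where
  "has_lift C i p \<longleftrightarrow>
     (\<forall>u\<in>Hom C (Dom C i) (Dom C p). \<forall>v\<in>Hom C (Cod C i) (Cod C p). p \<cdot>\<^bsub>C\<^esub> u = v \<cdot>\<^bsub>C\<^esub> i \<longrightarrow>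
        (\<exists>h\<in>Hom C (Cod C i) (Dom C p). h \<cdot>\<^bsub>C\<^esub> i = u \<and> p \<cdot>\<^bsub>C\<^esub> h = v))"

definition llp :: "('o, 'a, 'm) category_scheme \<Rightarrow> 'a set \<Rightarrow> 'a set" where
  "llp C S = {i \<in> Arr C. \<forall>p\<in>S. has_lift C i p}"

definition rlp :: "('o, 'a, 'm) category_scheme \<Rightarrow> 'a set \<Rightarrow> 'a set" where
  "rlp C S = {p \<in> Arr C. \<forall>i\<in>S. has_lift C i p}"

definition functorial_factorization ::
  "('o, 'a, 'm) category_scheme \<Rightarrow> 'a set \<Rightarrow> 'a set \<Rightarrow>
   ('a, 'a \<times> 'a \<times> 'a \<times> 'a, 'o, 'a) funct \<Rightarrow> ('a \<Rightarrow> 'a) \<Rightarrow> ('a \<Rightarrow> 'a) \<Rightarrow> bool" where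
  "functorial_factorization C L R E l r \<longleftrightarrow> is_functor (arrow_cat C) C E \<and>
     (\<forall>f\<in>Arr C. l f \<in> L \<inter> Hom C (Dom C f) (obmap E f) \<and> r f \<in> R \<inter> Hom C (obmap E f) (Cod C f) \<and>
        r f \<cdot>\<^bsub>C\<^esub> l f = f) \<and>
     (\<forall>(f, g, u, v)\<in>Arr (arrow_cat C).
        armap E (f, g, u, v) \<cdot>\<^bsub>C\<^esub> l f = l g \<cdot>\<^bsub>C\<^esub> u \<and>
        r g \<cdot>\<^bsub>C\<^esub> armap E (f, g, u, v) = v \<cdot>\<^bsub>C\<^esub> r f)"

locale model_category = category C for C :: "('o, 'a, 'm) category_scheme" (structure) +
  fixes \<kappa> :: "'u rel" and M :: "('a, 'n) model_structure_scheme"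
  assumes locally_small: "\<lbrakk>X \<in> Obj C; Y \<in> Obj C\<rbrakk> \<Longrightarrow> |Hom C X Y| <o \<kappa>"
    and bicomplete: "bicomplete \<kappa> C"
    and classes: "Weq M \<subseteq> Arr C" "Cof M \<subseteq> Arr C" "Fib M \<subseteq> Arr C"
    and two_of_three: "\<lbrakk>f \<in> Hom C X Y; g \<in> Hom C Y Z\<rbrakk> \<Longrightarrow>
      (f \<in> Weq M \<and> g \<in> Weq M \<longrightarrow> g \<cdot> f \<in> Weq M) \<and>
      (f \<in> Weq M \<and> g \<cdot> f \<in> Weq M \<longrightarrow> g \<in> Weq M) \<and>
      (g \<in> Weq M \<and> g \<cdot> f \<in> Weq M \<longrightarrow> f \<in> Weq M)"
    and retracts: "retract_of C f g \<Longrightarrow>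
      (g \<in> Weq M \<longrightarrow> f \<in> Weq M) \<and> (g \<in> Cof M \<longrightarrow> f \<in> Cof M) \<and> (g \<in> Fib M \<longrightarrow> f \<in> Fib M)"
    and lifting_cof: "\<lbrakk>i \<in> Cof M; p \<in> Fib M \<inter> Weq M\<rbrakk> \<Longrightarrow> has_lift C i p"
    and lifting_trivial_cof: "\<lbrakk>i \<in> Cof M \<inter> Weq M; p \<in> Fib M\<rbrakk> \<Longrightarrow> has_lift C i p"
    and factorization_cof: "\<exists>E l r. functorial_factorization C (Cof M) (Fib M \<inter> Weq M) E l r"
    and factorization_fib: "\<exists>E l r. functorial_factorization C (Cof M \<inter> Weq M) (Fib M) E l r"

definition cofibrant ::
  "('o, 'a, 'm) category_scheme \<Rightarrow> ('a, 'n) model_structure_scheme \<Rightarrow> 'o \<Rightarrow> bool" where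
  "cofibrant C M X \<longleftrightarrow> X \<in> Obj C \<and> (\<exists>Z. initial C Z \<and> (\<exists>f\<in>Hom C Z X. f \<in> Cof M))"

definition fibrant ::
  "('o, 'a, 'm) category_scheme \<Rightarrow> ('a, 'n) model_structure_scheme \<Rightarrow> 'o \<Rightarrow> bool" where
  "fibrant C M X \<longleftrightarrow> X \<in> Obj C \<and> (\<exists>Z. terminal C Z \<and> (\<exists>f\<in>Hom C X Z. f \<in> Fib M))"

text \<open>A functor together with a natural map \<open>q X : Q X \<rightarrow> X\<close>.\<close>

record ('o, 'a) replacement = "('o, 'a, 'o, 'a) funct" +
  repl :: "'o \<Rightarrow> 'a"

definition cofibrant_replacement ::
  "('o, 'a, 'm) category_scheme \<Rightarrow> ('a, 'n) model_structure_scheme \<Rightarrow>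
   ('o, 'a, 'k) replacement_scheme \<Rightarrow> bool" where
  "cofibrant_replacement C M Q \<longleftrightarrow> is_functor C C Q \<and>
     (\<forall>X\<in>Obj C. cofibrant C M (obmap Q X) \<and> repl Q X \<in> Hom C (obmap Q X) X \<inter> Fib M \<inter> Weq M) \<and>
     (\<forall>X\<in>Obj C. \<forall>Y\<in>Obj C. \<forall>f\<in>Hom C X Y. repl Q Y \<cdot>\<^bsub>C\<^esub> armap Q f = f \<cdot>\<^bsub>C\<^esub> repl Q X)"

subsection \<open>Smallness and cofibrant generation\<close>

definition ordinal_cat :: "'u rel \<Rightarrow> 'u \<Rightarrow> ('u, 'u \<times> 'u) category" where
  "ordinal_cat \<kappa> \<alpha> = \<lparr>Obj = underS \<kappa> \<alpha>, Arr = \<kappa> \<inter> (underS \<kappa> \<alpha> \<times> underS \<kappa> \<alpha>),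
     Dom = fst, Cod = snd, Ident = (\<lambda>\<beta>. (\<beta>, \<beta>)), Comp = (\<lambda>(\<gamma>, \<delta>) (\<beta>, _). (\<beta>, \<delta>))\<rparr>"

definition is_successor :: "'u rel \<Rightarrow> 'u \<Rightarrow> 'u \<Rightarrow> bool" where
  "is_successor \<kappa> \<beta> \<gamma> \<longleftrightarrow> \<beta> \<in> underS \<kappa> \<gamma> \<and> (\<forall>\<delta>. \<beta> \<in> underS \<kappa> \<delta> \<longrightarrow> (\<gamma>, \<delta>) \<in> \<kappa>)"

definition preserves_colimits ::
  "'u rel \<Rightarrow> ('i, 'j, 'm) category_scheme \<Rightarrow> ('o, 'a, 'n) category_scheme \<Rightarrow>
   ('i, 'j, 'o, 'a, 'k) funct_scheme \<Rightarrow> bool" where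
  "preserves_colimits \<kappa> J C X \<longleftrightarrow>
     (\<forall>(K :: ('u, 'u) category) (D :: ('u, 'u, 'i, 'j) funct) L \<iota>.
        small_cat \<kappa> K \<and> is_functor K J D \<and> is_colimit J K D L \<iota> \<longrightarrow>
        is_colimit C K (comp_funct X D) (obmap X L) (armap X \<circ> \<iota>))"

text \<open>The colimit of the sets \<open>C(A, X i)\<close>: their disjoint union modulo the equivalence relation
  generated by \<open>(i, g) \<sim> (k, X u \<cdot> g)\<close> for \<open>u : i \<rightarrow> k\<close>.\<close>

definition colim_Hom_rel ::
  "('o, 'a, 'm) category_scheme \<Rightarrow> 'o \<Rightarrow> ('i, 'j, 'n) category_scheme \<Rightarrow>
   ('i, 'j, 'o, 'a, 'k) funct_scheme \<Rightarrow> ('i \<times> 'a) rel" where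
  "colim_Hom_rel C A J X =
     {((Dom J u, g), (Cod J u, armap X u \<cdot>\<^bsub>C\<^esub> g)) | u g. u \<in> Arr J \<and> g \<in> Hom C A (obmap X (Dom J u))}"

definition colim_Hom ::
  "('o, 'a, 'm) category_scheme \<Rightarrow> 'o \<Rightarrow> ('i, 'j, 'n) category_scheme \<Rightarrow>
   ('i, 'j, 'o, 'a, 'k) funct_scheme \<Rightarrow> ('i \<times> 'a) set set" where
  "colim_Hom C A J X =
     (SIGMA i : Obj J. Hom C A (obmap X i)) // (colim_Hom_rel C A J X \<union> (colim_Hom_rel C A J X)\<inverse>)\<^sup>*"

text \<open>The map \<open>colim C(A, X i) \<rightarrow> C(A, colim X)\<close> induced by the cocone \<open>\<iota>\<close>; it is constant on the
  equivalence classes, which is what \<^const>\<open>the_elem\<close> relies on.\<close>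

definition colim_Hom_map ::
  "('o, 'a, 'm) category_scheme \<Rightarrow> ('i \<Rightarrow> 'a) \<Rightarrow> ('i \<times> 'a) set \<Rightarrow> 'a" where
  "colim_Hom_map C \<iota> k = the_elem ((\<lambda>(i, g). \<iota> i \<cdot>\<^bsub>C\<^esub> g) ` k)"

definition small_relative_to ::
  "'u rel \<Rightarrow> ('o, 'a, 'm) category_scheme \<Rightarrow> 'a set \<Rightarrow> 'o \<Rightarrow> bool" where
  "small_relative_to \<kappa> C S A \<longleftrightarrow> A \<in> Obj C \<and>
     (\<exists>\<Sigma>\<subseteq>Field \<kappa>. (\<forall>\<alpha>\<in>Field \<kappa>. \<exists>\<sigma>\<in>\<Sigma>. (\<alpha>, \<sigma>) \<in> \<kappa>) \<and>
       (\<forall>\<alpha>\<in>\<Sigma>. \<forall>X :: ('u, 'u \<times> 'u, 'o, 'a) funct.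
          is_functor (ordinal_cat \<kappa> \<alpha>) C X \<and> preserves_colimits \<kappa> (ordinal_cat \<kappa> \<alpha>) C X \<and>
          (\<forall>\<beta> \<gamma>. is_successor \<kappa> \<beta> \<gamma> \<and> \<gamma> \<in> underS \<kappa> \<alpha> \<longrightarrow> armap X (\<beta>, \<gamma>) \<in> S) \<longrightarrow>
          (\<forall>L \<iota>. is_colimit C (ordinal_cat \<kappa> \<alpha>) X L \<iota> \<longrightarrow>
             bij_betw (colim_Hom_map C \<iota>) (colim_Hom C A (ordinal_cat \<kappa> \<alpha>) X) (Hom C A L))))"

definition cofibrantly_generated ::
  "'u rel \<Rightarrow> ('o, 'a, 'm) category_scheme \<Rightarrow> ('a, 'n) model_structure_scheme \<Rightarrow> bool" where
  "cofibrantly_generated \<kappa> C M \<longleftrightarrow>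
     (\<exists>I J. I \<subseteq> Arr C \<and> J \<subseteq> Arr C \<and> |I| <o \<kappa> \<and> |J| <o \<kappa> \<and>
        (\<forall>i\<in>I. small_relative_to \<kappa> C (Cof M) (Dom C i)) \<and>
        (\<forall>j\<in>J. small_relative_to \<kappa> C (Cof M \<inter> Weq M) (Dom C j)) \<and>
        Fib M = rlp C J \<and> Fib M \<inter> Weq M = rlp C I)"

subsection \<open>Quillen equivalences\<close>

text \<open>These are conditions on the three classes of arrows. That they form model structures is
  stated separately by \<^locale>\<open>model_category\<close>.\<close>

definition left_Quillen ::
  "('o, 'a, 'm) category_scheme \<Rightarrow> ('a, 'n) model_structure_scheme \<Rightarrow>
   ('p, 'b, 'm') category_scheme \<Rightarrow> ('b, 'n') model_structure_scheme \<Rightarrow>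
   ('o, 'a, 'p, 'b, 'k) funct_scheme \<Rightarrow> ('p, 'b, 'o, 'a, 'l) funct_scheme \<Rightarrow>
   ('o \<Rightarrow> 'p \<Rightarrow> 'b \<Rightarrow> 'a) \<Rightarrow> bool" where
  "left_Quillen C M D N F U \<Phi> \<longleftrightarrow> adjunction C D F U \<Phi> \<and>
     (\<forall>f \<in> Cof M. armap F f \<in> Cof N) \<and>
     (\<forall>f \<in> Cof M \<inter> Weq M. armap F f \<in> Cof N \<inter> Weq N)"

definition Quillen_equivalence ::
  "('o, 'a, 'm) category_scheme \<Rightarrow> ('a, 'n) model_structure_scheme \<Rightarrow>
   ('p, 'b, 'm') category_scheme \<Rightarrow> ('b, 'n') model_structure_scheme \<Rightarrow>
   ('o, 'a, 'p, 'b, 'k) funct_scheme \<Rightarrow> ('p, 'b, 'o, 'a, 'l) funct_scheme \<Rightarrow>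
   ('o \<Rightarrow> 'p \<Rightarrow> 'b \<Rightarrow> 'a) \<Rightarrow> bool" where
  "Quillen_equivalence C M D N F U \<Phi> \<longleftrightarrow> left_Quillen C M D N F U \<Phi> \<and>
     (\<forall>X Y. cofibrant C M X \<and> fibrant D N Y \<longrightarrow>
        (\<forall>f\<in>Hom D (obmap F X) Y. f \<in> Weq N \<longleftrightarrow> \<Phi> X Y f \<in> Weq M))"

section \<open>Monoidal model categories\<close>

record ('o, 'a) monoidal = "('o, 'a) category" +
  Tensor :: "('o \<times> 'o, 'a \<times> 'a, 'o, 'a) funct"
  Unit :: 'o
  Assoc :: "'o \<Rightarrow> 'o \<Rightarrow> 'o \<Rightarrow> 'a"
  LUnit :: "'o \<Rightarrow> 'a"
  RUnit :: "'o \<Rightarrow> 'a"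

abbreviation tens_obj (infixr "\<otimes>\<index>" 70) where
  "X \<otimes>\<^bsub>C\<^esub> Y \<equiv> obmap (Tensor C) (X, Y)"

abbreviation tens_arr (infixr "\<boxtimes>\<index>" 70) where
  "f \<boxtimes>\<^bsub>C\<^esub> g \<equiv> armap (Tensor C) (f, g)"

locale monoidal_category = category C for C :: "('o, 'a, 'm) monoidal_scheme" (structure) +
  assumes Tensor_functor: "is_functor (prod_cat C C) C (Tensor C)"
    and Unit_in: "Unit C \<in> Obj C"
    and Assoc_in: "\<lbrakk>X \<in> Obj C; Y \<in> Obj C; Z \<in> Obj C\<rbrakk> \<Longrightarrow>
      Assoc C X Y Z \<in> Hom C ((X \<otimes> Y) \<otimes> Z) (X \<otimes> (Y \<otimes> Z)) \<and> is_iso C (Assoc C X Y Z)"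
    and LUnit_in: "X \<in> Obj C \<Longrightarrow> LUnit C X \<in> Hom C (Unit C \<otimes> X) X \<and> is_iso C (LUnit C X)"
    and RUnit_in: "X \<in> Obj C \<Longrightarrow> RUnit C X \<in> Hom C (X \<otimes> Unit C) X \<and> is_iso C (RUnit C X)"
    and Assoc_natural: "\<lbrakk>f \<in> Hom C X X'; g \<in> Hom C Y Y'; h \<in> Hom C Z Z'\<rbrakk> \<Longrightarrow>
      Assoc C X' Y' Z' \<cdot> ((f \<boxtimes> g) \<boxtimes> h) = (f \<boxtimes> (g \<boxtimes> h)) \<cdot> Assoc C X Y Z"
    and LUnit_natural: "f \<in> Hom C X X' \<Longrightarrow> LUnit C X' \<cdot> (Ident C (Unit C) \<boxtimes> f) = f \<cdot> LUnit C X"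
    and RUnit_natural: "f \<in> Hom C X X' \<Longrightarrow> RUnit C X' \<cdot> (f \<boxtimes> Ident C (Unit C)) = f \<cdot> RUnit C X"
    and pentagon: "\<lbrakk>W \<in> Obj C; X \<in> Obj C; Y \<in> Obj C; Z \<in> Obj C\<rbrakk> \<Longrightarrow>
      Assoc C W X (Y \<otimes> Z) \<cdot> Assoc C (W \<otimes> X) Y Z =
      (Ident C W \<boxtimes> Assoc C X Y Z) \<cdot> (Assoc C W (X \<otimes> Y) Z \<cdot> (Assoc C W X Y \<boxtimes> Ident C Z))"
    and triangle: "\<lbrakk>X \<in> Obj C; Y \<in> Obj C\<rbrakk> \<Longrightarrow>
      (Ident C X \<boxtimes> LUnit C Y) \<cdot> Assoc C X (Unit C) Y = RUnit C X \<boxtimes> Ident C Y"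

text \<open>\<open>T(X, -)\<close> has a right adjoint \<open>H(X, -)\<close>, naturally in \<open>X\<close>.\<close>

definition left_closed ::
  "('o, 'a, 'm) category_scheme \<Rightarrow> ('o \<times> 'o, 'a \<times> 'a, 'o, 'a) funct \<Rightarrow> bool" where
  "left_closed C T \<longleftrightarrow>
     (\<exists>(H :: ('o \<times> 'o, 'a \<times> 'a, 'o, 'a) funct) \<Phi>. is_functor (prod_cat (op_cat C) C) C H \<and>
        (\<forall>X\<in>Obj C. \<forall>Y\<in>Obj C. \<forall>Z\<in>Obj C.
           bij_betw (\<Phi> X Y Z) (Hom C (obmap T (X, Y)) Z) (Hom C Y (obmap H (X, Z)))) \<and>
        (\<forall>X\<in>Obj C. \<forall>Y\<in>Obj C. \<forall>Z\<in>Obj C. \<forall>X'\<in>Obj C. \<forall>Y'\<in>Obj C. \<forall>Z'\<in>Obj C.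
         \<forall>f\<in>Hom C X' X. \<forall>g\<in>Hom C Y' Y. \<forall>h\<in>Hom C Z Z'. \<forall>k\<in>Hom C (obmap T (X, Y)) Z.
           \<Phi> X' Y' Z' (h \<cdot>\<^bsub>C\<^esub> (k \<cdot>\<^bsub>C\<^esub> armap T (f, g))) = armap H (f, h) \<cdot>\<^bsub>C\<^esub> (\<Phi> X Y Z k \<cdot>\<^bsub>C\<^esub> g)))"

definition swap_funct :: "('o \<times> 'o, 'a \<times> 'a, 'o, 'a) funct \<Rightarrow> ('o \<times> 'o, 'a \<times> 'a, 'o, 'a) funct" where
  "swap_funct T = \<lparr>obmap = (\<lambda>(X, Y). obmap T (Y, X)), armap = (\<lambda>(f, g). armap T (g, f))\<rparr>"

definition pushout_product :: "('o, 'a, 'm) monoidal_scheme \<Rightarrow> 'a \<Rightarrow> 'a \<Rightarrow> 'a \<Rightarrow> bool" where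
  "pushout_product C f g h \<longleftrightarrow>
     (\<exists>i j. is_pushout C (Ident C (Dom C f) \<boxtimes>\<^bsub>C\<^esub> g) (f \<boxtimes>\<^bsub>C\<^esub> Ident C (Dom C g)) i j \<and>
        h \<in> Hom C (Cod C i) (Cod C f \<otimes>\<^bsub>C\<^esub> Cod C g) \<and>
        h \<cdot>\<^bsub>C\<^esub> i = f \<boxtimes>\<^bsub>C\<^esub> Ident C (Cod C g) \<and> h \<cdot>\<^bsub>C\<^esub> j = Ident C (Cod C f) \<boxtimes>\<^bsub>C\<^esub> g)"

locale monoidal_model_category = monoidal_category C + model_category C \<kappa> M
  for C :: "('o, 'a, 'm) monoidal_scheme" (structure) and \<kappa> :: "'u rel"
    and M :: "('a, 'n) model_structure_scheme" +
  fixes Q :: "('o, 'a, 'k) replacement_scheme"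
  assumes closed: "left_closed C (Tensor C)" "left_closed C (swap_funct (Tensor C))"
    and replacement: "cofibrant_replacement C M Q"
    and pushout_product_axiom: "\<lbrakk>f \<in> Cof M; g \<in> Cof M; pushout_product C f g h\<rbrakk> \<Longrightarrow>
      h \<in> Cof M \<and> (f \<in> Weq M \<or> g \<in> Weq M \<longrightarrow> h \<in> Weq M)"
    and unit_axiom: "cofibrant C M X \<Longrightarrow>
      LUnit C X \<cdot> (repl Q (Unit C) \<boxtimes> Ident C X) \<in> Weq M \<and>
      RUnit C X \<cdot> (Ident C X \<boxtimes> repl Q (Unit C)) \<in> Weq M"

text \<open>Structure maps \<open>F X \<otimes> F Y \<rightarrow> F (X \<otimes> Y)\<close> and \<open>Unit \<rightarrow> F Unit\<close>.\<close>

record ('o, 'a, 'p, 'b) monoidal_funct = "('o, 'a, 'p, 'b) funct" +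
  mult_map :: "'o \<Rightarrow> 'o \<Rightarrow> 'b"
  unit_map :: 'b

locale monoidal_functor =
  source: monoidal_category C + target: monoidal_category D + is_functor C D F
  for C :: "('o, 'a, 'm) monoidal_scheme" and D :: "('p, 'b, 'n) monoidal_scheme"
    and F :: "('o, 'a, 'p, 'b, 'k) monoidal_funct_scheme" +
  assumes mult_map_in: "\<lbrakk>X \<in> Obj C; Y \<in> Obj C\<rbrakk> \<Longrightarrow>
      mult_map F X Y \<in> Hom D (obmap F X \<otimes>\<^bsub>D\<^esub> obmap F Y) (obmap F (X \<otimes>\<^bsub>C\<^esub> Y)) \<and>
      is_iso D (mult_map F X Y)"
    and unit_map_in: "unit_map F \<in> Hom D (Unit D) (obmap F (Unit C))" "is_iso D (unit_map F)"
    and mult_map_natural: "\<lbrakk>f \<in> Hom C X X'; g \<in> Hom C Y Y'\<rbrakk> \<Longrightarrow>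
      mult_map F X' Y' \<cdot>\<^bsub>D\<^esub> (armap F f \<boxtimes>\<^bsub>D\<^esub> armap F g) = armap F (f \<boxtimes>\<^bsub>C\<^esub> g) \<cdot>\<^bsub>D\<^esub> mult_map F X Y"
    and mult_map_assoc: "\<lbrakk>X \<in> Obj C; Y \<in> Obj C; Z \<in> Obj C\<rbrakk> \<Longrightarrow>
      armap F (Assoc C X Y Z) \<cdot>\<^bsub>D\<^esub>
        (mult_map F (X \<otimes>\<^bsub>C\<^esub> Y) Z \<cdot>\<^bsub>D\<^esub> (mult_map F X Y \<boxtimes>\<^bsub>D\<^esub> Ident D (obmap F Z))) =
      mult_map F X (Y \<otimes>\<^bsub>C\<^esub> Z) \<cdot>\<^bsub>D\<^esub>
        ((Ident D (obmap F X) \<boxtimes>\<^bsub>D\<^esub> mult_map F Y Z) \<cdot>\<^bsub>D\<^esub>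
          Assoc D (obmap F X) (obmap F Y) (obmap F Z))"
    and unit_map_left: "X \<in> Obj C \<Longrightarrow>
      armap F (LUnit C X) \<cdot>\<^bsub>D\<^esub>
        (mult_map F (Unit C) X \<cdot>\<^bsub>D\<^esub> (unit_map F \<boxtimes>\<^bsub>D\<^esub> Ident D (obmap F X))) = LUnit D (obmap F X)"
    and unit_map_right: "X \<in> Obj C \<Longrightarrow>
      armap F (RUnit C X) \<cdot>\<^bsub>D\<^esub>
        (mult_map F X (Unit C) \<cdot>\<^bsub>D\<^esub> (Ident D (obmap F X) \<boxtimes>\<^bsub>D\<^esub> unit_map F)) = RUnit D (obmap F X)"

definition monoidal_Quillen_functor ::
  "('o, 'a, 'm) monoidal_scheme \<Rightarrow> ('a, 'n) model_structure_scheme \<Rightarrow> ('o, 'a, 'q) replacement_scheme \<Rightarrow>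
   ('p, 'b, 'm') monoidal_scheme \<Rightarrow> ('b, 'n') model_structure_scheme \<Rightarrow>
   ('o, 'a, 'p, 'b, 'k) monoidal_funct_scheme \<Rightarrow> ('p, 'b, 'o, 'a, 'l) funct_scheme \<Rightarrow>
   ('o \<Rightarrow> 'p \<Rightarrow> 'b \<Rightarrow> 'a) \<Rightarrow> bool" where
  "monoidal_Quillen_functor C M Q D N F U \<Phi> \<longleftrightarrow>
     left_Quillen C M D N F U \<Phi> \<and> monoidal_functor C D F \<and>
     inv_arr D (unit_map F) \<cdot>\<^bsub>D\<^esub> armap F (repl Q (Unit C)) \<in> Weq N"

definition monoidal_Quillen_equivalence ::
  "('o, 'a, 'm) monoidal_scheme \<Rightarrow> ('a, 'n) model_structure_scheme \<Rightarrow> ('o, 'a, 'q) replacement_scheme \<Rightarrow>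
   ('p, 'b, 'm') monoidal_scheme \<Rightarrow> ('b, 'n') model_structure_scheme \<Rightarrow>
   ('o, 'a, 'p, 'b, 'k) monoidal_funct_scheme \<Rightarrow> ('p, 'b, 'o, 'a, 'l) funct_scheme \<Rightarrow>
   ('o \<Rightarrow> 'p \<Rightarrow> 'b \<Rightarrow> 'a) \<Rightarrow> bool" where
  "monoidal_Quillen_equivalence C M Q D N F U \<Phi> \<longleftrightarrow>
     monoidal_Quillen_functor C M Q D N F U \<Phi> \<and> Quillen_equivalence C M D N F U \<Phi>"

section \<open>Monoids and modules\<close>

record ('o, 'a) monoid_data =
  Carrier :: 'o
  Mult :: 'a
  One :: 'a

locale monoid_object = monoidal_category C for C :: "('o, 'a, 'm) monoidal_scheme" (structure) +
  fixes A :: "('o, 'a, 'n) monoid_data_scheme"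
  assumes Carrier_in: "Carrier A \<in> Obj C"
    and Mult_in: "Mult A \<in> Hom C (Carrier A \<otimes> Carrier A) (Carrier A)"
    and One_in: "One A \<in> Hom C (Unit C) (Carrier A)"
    and Mult_assoc: "Mult A \<cdot> (Mult A \<boxtimes> Ident C (Carrier A)) =
      Mult A \<cdot> ((Ident C (Carrier A) \<boxtimes> Mult A) \<cdot> Assoc C (Carrier A) (Carrier A) (Carrier A))"
    and One_left: "Mult A \<cdot> (One A \<boxtimes> Ident C (Carrier A)) = LUnit C (Carrier A)"
    and One_right: "Mult A \<cdot> (Ident C (Carrier A) \<boxtimes> One A) = RUnit C (Carrier A)"

definition left_module ::
  "('o, 'a, 'm) monoidal_scheme \<Rightarrow> ('o, 'a, 'n) monoid_data_scheme \<Rightarrow> 'o \<times> 'a \<Rightarrow> bool" where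
  "left_module C A = (\<lambda>(X, a). X \<in> Obj C \<and> a \<in> Hom C (Carrier A \<otimes>\<^bsub>C\<^esub> X) X \<and>
     a \<cdot>\<^bsub>C\<^esub> (Mult A \<boxtimes>\<^bsub>C\<^esub> Ident C X) =
       a \<cdot>\<^bsub>C\<^esub> ((Ident C (Carrier A) \<boxtimes>\<^bsub>C\<^esub> a) \<cdot>\<^bsub>C\<^esub> Assoc C (Carrier A) (Carrier A) X) \<and>
     a \<cdot>\<^bsub>C\<^esub> (One A \<boxtimes>\<^bsub>C\<^esub> Ident C X) = LUnit C X)"

text \<open>An arrow of modules is a triple of its source, its target and the underlying arrow.\<close>

definition module_cat ::
  "('o, 'a, 'm) monoidal_scheme \<Rightarrow> ('o, 'a, 'n) monoid_data_scheme \<Rightarrow>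
   ('o \<times> 'a, ('o \<times> 'a) \<times> ('o \<times> 'a) \<times> 'a) category" where
  "module_cat C A = \<lparr>Obj = {X. left_module C A X},
     Arr = {(X, Y, f). left_module C A X \<and> left_module C A Y \<and> f \<in> Hom C (fst X) (fst Y) \<and>
       f \<cdot>\<^bsub>C\<^esub> snd X = snd Y \<cdot>\<^bsub>C\<^esub> (Ident C (Carrier A) \<boxtimes>\<^bsub>C\<^esub> f)},
     Dom = (\<lambda>(X, Y, f). X), Cod = (\<lambda>(X, Y, f). Y),
     Ident = (\<lambda>X. (X, X, Ident C (fst X))),
     Comp = (\<lambda>(Y, Z, g) (X, _, f). (X, Z, g \<cdot>\<^bsub>C\<^esub> f))\<rparr>"

text \<open>The cofibrations of a model structure are determined by the other two classes as the maps
  with the left lifting property with respect to the trivial fibrations.\<close>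

definition module_model ::
  "('o, 'a, 'm) monoidal_scheme \<Rightarrow> ('a, 'k) model_structure_scheme \<Rightarrow> ('o, 'a, 'n) monoid_data_scheme \<Rightarrow>
   (('o \<times> 'a) \<times> ('o \<times> 'a) \<times> 'a) model_structure" where
  "module_model C M A =
     (let W = {(X, Y, f) \<in> Arr (module_cat C A). f \<in> Weq M};
          P = {(X, Y, f) \<in> Arr (module_cat C A). f \<in> Fib M}
      in \<lparr>Weq = W, Cof = llp (module_cat C A) (P \<inter> W), Fib = P\<rparr>)"

definition image_monoid ::
  "('o, 'a, 'p, 'b, 'k) monoidal_funct_scheme \<Rightarrow> ('p, 'b, 'm) monoidal_scheme \<Rightarrow>
   ('o, 'a, 'n) monoid_data_scheme \<Rightarrow> ('p, 'b) monoid_data" where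
  "image_monoid F D A = \<lparr>Carrier = obmap F (Carrier A),
     Mult = armap F (Mult A) \<cdot>\<^bsub>D\<^esub> mult_map F (Carrier A) (Carrier A),
     One = armap F (One A) \<cdot>\<^bsub>D\<^esub> unit_map F\<rparr>"

definition image_module ::
  "('o, 'a, 'p, 'b, 'k) monoidal_funct_scheme \<Rightarrow> ('p, 'b, 'm) monoidal_scheme \<Rightarrow>
   ('o, 'a, 'n) monoid_data_scheme \<Rightarrow> 'o \<times> 'a \<Rightarrow> 'p \<times> 'b" where
  "image_module F D A = (\<lambda>(X, a). (obmap F X, armap F a \<cdot>\<^bsub>D\<^esub> mult_map F (Carrier A) X))"

definition module_funct ::
  "('o, 'a, 'p, 'b, 'k) monoidal_funct_scheme \<Rightarrow> ('p, 'b, 'm) monoidal_scheme \<Rightarrow>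
   ('o, 'a, 'n) monoid_data_scheme \<Rightarrow>
   ('o \<times> 'a, ('o \<times> 'a) \<times> ('o \<times> 'a) \<times> 'a, 'p \<times> 'b, ('p \<times> 'b) \<times> ('p \<times> 'b) \<times> 'b) funct" where
  "module_funct F D A = \<lparr>obmap = image_module F D A,
     armap = (\<lambda>(X, Y, f). (image_module F D A X, image_module F D A Y, armap F f))\<rparr>"

end

theory Submission
  imports Defs
begin

text \<open>
  The theorem reduces to statements about underlying objects, and no small object argument is
  needed. Let \<open>A\<close> be a monoid that is cofibrant as an object, and let \<open>U\<close> be right adjoint to \<open>F\<close>.

  The right adjoint of \<open>F : A-mod \<rightarrow> FA-mod\<close> is \<open>U\<close> on underlying objects, with \<open>A\<close> acting on \<open>U Y\<close> by the
  transpose of \<open>F A \<otimes> F U Y \<rightarrow> F A \<otimes> Y \<rightarrow> Y\<close>; the adjunction bijection for modules is the restriction of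
  the one for objects (\<open>module_funct_couniversal\<close>). As \<open>U\<close> preserves trivial fibrations, so does its
  version for modules, and hence \<open>F\<close> preserves the cofibrations of modules, which are defined by lifting.

  The point where the cofibrancy of \<open>A\<close> enters is that the forgetful functor \<open>A-mod \<rightarrow> C\<close> preserves
  cofibrations (\<open>forget_Cof\<close>). It has a right adjoint, the cofree module functor, which
  takes \<open>E\<close> to the internal hom \<open>[A, E]\<close> (\<open>cofree_couniversal\<close>). Since \<open>A\<close> is cofibrant,
  \<open>A \<otimes> -\<close> preserves cofibrations by the pushout product axiom, so \<open>[A, -]\<close> preserves trivial fibrations,
  and the claim follows by transposing lifting problems (\<open>has_lift_transpose\<close>).

  Consequently a trivial cofibration of modules is a trivial cofibration of \<open>C\<close>, so \<open>F\<close> takes it to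
  a weak equivalence. The forgetful functor also preserves initial objects, being a left adjoint, so
  a cofibrant module is cofibrant in \<open>C\<close>; dually, a terminal module lies over a terminal
  object, so a fibrant \<open>F A\<close>-module is fibrant in \<open>D\<close>. The criterion for a Quillen equivalence of
  modules is then the criterion for \<open>F\<close> and \<open>U\<close> applied to underlying objects.
\<close>

section \<open>Composition of arrows\<close>

text \<open>The domains and codomains of arrows are computed by simplification: the rules below replace
  membership in \<^const>\<open>Hom\<close>, whose objects do not occur in the terms to be rewritten, by conditions on
  \<^const>\<open>Dom\<close> and \<^const>\<open>Cod\<close>.\<close>

context category
begin

lemma Comp_Arr [simp]:
  assumes "f \<in> Arr C" "g \<in> Arr C" "Cod C f = Dom C g"
  shows "g \<cdot> f \<in> Arr C" "Dom C (g \<cdot> f) = Dom C f" "Cod C (g \<cdot> f) = Cod C g"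
  using Comp_in[of f "Dom C f" "Cod C f" g "Cod C g"] assms by (auto simp: Hom_def)

lemma Ident_Arr [simp]:
  assumes "X \<in> Obj C"
  shows "Ident C X \<in> Arr C" "Dom C (Ident C X) = X" "Cod C (Ident C X) = X"
  using Ident_in[OF assms] by (auto simp: Hom_def)

lemma Comp_Ident_Arr [simp]: "f \<in> Arr C \<Longrightarrow> Dom C f = X \<Longrightarrow> f \<cdot> Ident C X = f"
  by (rule Comp_Ident[of f X "Cod C f"]) (simp add: Hom_def)

lemma Ident_Comp_Arr [simp]: "f \<in> Arr C \<Longrightarrow> Cod C f = X \<Longrightarrow> Ident C X \<cdot> f = f"
  by (rule Ident_Comp[of f "Dom C f"]) (simp add: Hom_def)

lemma Comp_assoc_Arr:
  assumes "f \<in> Arr C" "g \<in> Arr C" "h \<in> Arr C" "Cod C f = Dom C g" "Cod C g = Dom C h"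
  shows "(h \<cdot> g) \<cdot> f = h \<cdot> (g \<cdot> f)"
  by (rule Comp_assoc[of f "Dom C f" "Cod C f" g "Cod C g" h "Cod C h"])
    (use assms in \<open>auto simp: Hom_def\<close>)

lemmas Dom_Cod_Obj [simp] = Dom_in Cod_in

lemma Hom_Obj: "f \<in> Hom C X Y \<Longrightarrow> X \<in> Obj C \<and> Y \<in> Obj C"
  by (auto simp: Hom_def)

lemma inv_arr_inverse_arrows:
  assumes "is_iso C f"
  shows "inverse_arrows C f (inv_arr C f)"
proof -
  obtain g where g: "inverse_arrows C f g" using assms by (auto simp: is_iso_def)
  have "h = g" if h: "inverse_arrows C f h" for h
  proof -
    have "h = h \<cdot> (f \<cdot> g)" using g h by (simp add: inverse_arrows_def Hom_def)
    also have "\<dots> = (h \<cdot> f) \<cdot> g"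
      using g h by (intro Comp_assoc_Arr[symmetric]) (auto simp: inverse_arrows_def Hom_def)
    also have "\<dots> = g" using g h by (simp add: inverse_arrows_def Hom_def)
    finally show ?thesis .
  qed
  then show ?thesis using g unfolding inv_arr_def by (metis theI)
qed

lemma inv_arr_Arr [simp]:
  assumes "is_iso C f"
  shows "inv_arr C f \<in> Arr C" "Dom C (inv_arr C f) = Cod C f" "Cod C (inv_arr C f) = Dom C f"
    "inv_arr C f \<cdot> f = Ident C (Dom C f)" "f \<cdot> inv_arr C f = Ident C (Cod C f)"
  using inv_arr_inverse_arrows[OF assms] by (auto simp: inverse_arrows_def Hom_def)

lemma iso_cancel_right:
  assumes "is_iso C e" "e \<in> Hom C W X" "f \<in> Hom C X Y" "g \<in> Hom C X Y" "f \<cdot> e = g \<cdot> e"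
  shows "f = g"
proof -
  have "f = (f \<cdot> e) \<cdot> inv_arr C e"
    using assms(1-4) by (simp add: Hom_def Comp_assoc_Arr)
  also have "\<dots> = (g \<cdot> e) \<cdot> inv_arr C e" by (simp add: assms(5))
  also have "\<dots> = g" using assms(1-4) by (simp add: Hom_def Comp_assoc_Arr)
  finally show ?thesis .
qed

lemma is_iso_Comp:
  assumes "is_iso C f" "is_iso C g" "f \<in> Hom C X Y" "g \<in> Hom C Y Z"
  shows "is_iso C (g \<cdot> f)"
proof -
  have "inverse_arrows C (g \<cdot> f) (inv_arr C f \<cdot> inv_arr C g)"
  proof -
    have "(inv_arr C f \<cdot> inv_arr C g) \<cdot> (g \<cdot> f) = inv_arr C f \<cdot> ((inv_arr C g \<cdot> g) \<cdot> f)"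
      using assms(3,4) assms(1,2)[THEN inv_arr_Arr(1)] assms(1,2)[THEN inv_arr_Arr(2)]
        assms(1,2)[THEN inv_arr_Arr(3)]
      by (simp add: Hom_def Comp_assoc_Arr del: inv_arr_Arr)
    moreover have "(g \<cdot> f) \<cdot> (inv_arr C f \<cdot> inv_arr C g) = g \<cdot> ((f \<cdot> inv_arr C f) \<cdot> inv_arr C g)"
      using assms(3,4) assms(1,2)[THEN inv_arr_Arr(1)] assms(1,2)[THEN inv_arr_Arr(2)]
        assms(1,2)[THEN inv_arr_Arr(3)]
      by (simp add: Hom_def Comp_assoc_Arr del: inv_arr_Arr)
    ultimately show ?thesis using assms by (simp add: inverse_arrows_def Hom_def)
  qed
  then show ?thesis by (auto simp: is_iso_def)
qed

end

context is_functor
begin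

lemma armap_Arr [simp]:
  assumes "f \<in> Arr C"
  shows "armap F f \<in> Arr D" "Dom D (armap F f) = obmap F (Dom C f)"
    "Cod D (armap F f) = obmap F (Cod C f)"
  using armap_in[of f "Dom C f" "Cod C f"] assms by (auto simp: Hom_def)

lemmas obmap_Obj [simp] = obmap_in
lemmas armap_Ident_Obj [simp] = armap_Ident

lemma armap_Comp_Arr:
  assumes "f \<in> Arr C" "g \<in> Arr C" "Cod C f = Dom C g"
  shows "armap F (g \<cdot>\<^bsub>C\<^esub> f) = armap F g \<cdot>\<^bsub>D\<^esub> armap F f"
  by (rule armap_Comp[of f "Dom C f" "Cod C f" g "Cod C g"]) (use assms in \<open>auto simp: Hom_def\<close>)

end

section \<open>Couniversal arrows\<close>

text \<open>A couniversal arrow \<open>\<epsilon> : F P \<rightarrow> Y\<close> from the functor \<open>F\<close> to the object \<open>Y\<close>: the value at \<open>Y\<close> of a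
  right adjoint of \<open>F\<close>, with its counit.\<close>

definition couniversal ::
  "('o, 'a, 'm) category_scheme \<Rightarrow> ('p, 'b, 'n) category_scheme \<Rightarrow>
   ('o, 'a, 'p, 'b, 'k) funct_scheme \<Rightarrow> 'p \<Rightarrow> 'o \<Rightarrow> 'b \<Rightarrow> bool" where
  "couniversal C D F Y P \<epsilon> \<longleftrightarrow> P \<in> Obj C \<and> \<epsilon> \<in> Hom D (obmap F P) Y \<and>
     (\<forall>X\<in>Obj C. \<forall>k\<in>Hom D (obmap F X) Y. \<exists>!g. g \<in> Hom C X P \<and> \<epsilon> \<cdot>\<^bsub>D\<^esub> armap F g = k)"

lemma couniversalD:
  assumes "couniversal C D F Y P \<epsilon>"
  shows "P \<in> Obj C" "\<epsilon> \<in> Hom D (obmap F P) Y"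
  using assms by (auto simp: couniversal_def)

lemma couniversal_exists:
  assumes "couniversal C D F Y P \<epsilon>" "X \<in> Obj C" "k \<in> Hom D (obmap F X) Y"
  obtains g where "g \<in> Hom C X P" "\<epsilon> \<cdot>\<^bsub>D\<^esub> armap F g = k"
  using assms unfolding couniversal_def by blast

context is_functor
begin

lemma couniversal_unique:
  assumes "couniversal C D F Y P \<epsilon>" "g \<in> Hom C X P" "g' \<in> Hom C X P"
    "\<epsilon> \<cdot>\<^bsub>D\<^esub> armap F g = \<epsilon> \<cdot>\<^bsub>D\<^esub> armap F g'"
  shows "g = g'"
proof -
  have "X \<in> Obj C" using assms(2) source.Hom_Obj by blast
  moreover have "\<epsilon> \<cdot>\<^bsub>D\<^esub> armap F g' \<in> Hom D (obmap F X) Y"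
    using assms(1,3) by (simp add: couniversal_def Hom_def)
  ultimately show ?thesis using assms unfolding couniversal_def by blast
qed

lemma initial_obmap:
  assumes univ: "\<And>Y. Y \<in> Obj D \<Longrightarrow> \<exists>P \<epsilon>. couniversal C D F Y P \<epsilon>"
    and Z: "initial C Z"
  shows "initial D (obmap F Z)"
  unfolding initial_def
proof (intro conjI ballI)
  show "obmap F Z \<in> Obj D" using Z by (simp add: initial_def)
next
  fix Y assume Y: "Y \<in> Obj D"
  obtain P \<epsilon> where P: "couniversal C D F Y P \<epsilon>" using univ[OF Y] by blast
  obtain g where g: "g \<in> Hom C Z P" and g_unique: "\<And>g'. g' \<in> Hom C Z P \<Longrightarrow> g' = g"
    using Z couniversalD(1)[OF P] unfolding initial_def by blast
  show "\<exists>!f. f \<in> Hom D (obmap F Z) Y"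
  proof (rule ex1I)
    show "\<epsilon> \<cdot>\<^bsub>D\<^esub> armap F g \<in> Hom D (obmap F Z) Y"
      using couniversalD[OF P] g by (simp add: Hom_def)
  next
    fix f assume "f \<in> Hom D (obmap F Z) Y"
    then show "f = \<epsilon> \<cdot>\<^bsub>D\<^esub> armap F g"
      using couniversal_exists[OF P] g_unique Z unfolding initial_def by metis
  qed
qed

text \<open>Transposition matches the solutions of the two lifting problems: those for \<open>F i\<close> against \<open>p\<close>, and
  those for \<open>i\<close> against the image \<open>q\<close> of \<open>p\<close> under the right adjoint.\<close>

lemma has_lift_transpose:
  assumes i: "i \<in> Arr C" and p: "p \<in> Hom D E B"
    and E: "couniversal C D F E P \<epsilon>" and B: "couniversal C D F B P' \<epsilon>'"
    and q: "q \<in> Hom C P P'" and eq: "\<epsilon>' \<cdot>\<^bsub>D\<^esub> armap F q = p \<cdot>\<^bsub>D\<^esub> \<epsilon>"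
  shows "has_lift D (armap F i) p \<longleftrightarrow> has_lift C i q"
proof
  note [simp] = Hom_def source.Comp_assoc_Arr target.Comp_assoc_Arr armap_Comp_Arr
  note facts = i p q couniversalD[OF E] couniversalD[OF B]
  have eq2: "\<epsilon>' \<cdot>\<^bsub>D\<^esub> (armap F q \<cdot>\<^bsub>D\<^esub> x) = p \<cdot>\<^bsub>D\<^esub> (\<epsilon> \<cdot>\<^bsub>D\<^esub> x)"
    if "x \<in> Arr D" "Cod D x = obmap F P" for x
    using that facts target.Comp_assoc_Arr[of x "armap F q" \<epsilon>'] target.Comp_assoc_Arr[of x \<epsilon> p] eq
    by simp
  {
    assume lift: "has_lift D (armap F i) p"
    show "has_lift C i q"
      unfolding has_lift_def
    proof (intro ballI impI)
      fix u v assume u: "u \<in> Hom C (Dom C i) (Dom C q)" and v: "v \<in> Hom C (Cod C i) (Cod C q)"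
        and sq: "q \<cdot>\<^bsub>C\<^esub> u = v \<cdot>\<^bsub>C\<^esub> i"
      have "p \<cdot>\<^bsub>D\<^esub> (\<epsilon> \<cdot>\<^bsub>D\<^esub> armap F u) = \<epsilon>' \<cdot>\<^bsub>D\<^esub> armap F (q \<cdot>\<^bsub>C\<^esub> u)"
        using facts u eq2 by simp
      also have "\<dots> = (\<epsilon>' \<cdot>\<^bsub>D\<^esub> armap F v) \<cdot>\<^bsub>D\<^esub> armap F i"
        using facts v unfolding sq by simp
      finally have "p \<cdot>\<^bsub>D\<^esub> (\<epsilon> \<cdot>\<^bsub>D\<^esub> armap F u) = (\<epsilon>' \<cdot>\<^bsub>D\<^esub> armap F v) \<cdot>\<^bsub>D\<^esub> armap F i" .
      then obtain k where k: "k \<in> Hom D (obmap F (Cod C i)) E" "k \<cdot>\<^bsub>D\<^esub> armap F i = \<epsilon> \<cdot>\<^bsub>D\<^esub> armap F u"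
          "p \<cdot>\<^bsub>D\<^esub> k = \<epsilon>' \<cdot>\<^bsub>D\<^esub> armap F v"
        using lift[unfolded has_lift_def, rule_format, of "\<epsilon> \<cdot>\<^bsub>D\<^esub> armap F u" "\<epsilon>' \<cdot>\<^bsub>D\<^esub> armap F v"] facts u v
        by auto
      obtain h where h: "h \<in> Hom C (Cod C i) P" "\<epsilon> \<cdot>\<^bsub>D\<^esub> armap F h = k"
        using couniversal_exists[OF E _ k(1)] i by auto
      have "h \<cdot>\<^bsub>C\<^esub> i = u"
        by (rule couniversal_unique[OF E, of _ "Dom C i"])
          (use facts u h k target.Comp_assoc_Arr[of "armap F i" "armap F h" \<epsilon>] in auto)
      moreover have "q \<cdot>\<^bsub>C\<^esub> h = v"
        by (rule couniversal_unique[OF B, of _ "Cod C i"])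
          (use facts v h k eq2 in auto)
      ultimately show "\<exists>h\<in>Hom C (Cod C i) (Dom C q). h \<cdot>\<^bsub>C\<^esub> i = u \<and> q \<cdot>\<^bsub>C\<^esub> h = v"
        using h q by auto
    qed
  next
    assume lift: "has_lift C i q"
    show "has_lift D (armap F i) p"
      unfolding has_lift_def
    proof (intro ballI impI)
      fix u v assume u: "u \<in> Hom D (Dom D (armap F i)) (Dom D p)"
        and v: "v \<in> Hom D (Cod D (armap F i)) (Cod D p)"
        and sq: "p \<cdot>\<^bsub>D\<^esub> u = v \<cdot>\<^bsub>D\<^esub> armap F i"
      obtain u' where u': "u' \<in> Hom C (Dom C i) P" "\<epsilon> \<cdot>\<^bsub>D\<^esub> armap F u' = u"
        using couniversal_exists[OF E, of "Dom C i" u] u facts by auto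
      obtain v' where v': "v' \<in> Hom C (Cod C i) P'" "\<epsilon>' \<cdot>\<^bsub>D\<^esub> armap F v' = v"
        using couniversal_exists[OF B, of "Cod C i" v] v facts by auto
      have "q \<cdot>\<^bsub>C\<^esub> u' = v' \<cdot>\<^bsub>C\<^esub> i"
        by (rule couniversal_unique[OF B, of _ "Dom C i"])
          (use facts u' v' sq eq2 target.Comp_assoc_Arr[of "armap F i" "armap F v'" \<epsilon>'] in auto)
      then obtain h where h: "h \<in> Hom C (Cod C i) P" "h \<cdot>\<^bsub>C\<^esub> i = u'" "q \<cdot>\<^bsub>C\<^esub> h = v'"
        using lift[unfolded has_lift_def, rule_format, of u' v'] facts u' v' by auto
      have "(\<epsilon> \<cdot>\<^bsub>D\<^esub> armap F h) \<cdot>\<^bsub>D\<^esub> armap F i = \<epsilon> \<cdot>\<^bsub>D\<^esub> armap F (h \<cdot>\<^bsub>C\<^esub> i)"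
        using facts h(1) by simp
      then have "(\<epsilon> \<cdot>\<^bsub>D\<^esub> armap F h) \<cdot>\<^bsub>D\<^esub> armap F i = u" unfolding h(2) u'(2) .
      moreover have "p \<cdot>\<^bsub>D\<^esub> (\<epsilon> \<cdot>\<^bsub>D\<^esub> armap F h) = \<epsilon>' \<cdot>\<^bsub>D\<^esub> armap F (q \<cdot>\<^bsub>C\<^esub> h)"
        using facts h(1) eq2 by simp
      then have "p \<cdot>\<^bsub>D\<^esub> (\<epsilon> \<cdot>\<^bsub>D\<^esub> armap F h) = v" unfolding h(3) v'(2) .
      ultimately show "\<exists>k\<in>Hom D (Cod D (armap F i)) (Dom D p). k \<cdot>\<^bsub>D\<^esub> armap F i = u \<and> p \<cdot>\<^bsub>D\<^esub> k = v"
        using facts h(1) by (intro bexI[of _ "\<epsilon> \<cdot>\<^bsub>D\<^esub> armap F h"]) auto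
    qed
  }
qed

end


lemma adjunction_couniversal:
  assumes adj: "adjunction C D F U \<Phi>" and Y: "Y \<in> Obj D"
  shows "\<exists>\<epsilon>. couniversal C D F Y (obmap U Y) \<epsilon> \<and>
    (\<forall>X\<in>Obj C. \<forall>f\<in>Hom D (obmap F X) Y.
       \<Phi> X Y f \<in> Hom C X (obmap U Y) \<and> \<epsilon> \<cdot>\<^bsub>D\<^esub> armap F (\<Phi> X Y f) = f)"
proof -
  interpret F: is_functor C D F using adj by (simp add: adjunction_def)
  interpret U: is_functor D C U using adj by (simp add: adjunction_def)
  have bij: "bij_betw (\<Phi> X Y) (Hom D (obmap F X) Y) (Hom C X (obmap U Y))" if "X \<in> Obj C" for X
    using adj Y that by (simp add: adjunction_def)
  have nat: "\<Phi> X' Y (Ident D Y \<cdot>\<^bsub>D\<^esub> (h \<cdot>\<^bsub>D\<^esub> armap F f)) = armap U (Ident D Y) \<cdot>\<^bsub>C\<^esub> (\<Phi> X Y h \<cdot>\<^bsub>C\<^esub> f)"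
    if "f \<in> Hom C X' X" "h \<in> Hom D (obmap F X) Y" for X X' f h
    using adj Y that F.source.Hom_Obj[OF that(1)] F.target.Ident_in[OF Y]
    unfolding adjunction_def by blast
  obtain \<epsilon> where \<epsilon>: "\<epsilon> \<in> Hom D (obmap F (obmap U Y)) Y"
      and \<epsilon>_Ident: "\<Phi> (obmap U Y) Y \<epsilon> = Ident C (obmap U Y)"
    using bij[OF U.obmap_in[OF Y]] F.source.Ident_in[OF U.obmap_in[OF Y]]
    by (metis bij_betw_imp_surj_on imageE)
  have transpose: "\<Phi> X Y (\<epsilon> \<cdot>\<^bsub>D\<^esub> armap F g) = g" if g: "g \<in> Hom C X (obmap U Y)" for X g
    using nat[OF g \<epsilon>] g \<epsilon> Y by (simp add: \<epsilon>_Ident Hom_def)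
  have transpose_inv: "\<Phi> X Y f \<in> Hom C X (obmap U Y) \<and> \<epsilon> \<cdot>\<^bsub>D\<^esub> armap F (\<Phi> X Y f) = f"
    if X: "X \<in> Obj C" and f: "f \<in> Hom D (obmap F X) Y" for X f
  proof
    show in_Hom: "\<Phi> X Y f \<in> Hom C X (obmap U Y)" using bij_betwE[OF bij[OF X]] f by blast
    have "\<epsilon> \<cdot>\<^bsub>D\<^esub> armap F (\<Phi> X Y f) \<in> Hom D (obmap F X) Y"
      using in_Hom \<epsilon> by (simp add: Hom_def)
    then show "\<epsilon> \<cdot>\<^bsub>D\<^esub> armap F (\<Phi> X Y f) = f"
      using bij_betw_imp_inj_on[OF bij[OF X]] f transpose[OF in_Hom] by (simp add: inj_on_def)
  qed
  have "couniversal C D F Y (obmap U Y) \<epsilon>"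
    unfolding couniversal_def
  proof (intro conjI ballI)
    fix X k assume "X \<in> Obj C" "k \<in> Hom D (obmap F X) Y"
    then show "\<exists>!g. g \<in> Hom C X (obmap U Y) \<and> \<epsilon> \<cdot>\<^bsub>D\<^esub> armap F g = k"
      using transpose transpose_inv by metis
  qed (use \<epsilon> Y in auto)
  then show ?thesis using transpose_inv by blast
qed

text \<open>Conversely, couniversal arrows to all objects assemble into a right adjoint.\<close>

lemma (in is_functor) couniversal_adjunction:
  assumes univ: "\<And>Y. Y \<in> Obj D \<Longrightarrow> couniversal C D F Y (P Y) (\<epsilon> Y)"
  shows "\<exists>(U :: ('p, 'b, 'o, 'a) funct) \<Phi>. adjunction C D F U \<Phi> \<and>
    (\<forall>X\<in>Obj C. \<forall>Y\<in>Obj D. \<forall>f\<in>Hom D (obmap F X) Y.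
       \<Phi> X Y f \<in> Hom C X (P Y) \<and> \<epsilon> Y \<cdot>\<^bsub>D\<^esub> armap F (\<Phi> X Y f) = f)"
proof -
  note [simp] = Hom_def source.Comp_assoc_Arr target.Comp_assoc_Arr armap_Comp_Arr
  \<comment> \<open>\<open>\<Phi> X Y f\<close> is the transpose of \<open>f\<close>, and \<open>U g\<close> is the transpose of \<open>g \<cdot> \<epsilon>\<close>.\<close>
  define \<Phi> where "\<Phi> X Y f = (THE g. g \<in> Hom C X (P Y) \<and> \<epsilon> Y \<cdot>\<^bsub>D\<^esub> armap F g = f)" for X Y f
  define U :: "('p, 'b, 'o, 'a) funct" where
    "U = \<lparr>obmap = P, armap = (\<lambda>g. \<Phi> (P (Dom D g)) (Cod D g) (g \<cdot>\<^bsub>D\<^esub> \<epsilon> (Dom D g)))\<rparr>"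
  have P: "P Y \<in> Obj C" "\<epsilon> Y \<in> Arr D" "Dom D (\<epsilon> Y) = obmap F (P Y)" "Cod D (\<epsilon> Y) = Y"
    if "Y \<in> Obj D" for Y
    using couniversalD[OF univ[OF that]] by auto
  have \<Phi>: "\<Phi> X Y f \<in> Hom C X (P Y) \<and> \<epsilon> Y \<cdot>\<^bsub>D\<^esub> armap F (\<Phi> X Y f) = f"
    if "X \<in> Obj C" "Y \<in> Obj D" "f \<in> Hom D (obmap F X) Y" for X Y f
    unfolding \<Phi>_def by (rule theI') (use univ that in \<open>unfold couniversal_def, blast\<close>)
  have U_arr: "armap U g \<in> Hom C (P Y) (P Y')" "\<epsilon> Y' \<cdot>\<^bsub>D\<^esub> armap F (armap U g) = g \<cdot>\<^bsub>D\<^esub> \<epsilon> Y"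
    if "g \<in> Hom D Y Y'" for g Y Y'
  proof -
    have "Y \<in> Obj D" "Y' \<in> Obj D" using that target.Hom_Obj by blast+
    then show "armap U g \<in> Hom C (P Y) (P Y')" "\<epsilon> Y' \<cdot>\<^bsub>D\<^esub> armap F (armap U g) = g \<cdot>\<^bsub>D\<^esub> \<epsilon> Y"
      using \<Phi>[of "P Y" Y' "g \<cdot>\<^bsub>D\<^esub> \<epsilon> Y"] that P by (auto simp: U_def)
  qed
  have U_obj: "obmap U = P" by (simp add: U_def)
  have "is_functor D C U"
  proof
    fix Y assume Y: "Y \<in> Obj D"
    then show "obmap U Y \<in> Obj C" by (simp add: U_obj P)
    show "armap U (Ident D Y) = Ident C (obmap U Y)"
      by (rule couniversal_unique[OF univ[OF Y], of _ "P Y"])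
        (use U_arr[OF target.Ident_in[OF Y]] P[OF Y] in \<open>auto simp: U_obj\<close>)
  next
    fix f X Y assume "f \<in> Hom D X Y"
    then show "armap U f \<in> Hom C (obmap U X) (obmap U Y)" using U_arr(1) unfolding U_obj by blast
  next
    fix f X Y g Z assume f: "f \<in> Hom D X Y" and g: "g \<in> Hom D Y Z"
    have gf: "g \<cdot>\<^bsub>D\<^esub> f \<in> Hom D X Z" using f g by simp
    have Obj: "X \<in> Obj D" "Y \<in> Obj D" "Z \<in> Obj D" using f g by auto
    have "\<epsilon> Z \<cdot>\<^bsub>D\<^esub> armap F (armap U g \<cdot>\<^bsub>C\<^esub> armap U f)
        = (\<epsilon> Z \<cdot>\<^bsub>D\<^esub> armap F (armap U g)) \<cdot>\<^bsub>D\<^esub> armap F (armap U f)"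
      using U_arr(1)[OF f] U_arr(1)[OF g] P[OF Obj(3)] by simp
    also have "\<dots> = g \<cdot>\<^bsub>D\<^esub> (\<epsilon> Y \<cdot>\<^bsub>D\<^esub> armap F (armap U f))"
      unfolding U_arr(2)[OF g] using U_arr(1)[OF f] g P[OF Obj(2)] by simp
    also have "\<dots> = (g \<cdot>\<^bsub>D\<^esub> f) \<cdot>\<^bsub>D\<^esub> \<epsilon> X"
      unfolding U_arr(2)[OF f] using f g P[OF Obj(1)] by simp
    finally show "armap U (g \<cdot>\<^bsub>D\<^esub> f) = armap U g \<cdot>\<^bsub>C\<^esub> armap U f"
      using U_arr(2)[OF gf] U_arr(1)[OF gf] U_arr(1)[OF f] U_arr(1)[OF g]
      by (intro couniversal_unique[OF univ[OF Obj(3)], of _ "P X"]) (auto simp del: armap_Comp_Arr)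
  qed
  moreover have "bij_betw (\<Phi> X Y) (Hom D (obmap F X) Y) (Hom C X (obmap U Y))"
    if X: "X \<in> Obj C" and Y: "Y \<in> Obj D" for X Y
  proof (rule bij_betw_byWitness[where f' = "\<lambda>g. \<epsilon> Y \<cdot>\<^bsub>D\<^esub> armap F g"])
    show "\<forall>f\<in>Hom D (obmap F X) Y. \<epsilon> Y \<cdot>\<^bsub>D\<^esub> armap F (\<Phi> X Y f) = f"
      using \<Phi>[OF X Y] by blast
    show eps_in: "(\<lambda>g. \<epsilon> Y \<cdot>\<^bsub>D\<^esub> armap F g) ` Hom C X (obmap U Y) \<subseteq> Hom D (obmap F X) Y"
      using P[OF Y] by (auto simp: U_obj)
    show "\<Phi> X Y ` Hom D (obmap F X) Y \<subseteq> Hom C X (obmap U Y)"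
      using \<Phi>[OF X Y] by (auto simp: U_obj)
    show "\<forall>g\<in>Hom C X (obmap U Y). \<Phi> X Y (\<epsilon> Y \<cdot>\<^bsub>D\<^esub> armap F g) = g"
    proof
      fix g assume g: "g \<in> Hom C X (obmap U Y)"
      then have "\<epsilon> Y \<cdot>\<^bsub>D\<^esub> armap F g \<in> Hom D (obmap F X) Y" using eps_in by blast
      from \<Phi>[OF X Y this] g show "\<Phi> X Y (\<epsilon> Y \<cdot>\<^bsub>D\<^esub> armap F g) = g"
        by (intro couniversal_unique[OF univ[OF Y], of _ X]) (auto simp: U_obj)
    qed
  qed
  moreover have "\<Phi> X' Y' (g \<cdot>\<^bsub>D\<^esub> (h \<cdot>\<^bsub>D\<^esub> armap F f)) = armap U g \<cdot>\<^bsub>C\<^esub> (\<Phi> X Y h \<cdot>\<^bsub>C\<^esub> f)"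
    if f: "f \<in> Hom C X' X" and g: "g \<in> Hom D Y Y'" and h: "h \<in> Hom D (obmap F X) Y" for X X' Y Y' f g h
  proof -
    have Obj: "X \<in> Obj C" "X' \<in> Obj C" "Y \<in> Obj D" "Y' \<in> Obj D" using f g by auto
    note \<Phi>h = \<Phi>[OF Obj(1,3) h]
    have "\<epsilon> Y' \<cdot>\<^bsub>D\<^esub> armap F (armap U g \<cdot>\<^bsub>C\<^esub> (\<Phi> X Y h \<cdot>\<^bsub>C\<^esub> f))
        = (\<epsilon> Y' \<cdot>\<^bsub>D\<^esub> armap F (armap U g)) \<cdot>\<^bsub>D\<^esub> (armap F (\<Phi> X Y h) \<cdot>\<^bsub>D\<^esub> armap F f)"
      using U_arr(1)[OF g] \<Phi>h f P[OF Obj(4)] by simp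
    also have "\<dots> = g \<cdot>\<^bsub>D\<^esub> (\<epsilon> Y \<cdot>\<^bsub>D\<^esub> (armap F (\<Phi> X Y h) \<cdot>\<^bsub>D\<^esub> armap F f))"
      unfolding U_arr(2)[OF g] using \<Phi>h g f P[OF Obj(3)] by simp
    also have "\<dots> = g \<cdot>\<^bsub>D\<^esub> (h \<cdot>\<^bsub>D\<^esub> armap F f)"
      using \<Phi>h f P[OF Obj(3)] target.Comp_assoc_Arr[of "armap F f" "armap F (\<Phi> X Y h)" "\<epsilon> Y"]
      by simp
    finally have eq: "\<epsilon> Y' \<cdot>\<^bsub>D\<^esub> armap F (armap U g \<cdot>\<^bsub>C\<^esub> (\<Phi> X Y h \<cdot>\<^bsub>C\<^esub> f))
      = g \<cdot>\<^bsub>D\<^esub> (h \<cdot>\<^bsub>D\<^esub> armap F f)" .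
    have in_Hom: "g \<cdot>\<^bsub>D\<^esub> (h \<cdot>\<^bsub>D\<^esub> armap F f) \<in> Hom D (obmap F X') Y'" using f g h by simp
    have "armap U g \<cdot>\<^bsub>C\<^esub> (\<Phi> X Y h \<cdot>\<^bsub>C\<^esub> f) \<in> Hom C X' (P Y')"
      using U_arr(1)[OF g] \<Phi>h f by simp
    then show ?thesis
      using \<Phi>[OF Obj(2,4) in_Hom] eq by (intro couniversal_unique[OF univ[OF Obj(4)], of _ X']) auto
  qed
  ultimately have "adjunction C D F U \<Phi>"
    using is_functor_axioms unfolding adjunction_def by blast
  then show ?thesis using \<Phi> by blast
qed

section \<open>Lifting characterizations of the model structure\<close>

lemma retract_ofI:
  assumes "f \<in> Arr C" "g \<in> Arr C"
    "i \<in> Hom C (Dom C f) (Dom C g)" "r \<in> Hom C (Dom C g) (Dom C f)"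
    "i' \<in> Hom C (Cod C f) (Cod C g)" "r' \<in> Hom C (Cod C g) (Cod C f)"
    "r \<cdot>\<^bsub>C\<^esub> i = Ident C (Dom C f)" "r' \<cdot>\<^bsub>C\<^esub> i' = Ident C (Cod C f)"
    "g \<cdot>\<^bsub>C\<^esub> i = i' \<cdot>\<^bsub>C\<^esub> f" "f \<cdot>\<^bsub>C\<^esub> r = r' \<cdot>\<^bsub>C\<^esub> g"
  shows "retract_of C f g"
  unfolding retract_of_def using assms by blast

context model_category
begin

text \<open>The retract argument: factor a map as a cofibration followed by a trivial fibration. If it has the
  right lifting property against the first factor, it is a retract of the second; if it has the left
  lifting property against the second factor, it is a retract of the first.\<close>

lemma trivial_Fib_eq_rlp: "Fib M \<inter> Weq M = rlp C (Cof M)"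
proof
  show "Fib M \<inter> Weq M \<subseteq> rlp C (Cof M)" using lifting_cof classes by (auto simp: rlp_def)
next
  show "rlp C (Cof M) \<subseteq> Fib M \<inter> Weq M"
  proof
    fix p assume "p \<in> rlp C (Cof M)"
    then have p: "p \<in> Arr C" and lift: "\<And>i. i \<in> Cof M \<Longrightarrow> has_lift C i p" by (auto simp: rlp_def)
    obtain E l r where "functorial_factorization C (Cof M) (Fib M \<inter> Weq M) E l r"
      using factorization_cof by blast
    then have l: "l p \<in> Cof M" "l p \<in> Hom C (Dom C p) (obmap E p)"
      and r: "r p \<in> Fib M" "r p \<in> Weq M" "r p \<in> Hom C (obmap E p) (Cod C p)" and rl: "r p \<cdot> l p = p"
      using p by (auto simp: functorial_factorization_def)
    obtain h where h: "h \<in> Hom C (obmap E p) (Dom C p)" "h \<cdot> l p = Ident C (Dom C p)" "p \<cdot> h = r p"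
      using lift[OF l(1), unfolded has_lift_def, rule_format, of "Ident C (Dom C p)" "r p"] p l r rl
      by (auto simp: Hom_def)
    have "retract_of C p (r p)"
      by (rule retract_ofI[of p C "r p" "l p" h "Ident C (Cod C p)" "Ident C (Cod C p)"])
        (use p l r h rl in \<open>auto simp: Hom_def\<close>)
    then show "p \<in> Fib M \<inter> Weq M" using retracts r by blast
  qed
qed

lemma Cof_eq_llp: "Cof M = llp C (Fib M \<inter> Weq M)"
proof
  show "Cof M \<subseteq> llp C (Fib M \<inter> Weq M)" using lifting_cof classes by (auto simp: llp_def)
next
  show "llp C (Fib M \<inter> Weq M) \<subseteq> Cof M"
  proof
    fix f assume "f \<in> llp C (Fib M \<inter> Weq M)"
    then have f: "f \<in> Arr C" and lift: "\<And>p. p \<in> Fib M \<Longrightarrow> p \<in> Weq M \<Longrightarrow> has_lift C f p"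
      by (auto simp: llp_def)
    obtain E l r where "functorial_factorization C (Cof M) (Fib M \<inter> Weq M) E l r"
      using factorization_cof by blast
    then have l: "l f \<in> Cof M" "l f \<in> Hom C (Dom C f) (obmap E f)"
      and r: "r f \<in> Fib M" "r f \<in> Weq M" "r f \<in> Hom C (obmap E f) (Cod C f)" and rl: "r f \<cdot> l f = f"
      using f by (auto simp: functorial_factorization_def)
    obtain h where h: "h \<in> Hom C (Cod C f) (obmap E f)" "h \<cdot> f = l f" "r f \<cdot> h = Ident C (Cod C f)"
      using lift[OF r(1,2), unfolded has_lift_def, rule_format, of "l f" "Ident C (Cod C f)"] f l r rl
      by (auto simp: Hom_def)
    have "retract_of C f (l f)"
      by (rule retract_ofI[of f C "l f" "Ident C (Dom C f)" "Ident C (Dom C f)" h "r f"])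
        (use f l r h rl in \<open>auto simp: Hom_def\<close>)
    then show "f \<in> Cof M" using retracts l by blast
  qed
qed

end

text \<open>The right adjoint of a functor that preserves cofibrations preserves trivial fibrations. Here \<open>q\<close> is
  the image of \<open>p\<close> under the right adjoint.\<close>

lemma couniversal_trivial_Fib:
  assumes C: "model_category C \<kappa> M" and D: "model_category D \<kappa>' N"
    and F: "is_functor C D F" "\<And>i. i \<in> Cof M \<Longrightarrow> armap F i \<in> Cof N"
    and p: "p \<in> Fib N \<inter> Weq N" "p \<in> Hom D E B"
    and E: "couniversal C D F E P \<epsilon>" and B: "couniversal C D F B P' \<epsilon>'"
    and q: "q \<in> Hom C P P'" and eq: "\<epsilon>' \<cdot>\<^bsub>D\<^esub> armap F q = p \<cdot>\<^bsub>D\<^esub> \<epsilon>"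
  shows "q \<in> Fib M \<inter> Weq M"
proof -
  interpret C: model_category C \<kappa> M by (rule C)
  interpret D: model_category D \<kappa>' N by (rule D)
  interpret F: is_functor C D F by (rule F)
  have "has_lift C i q" if "i \<in> Cof M" for i
    using F.has_lift_transpose[OF _ p(2) E B q eq, of i] D.lifting_cof[OF F(2)[OF that] p(1)]
      that C.classes by blast
  then show ?thesis
    unfolding C.trivial_Fib_eq_rlp using q by (auto simp: rlp_def Hom_def)
qed


section \<open>Monoidal categories\<close>

text \<open>The functor \<open>T(X, -)\<close>.\<close>

definition partial_funct ::
  "('o, 'a, 'm) category_scheme \<Rightarrow> ('o \<times> 'p, 'a \<times> 'b, 'q, 'c) funct \<Rightarrow> 'o \<Rightarrow> ('p, 'b, 'q, 'c) funct" where
  "partial_funct C T X =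
     \<lparr>obmap = (\<lambda>Y. obmap T (X, Y)), armap = (\<lambda>g. armap T (Ident C X, g))\<rparr>"

lemma partial_funct_simps [simp]:
  "obmap (partial_funct C T X) Y = obmap T (X, Y)"
  "armap (partial_funct C T X) g = armap T (Ident C X, g)"
  by (simp_all add: partial_funct_def)

lemma partial_funct_is_functor:
  assumes C: "category C" and D: "category D" and T: "is_functor (prod_cat C D) E T" and X: "X \<in> Obj C"
  shows "is_functor D E (partial_funct C T X)"
proof -
  interpret C: category C by (rule C)
  interpret D: category D by (rule D)
  interpret T: is_functor "prod_cat C D" E T by (rule T)
  note [simp] = prod_cat_def Hom_def
  show ?thesis
  proof
    fix Y assume Y: "Y \<in> Obj D"
    then show "obmap (partial_funct C T X) Y \<in> Obj E" using T.obmap_in[of "(X, Y)"] X by simp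
    show "armap (partial_funct C T X) (Ident D Y) = Ident E (obmap (partial_funct C T X) Y)"
      using T.armap_Ident[of "(X, Y)"] X Y by simp
  next
    fix g Y Z assume "g \<in> Hom D Y Z"
    then show "armap (partial_funct C T X) g
        \<in> Hom E (obmap (partial_funct C T X) Y) (obmap (partial_funct C T X) Z)"
      using T.armap_in[of "(Ident C X, g)" "(X, Y)" "(X, Z)"] X by simp
  next
    fix f Y Z g W assume "f \<in> Hom D Y Z" "g \<in> Hom D Z W"
    then show "armap (partial_funct C T X) (g \<cdot>\<^bsub>D\<^esub> f)
        = armap (partial_funct C T X) g \<cdot>\<^bsub>E\<^esub> armap (partial_funct C T X) f"
      using T.armap_Comp[of "(Ident C X, f)" "(X, Y)" "(X, Z)" "(Ident C X, g)" "(X, W)"] X by simp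
  qed
qed

lemma (in category) op_cat_category: "category (op_cat C)"
proof
qed (auto simp: op_cat_def Hom_def Comp_assoc_Arr)

text \<open>In a closed monoidal category, \<open>P\<close> is the internal hom from \<open>X\<close> to \<open>Z\<close> and \<open>\<epsilon>\<close> is evaluation.\<close>

lemma left_closed_couniversal:
  fixes C :: "('o, 'a, 'm) category_scheme"
  assumes C: "category C" and T: "is_functor (prod_cat C C) C T" and closed: "left_closed C T"
    and X: "X \<in> Obj C" and Z: "Z \<in> Obj C"
  shows "\<exists>P \<epsilon>. couniversal C C (partial_funct C T X) Z P \<epsilon>"
proof -
  interpret C: category C by (rule C)
  obtain H :: "('o \<times> 'o, 'a \<times> 'a, 'o, 'a) funct" and \<Phi> where H: "is_functor (prod_cat (op_cat C) C) C H"
    and bij: "\<forall>X\<in>Obj C. \<forall>Y\<in>Obj C. \<forall>Z\<in>Obj C.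
           bij_betw (\<Phi> X Y Z) (Hom C (obmap T (X, Y)) Z) (Hom C Y (obmap H (X, Z)))"
    and nat: "\<forall>X\<in>Obj C. \<forall>Y\<in>Obj C. \<forall>Z\<in>Obj C. \<forall>X'\<in>Obj C. \<forall>Y'\<in>Obj C. \<forall>Z'\<in>Obj C.
         \<forall>f\<in>Hom C X' X. \<forall>g\<in>Hom C Y' Y. \<forall>h\<in>Hom C Z Z'. \<forall>k\<in>Hom C (obmap T (X, Y)) Z.
           \<Phi> X' Y' Z' (h \<cdot>\<^bsub>C\<^esub> (k \<cdot>\<^bsub>C\<^esub> armap T (f, g))) = armap H (f, h) \<cdot>\<^bsub>C\<^esub> (\<Phi> X Y Z k \<cdot>\<^bsub>C\<^esub> g)"
    using closed unfolding left_closed_def by blast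
  have "is_functor C C (partial_funct (op_cat C) H X)"
    by (rule partial_funct_is_functor[OF C.op_cat_category C H]) (simp add: op_cat_def X)
  moreover have "is_functor C C (partial_funct C T X)"
    by (rule partial_funct_is_functor[OF C C T X])
  moreover have "Ident (op_cat C) X = Ident C X" by (simp add: op_cat_def)
  ultimately have "adjunction C C (partial_funct C T X) (partial_funct (op_cat C) H X) (\<Phi> X)"
    using bij nat X C.Ident_in[OF X] by (simp add: adjunction_def)
  from adjunction_couniversal[OF this Z] show ?thesis by blast
qed

context monoidal_category
begin

interpretation T: is_functor "prod_cat C C" C "Tensor C" by (rule Tensor_functor)

lemma tensor_Obj [simp]: "X \<in> Obj C \<Longrightarrow> Y \<in> Obj C \<Longrightarrow> X \<otimes> Y \<in> Obj C"
  using T.obmap_in[of "(X, Y)"] by (simp add: prod_cat_def)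

lemma tensor_Arr [simp]:
  assumes "f \<in> Arr C" "g \<in> Arr C"
  shows "f \<boxtimes> g \<in> Arr C" "Dom C (f \<boxtimes> g) = Dom C f \<otimes> Dom C g" "Cod C (f \<boxtimes> g) = Cod C f \<otimes> Cod C g"
  using T.armap_Arr[of "(f, g)"] assms by (auto simp: prod_cat_def)

lemma tensor_Ident [simp]:
  "X \<in> Obj C \<Longrightarrow> Y \<in> Obj C \<Longrightarrow> Ident C X \<boxtimes> Ident C Y = Ident C (X \<otimes> Y)"
  using T.armap_Ident[of "(X, Y)"] by (simp add: prod_cat_def)

lemma tensor_Comp:
  assumes "f \<in> Arr C" "f' \<in> Arr C" "g \<in> Arr C" "g' \<in> Arr C" "Cod C f = Dom C f'" "Cod C g = Dom C g'"
  shows "(f' \<boxtimes> g') \<cdot> (f \<boxtimes> g) = (f' \<cdot> f) \<boxtimes> (g' \<cdot> g)"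
  using T.armap_Comp_Arr[of "(f, g)" "(f', g')"] assms by (simp add: prod_cat_def)

lemma tensor_Comp_left:
  assumes "f \<in> Arr C" "f' \<in> Arr C" "g \<in> Arr C" "g' \<in> Arr C" "Cod C f = Dom C f'" "Cod C g = Dom C g'"
    "x \<in> Arr C" "Cod C x = Dom C f \<otimes> Dom C g"
  shows "(f' \<boxtimes> g') \<cdot> ((f \<boxtimes> g) \<cdot> x) = ((f' \<cdot> f) \<boxtimes> (g' \<cdot> g)) \<cdot> x"
  using assms by (simp add: tensor_Comp flip: Comp_assoc_Arr)

lemmas Unit_Obj [simp] = Unit_in

lemma Assoc_Arr [simp]:
  assumes "X \<in> Obj C" "Y \<in> Obj C" "Z \<in> Obj C"
  shows "Assoc C X Y Z \<in> Arr C" "Dom C (Assoc C X Y Z) = (X \<otimes> Y) \<otimes> Z"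
    "Cod C (Assoc C X Y Z) = X \<otimes> (Y \<otimes> Z)" "is_iso C (Assoc C X Y Z)"
  using Assoc_in[OF assms] by (auto simp: Hom_def)

lemma LUnit_Arr [simp]:
  assumes "X \<in> Obj C"
  shows "LUnit C X \<in> Arr C" "Dom C (LUnit C X) = Unit C \<otimes> X" "Cod C (LUnit C X) = X"
    "is_iso C (LUnit C X)"
  using LUnit_in[OF assms] by (auto simp: Hom_def)

lemma RUnit_Arr [simp]:
  assumes "X \<in> Obj C"
  shows "RUnit C X \<in> Arr C" "Dom C (RUnit C X) = X \<otimes> Unit C" "Cod C (RUnit C X) = X"
    "is_iso C (RUnit C X)"
  using RUnit_in[OF assms] by (auto simp: Hom_def)

lemma Assoc_natural_Arr:
  assumes "f \<in> Arr C" "g \<in> Arr C" "h \<in> Arr C"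
  shows "Assoc C (Cod C f) (Cod C g) (Cod C h) \<cdot> ((f \<boxtimes> g) \<boxtimes> h)
    = (f \<boxtimes> (g \<boxtimes> h)) \<cdot> Assoc C (Dom C f) (Dom C g) (Dom C h)"
  by (rule Assoc_natural) (use assms in \<open>auto simp: Hom_def\<close>)

lemma LUnit_natural_Arr:
  assumes "f \<in> Arr C"
  shows "LUnit C (Cod C f) \<cdot> (Ident C (Unit C) \<boxtimes> f) = f \<cdot> LUnit C (Dom C f)"
  by (rule LUnit_natural) (use assms in \<open>auto simp: Hom_def\<close>)

lemma is_iso_tensor:
  assumes "is_iso C f" "is_iso C g" "f \<in> Arr C" "g \<in> Arr C"
  shows "is_iso C (f \<boxtimes> g)"
proof -
  have "inverse_arrows C (f \<boxtimes> g) (inv_arr C f \<boxtimes> inv_arr C g)"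
    using assms by (simp add: inverse_arrows_def Hom_def tensor_Comp)
  then show ?thesis by (auto simp: is_iso_def)
qed

lemma is_iso_Ident [simp]: "X \<in> Obj C \<Longrightarrow> is_iso C (Ident C X)"
  unfolding is_iso_def inverse_arrows_def by (intro exI[of _ "Ident C X"]) (simp add: Hom_def)

text \<open>The left unit triangle not among the axioms. After tensoring on the left with the unit, which
  is faithful, it follows from the pentagon and the middle triangle.\<close>

lemma LUnit_tensor:
  assumes X: "X \<in> Obj C" and Y: "Y \<in> Obj C"
  shows "LUnit C (X \<otimes> Y) \<cdot> Assoc C (Unit C) X Y = LUnit C X \<boxtimes> Ident C Y"
proof -
  let ?I = "Unit C" and ?i = "Ident C (Unit C)"
  let ?l = "LUnit C (X \<otimes> Y) \<cdot> Assoc C ?I X Y" and ?r = "LUnit C X \<boxtimes> Ident C Y"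
  let ?e = "Assoc C ?I (?I \<otimes> X) Y \<cdot> (Assoc C ?I ?I X \<boxtimes> Ident C Y)"
  note [simp] = X Y
  have e: "is_iso C ?e"
    by (rule is_iso_Comp[of _ _ "((?I \<otimes> ?I) \<otimes> X) \<otimes> Y" "(?I \<otimes> (?I \<otimes> X)) \<otimes> Y" "?I \<otimes> ((?I \<otimes> X) \<otimes> Y)"])
      (simp_all add: is_iso_tensor Hom_def)
  have "(?i \<boxtimes> ?l) \<cdot> ?e
      = (?i \<boxtimes> LUnit C (X \<otimes> Y)) \<cdot> ((?i \<boxtimes> Assoc C ?I X Y) \<cdot> ?e)"
    by (simp add: tensor_Comp_left)
  also have "\<dots> = ((?i \<boxtimes> LUnit C (X \<otimes> Y)) \<cdot> Assoc C ?I ?I (X \<otimes> Y)) \<cdot> Assoc C (?I \<otimes> ?I) X Y"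
    by (simp add: pentagon[symmetric] Comp_assoc_Arr)
  also have "\<dots> = (RUnit C ?I \<boxtimes> (Ident C X \<boxtimes> Ident C Y)) \<cdot> Assoc C (?I \<otimes> ?I) X Y"
    by (simp add: triangle)
  also have "\<dots> = Assoc C ?I X Y \<cdot> ((RUnit C ?I \<boxtimes> Ident C X) \<boxtimes> Ident C Y)"
    using Assoc_natural_Arr[of "RUnit C ?I" "Ident C X" "Ident C Y"] by simp
  also have "\<dots> = Assoc C ?I X Y \<cdot> (((?i \<boxtimes> LUnit C X) \<boxtimes> Ident C Y) \<cdot> (Assoc C ?I ?I X \<boxtimes> Ident C Y))"
    by (simp add: triangle[symmetric] tensor_Comp)
  also have "\<dots> = (Assoc C ?I X Y \<cdot> ((?i \<boxtimes> LUnit C X) \<boxtimes> Ident C Y)) \<cdot> (Assoc C ?I ?I X \<boxtimes> Ident C Y)"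
    by (simp add: Comp_assoc_Arr)
  also have "\<dots> = (?i \<boxtimes> ?r) \<cdot> ?e"
    using Assoc_natural_Arr[of ?i "LUnit C X" "Ident C Y"] by (simp add: Comp_assoc_Arr)
  finally have "(?i \<boxtimes> ?l) \<cdot> ?e = (?i \<boxtimes> ?r) \<cdot> ?e" .
  then have "?i \<boxtimes> ?l = ?i \<boxtimes> ?r"
    by (rule iso_cancel_right[OF e, rotated 3]) (simp_all add: Hom_def)
  then have "?l \<cdot> LUnit C ((?I \<otimes> X) \<otimes> Y) = ?r \<cdot> LUnit C ((?I \<otimes> X) \<otimes> Y)"
    using LUnit_natural_Arr[of ?l] LUnit_natural_Arr[of ?r] by simp
  then show ?thesis
    by (rule iso_cancel_right[rotated 4]) (simp_all add: Hom_def)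
qed

lemma swap_funct_is_functor: "is_functor (prod_cat C C) C (swap_funct (Tensor C))"
proof
  fix f X Y g Z
  assume "f \<in> Hom (prod_cat C C) X Y" "g \<in> Hom (prod_cat C C) Y Z"
  then show "armap (swap_funct (Tensor C)) (g \<cdot>\<^bsub>prod_cat C C\<^esub> f)
      = armap (swap_funct (Tensor C)) g \<cdot> armap (swap_funct (Tensor C)) f"
    by (auto simp: prod_cat_def Hom_def swap_funct_def tensor_Comp)
qed (auto simp: prod_cat_def Hom_def swap_funct_def)

lemma tensor_left_is_functor: "X \<in> Obj C \<Longrightarrow> is_functor C C (partial_funct C (Tensor C) X)"
  by (rule partial_funct_is_functor) (rule category_axioms Tensor_functor | assumption)+

end

context monoidal_model_category
begin

lemma tensor_left_couniversal:
  assumes "X \<in> Obj C" "Z \<in> Obj C"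
  shows "\<exists>P \<epsilon>. couniversal C C (partial_funct C (Tensor C) X) Z P \<epsilon>"
  by (rule left_closed_couniversal[OF category_axioms Tensor_functor closed(1) assms])

lemma initial_tensor:
  assumes "initial C Z" "X \<in> Obj C"
  shows "initial C (Z \<otimes> X)"
proof -
  interpret T: is_functor C C "partial_funct C (swap_funct (Tensor C)) X"
    by (rule partial_funct_is_functor[OF category_axioms category_axioms swap_funct_is_functor assms(2)])
  have "initial C (obmap (partial_funct C (swap_funct (Tensor C)) X) Z)"
    by (rule T.initial_obmap[OF left_closed_couniversal[OF category_axioms swap_funct_is_functor
          closed(2) assms(2)] assms(1)])
  then show ?thesis by (simp add: swap_funct_def)
qed

text \<open>The pushout product of \<open>0 \<rightarrow> X\<close> with \<open>j\<close> is \<open>X \<otimes> j\<close>, as \<open>0 \<otimes> -\<close> is initial.\<close>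

lemma Cof_tensor_left:
  assumes X: "cofibrant C M X" and j: "j \<in> Cof M"
  shows "Ident C X \<boxtimes> j \<in> Cof M"
proof -
  obtain Z z where Z: "initial C Z" and z: "z \<in> Hom C Z X" "z \<in> Cof M"
    using X by (auto simp: cofibrant_def)
  have j_Arr [simp]: "j \<in> Arr C" using j classes by blast
  let ?K = "Dom C j" and ?L = "Cod C j"
  have X_Obj [simp]: "X \<in> Obj C" and Z_Obj [simp]: "Z \<in> Obj C"
    using X Z by (auto simp: cofibrant_def initial_def)
  have z_Arr [simp]: "z \<in> Arr C" "Dom C z = Z" "Cod C z = X" using z by (auto simp: Hom_def)
  \<comment> \<open>Parallel arrows out of the initial objects \<open>Z \<otimes> W\<close> agree.\<close>
  have eq: "f = g" if "f \<in> Arr C" "g \<in> Arr C" "Dom C f = Z \<otimes> W" "Dom C g = Z \<otimes> W" "W \<in> Obj C"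
    "Cod C f = Cod C g" for f g W
  proof -
    have "\<exists>!h. h \<in> Hom C (Z \<otimes> W) (Cod C f)"
      using initial_tensor[OF Z \<open>W \<in> Obj C\<close>] Cod_in[OF that(1)] by (simp add: initial_def)
    moreover have "f \<in> Hom C (Z \<otimes> W) (Cod C f)" "g \<in> Hom C (Z \<otimes> W) (Cod C f)"
      using that by (simp_all add: Hom_def)
    ultimately show ?thesis by blast
  qed
  have "\<exists>!t. t \<in> Hom C (Z \<otimes> ?L) (X \<otimes> ?K)"
    using initial_tensor[OF Z, of ?L] by (simp add: initial_def)
  then obtain t where t: "t \<in> Hom C (Z \<otimes> ?L) (X \<otimes> ?K)" by blast
  then have t_Arr [simp]: "t \<in> Arr C" "Dom C t = Z \<otimes> ?L" "Cod C t = X \<otimes> ?K" by (auto simp: Hom_def)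
  \<comment> \<open>\<open>Z \<otimes> j\<close> is an isomorphism, so its pushout along \<open>z \<otimes> K\<close> is an identity.\<close>
  have "is_pushout C (Ident C Z \<boxtimes> j) (z \<boxtimes> Ident C ?K) t (Ident C (X \<otimes> ?K))"
    unfolding is_pushout_def
  proof (intro conjI ballI impI)
    show "t \<cdot> (Ident C Z \<boxtimes> j) = Ident C (X \<otimes> ?K) \<cdot> (z \<boxtimes> Ident C ?K)"
      by (rule eq[of _ _ ?K]) auto
  next
    fix W p q assume p: "p \<in> Hom C (Cod C (Ident C Z \<boxtimes> j)) W"
      and q: "q \<in> Hom C (Cod C (z \<boxtimes> Ident C ?K)) W"
    have "q \<cdot> t = p"
      by (rule eq[of _ _ ?L]) (use p q in \<open>simp_all add: Hom_def\<close>)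
    moreover have "h \<cdot> Ident C (X \<otimes> ?K) = h" if "h \<in> Hom C (Cod C t) W" for h
      using that by (simp add: Hom_def)
    moreover have "q \<in> Hom C (Cod C t) W" using q by (simp add: Hom_def)
    ultimately show "\<exists>!h. h \<in> Hom C (Cod C t) W \<and> h \<cdot> t = p \<and> h \<cdot> Ident C (X \<otimes> ?K) = q"
      by metis
  qed auto
  moreover have "(Ident C X \<boxtimes> j) \<cdot> t = z \<boxtimes> Ident C ?L"
    by (rule eq[of _ _ ?L]) simp_all
  moreover have "(Ident C X \<boxtimes> j) \<cdot> Ident C (X \<otimes> ?K) = Ident C X \<boxtimes> j" by simp
  ultimately have "pushout_product C z j (Ident C X \<boxtimes> j)"
    unfolding pushout_product_def
    by (intro exI[of _ t] exI[of _ "Ident C (X \<otimes> ?K)"]) (simp add: Hom_def)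
  from pushout_product_axiom[OF z(2) j this] show ?thesis ..
qed

end


section \<open>Modules\<close>

lemma module_cat_simps [simp]:
  "Obj (module_cat C A) = {X. left_module C A X}"
  "(X, Y, f) \<in> Arr (module_cat C A) \<longleftrightarrow> left_module C A X \<and> left_module C A Y \<and>
     f \<in> Hom C (fst X) (fst Y) \<and> f \<cdot>\<^bsub>C\<^esub> snd X = snd Y \<cdot>\<^bsub>C\<^esub> (Ident C (Carrier A) \<boxtimes>\<^bsub>C\<^esub> f)"
  "Dom (module_cat C A) (X, Y, f) = X"
  "Cod (module_cat C A) (X, Y, f) = Y"
  "Ident (module_cat C A) X = (X, X, Ident C (fst X))"
  "(Y, Z, g) \<cdot>\<^bsub>module_cat C A\<^esub> (X, W, f) = (X, Z, g \<cdot>\<^bsub>C\<^esub> f)"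
  by (simp_all add: module_cat_def)

lemma module_Hom_iff [simp]:
  "(X', Y', f) \<in> Hom (module_cat C A) X Y \<longleftrightarrow> X' = X \<and> Y' = Y \<and> (X, Y, f) \<in> Arr (module_cat C A)"
  by (auto simp: Hom_def)

lemma module_HomE:
  assumes "\<phi> \<in> Hom (module_cat C A) X Y"
  obtains f where "\<phi> = (X, Y, f)" "left_module C A X" "left_module C A Y" "f \<in> Hom C (fst X) (fst Y)"
    "f \<cdot>\<^bsub>C\<^esub> snd X = snd Y \<cdot>\<^bsub>C\<^esub> (Ident C (Carrier A) \<boxtimes>\<^bsub>C\<^esub> f)"
  using assms by (cases \<phi>) auto

lemma left_module_pair:
  "left_module C A (X, a) \<longleftrightarrow> X \<in> Obj C \<and> a \<in> Hom C (Carrier A \<otimes>\<^bsub>C\<^esub> X) X \<and>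
     a \<cdot>\<^bsub>C\<^esub> (Mult A \<boxtimes>\<^bsub>C\<^esub> Ident C X) =
       a \<cdot>\<^bsub>C\<^esub> ((Ident C (Carrier A) \<boxtimes>\<^bsub>C\<^esub> a) \<cdot>\<^bsub>C\<^esub> Assoc C (Carrier A) (Carrier A) X) \<and>
     a \<cdot>\<^bsub>C\<^esub> (One A \<boxtimes>\<^bsub>C\<^esub> Ident C X) = LUnit C X"
  by (simp add: left_module_def)

lemma left_moduleD:
  assumes "left_module C A X"
  shows "fst X \<in> Obj C" "snd X \<in> Arr C" "Dom C (snd X) = Carrier A \<otimes>\<^bsub>C\<^esub> fst X" "Cod C (snd X) = fst X"
    "snd X \<cdot>\<^bsub>C\<^esub> (Mult A \<boxtimes>\<^bsub>C\<^esub> Ident C (fst X)) =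
       snd X \<cdot>\<^bsub>C\<^esub> ((Ident C (Carrier A) \<boxtimes>\<^bsub>C\<^esub> snd X) \<cdot>\<^bsub>C\<^esub> Assoc C (Carrier A) (Carrier A) (fst X))"
    "snd X \<cdot>\<^bsub>C\<^esub> (One A \<boxtimes>\<^bsub>C\<^esub> Ident C (fst X)) = LUnit C (fst X)"
  using assms by (auto simp: left_module_def Hom_def split: prod.splits)

text \<open>The functor from modules to underlying objects.\<close>

definition forget :: "('o \<times> 'a, ('o \<times> 'a) \<times> ('o \<times> 'a) \<times> 'a, 'o, 'a) funct" where
  "forget = \<lparr>obmap = fst, armap = (\<lambda>(X, Y, f). f)\<rparr>"

lemma forget_simps [simp]: "obmap forget X = fst X" "armap forget (X, Y, f) = f"
  by (simp_all add: forget_def)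

context monoidal_category
begin

lemma module_cat_category:
  assumes A: "Carrier A \<in> Obj C"
  shows "category (module_cat C A)"
proof
  fix X assume "X \<in> Obj (module_cat C A)"
  then show "Ident (module_cat C A) X \<in> Hom (module_cat C A) X X"
    using left_moduleD[of C A X] A by (simp add: Hom_def)
next
  fix f X Y g Z assume "f \<in> Hom (module_cat C A) X Y" "g \<in> Hom (module_cat C A) Y Z"
  then show "g \<cdot>\<^bsub>module_cat C A\<^esub> f \<in> Hom (module_cat C A) X Z"
  proof (elim module_HomE)
    fix f' g'
    assume XYZ: "left_module C A X" "left_module C A Y" "left_module C A Z"
      and f: "f = (X, Y, f')" "f' \<in> Hom C (fst X) (fst Y)"
        "f' \<cdot> snd X = snd Y \<cdot> (Ident C (Carrier A) \<boxtimes> f')"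
      and g: "g = (Y, Z, g')" "g' \<in> Hom C (fst Y) (fst Z)"
        "g' \<cdot> snd Y = snd Z \<cdot> (Ident C (Carrier A) \<boxtimes> g')"
    note facts = XYZ[THEN left_moduleD(1)] XYZ[THEN left_moduleD(2)] XYZ[THEN left_moduleD(3)]
      XYZ[THEN left_moduleD(4)] f(2) g(2) A
    have "(g' \<cdot> f') \<cdot> snd X = (g' \<cdot> snd Y) \<cdot> (Ident C (Carrier A) \<boxtimes> f')"
      using facts f(3) by (simp add: Hom_def Comp_assoc_Arr)
    also have "\<dots> = snd Z \<cdot> (Ident C (Carrier A) \<boxtimes> (g' \<cdot> f'))"
      unfolding g(3) using facts by (simp add: Hom_def Comp_assoc_Arr tensor_Comp)
    finally show ?thesis using XYZ f(1) g(1) facts by (simp add: Hom_def)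
  qed
qed (auto simp: Hom_def Comp_assoc_Arr elim!: module_HomE)

lemma forget_is_functor:
  assumes A: "Carrier A \<in> Obj C"
  shows "is_functor (module_cat C A) C forget"
proof -
  interpret mod: category "module_cat C A" by (rule module_cat_category[OF A])
  show ?thesis
  proof
    fix X assume "X \<in> Obj (module_cat C A)"
    then show "obmap forget X \<in> Obj C" using left_moduleD(1)[of C A X] by simp
  qed (auto elim!: module_HomE)
qed

end

subsection \<open>Cofree modules\<close>

text \<open>Let \<open>ev : A \<otimes> P \<rightarrow> E\<close> exhibit \<open>P\<close> as the internal hom from \<open>A\<close> to \<open>E\<close>. The monoid acts on \<open>P\<close> by
  multiplication on the right in the argument: in terms of elements, \<open>(b \<phi>) x = \<phi> (x b)\<close>. The equation
  \<open>ev_action\<close> states this and determines the action \<open>c\<close>.\<close>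

locale cofree_action = monoid_object C A for C :: "('o, 'a, 'm) monoidal_scheme" (structure)
    and A :: "('o, 'a, 'n) monoid_data_scheme" +
  fixes E P :: 'o and ev c :: 'a
  assumes ev_couniversal: "couniversal C C (partial_funct C (Tensor C) (Carrier A)) E P ev"
    and action_in: "c \<in> Hom C (Carrier A \<otimes> P) P"
    and ev_action: "ev \<cdot> ((Ident C (Carrier A) \<boxtimes> c) \<cdot> Assoc C (Carrier A) (Carrier A) P)
      = ev \<cdot> (Mult A \<boxtimes> Ident C P)"

context monoid_object
begin

lemmas Carrier_Obj [simp] = Carrier_in

lemma Mult_Arr [simp]:
  "Mult A \<in> Arr C" "Dom C (Mult A) = Carrier A \<otimes> Carrier A" "Cod C (Mult A) = Carrier A"
  using Mult_in by (auto simp: Hom_def)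

lemma One_Arr [simp]:
  "One A \<in> Arr C" "Dom C (One A) = Unit C" "Cod C (One A) = Carrier A"
  using One_in by (auto simp: Hom_def)

lemma cofree_action_exists:
  assumes ev: "couniversal C C (partial_funct C (Tensor C) (Carrier A)) E P ev"
  shows "\<exists>c. cofree_action C A E P ev c"
proof -
  note P = couniversalD[OF ev]
  let ?k = "ev \<cdot> ((Mult A \<boxtimes> Ident C P) \<cdot> inv_arr C (Assoc C (Carrier A) (Carrier A) P))"
  have "?k \<in> Hom C (obmap (partial_funct C (Tensor C) (Carrier A)) (Carrier A \<otimes> P)) E"
    using P by (simp add: Hom_def)
  then obtain c where c: "c \<in> Hom C (Carrier A \<otimes> P) P" "ev \<cdot> (Ident C (Carrier A) \<boxtimes> c) = ?k"
    using couniversal_exists[OF ev, of "Carrier A \<otimes> P" ?k] P by auto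
  have "ev \<cdot> ((Ident C (Carrier A) \<boxtimes> c) \<cdot> Assoc C (Carrier A) (Carrier A) P)
      = (ev \<cdot> (Ident C (Carrier A) \<boxtimes> c)) \<cdot> Assoc C (Carrier A) (Carrier A) P"
    using P c(1) by (simp add: Hom_def Comp_assoc_Arr)
  also have "\<dots> = ev \<cdot> (Mult A \<boxtimes> Ident C P)"
    unfolding c(2) using P by (simp add: Hom_def Comp_assoc_Arr)
  finally show ?thesis
    using monoid_object_axioms ev c(1) by (intro exI[of _ c]) (simp add: cofree_action_def cofree_action_axioms_def)
qed

end

context cofree_action
begin

abbreviation \<alpha> where "\<alpha> X \<equiv> Assoc C (Carrier A) (Carrier A) X"
abbreviation \<i> where "\<i> \<equiv> Ident C (Carrier A)"

lemma ev_Arr [simp]: "P \<in> Obj C" "ev \<in> Arr C" "Dom C ev = Carrier A \<otimes> P" "Cod C ev = E"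
  using couniversalD[OF ev_couniversal] by (auto simp: Hom_def)

lemma action_Arr [simp]: "c \<in> Arr C" "Dom C c = Carrier A \<otimes> P" "Cod C c = P"
  using action_in by (auto simp: Hom_def)

lemma transpose_unique:
  assumes "g \<in> Arr C" "g' \<in> Arr C" "Dom C g = Dom C g'" "Cod C g = P" "Cod C g' = P"
    "ev \<cdot> (\<i> \<boxtimes> g) = ev \<cdot> (\<i> \<boxtimes> g')"
  shows "g = g'"
  by (rule is_functor.couniversal_unique[OF tensor_left_is_functor[OF Carrier_in] ev_couniversal, of _ "Dom C g"])
    (use assms in \<open>auto simp: Hom_def\<close>)

lemma ev_action_left:
  assumes "x \<in> Arr C" "Cod C x = (Carrier A \<otimes> Carrier A) \<otimes> P"
  shows "ev \<cdot> ((\<i> \<boxtimes> c) \<cdot> (\<alpha> P \<cdot> x)) = ev \<cdot> ((Mult A \<boxtimes> Ident C P) \<cdot> x)"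
proof -
  have "ev \<cdot> ((\<i> \<boxtimes> c) \<cdot> (\<alpha> P \<cdot> x)) = (ev \<cdot> ((\<i> \<boxtimes> c) \<cdot> \<alpha> P)) \<cdot> x"
    using assms by (simp add: Comp_assoc_Arr)
  also have "\<dots> = ev \<cdot> ((Mult A \<boxtimes> Ident C P) \<cdot> x)"
    unfolding ev_action using assms by (simp add: Comp_assoc_Arr)
  finally show ?thesis .
qed

text \<open>A map \<open>g : W \<rightarrow> P\<close> is linear once its transpose \<open>k : A \<otimes> W \<rightarrow> E\<close> is balanced, which in terms of
  elements means \<open>k (x b, w) = k (x, b w)\<close>. Equations between maps into \<open>P\<close> are checked on
  their transposes, and these are compared after composition with an isomorphism built from associators.\<close>

lemma linear_if_balanced:
  assumes w: "w \<in> Hom C (Carrier A \<otimes> W) W" and g: "g \<in> Hom C W P" and k: "ev \<cdot> (\<i> \<boxtimes> g) = k"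
    and balanced: "k \<cdot> (Mult A \<boxtimes> Ident C W) = k \<cdot> ((\<i> \<boxtimes> w) \<cdot> \<alpha> W)"
  shows "g \<cdot> w = c \<cdot> (\<i> \<boxtimes> g)"
proof (rule transpose_unique)
  have W: "W \<in> Obj C" using g Hom_Obj by blast
  note facts = W w g
  have "(ev \<cdot> (\<i> \<boxtimes> (g \<cdot> w))) \<cdot> \<alpha> W = (ev \<cdot> (\<i> \<boxtimes> g)) \<cdot> ((\<i> \<boxtimes> w) \<cdot> \<alpha> W)"
    using facts by (simp add: Hom_def Comp_assoc_Arr tensor_Comp_left)
  also have "\<dots> = (ev \<cdot> (\<i> \<boxtimes> g)) \<cdot> (Mult A \<boxtimes> Ident C W)" unfolding k balanced ..
  also have "\<dots> = ev \<cdot> ((Mult A \<boxtimes> Ident C P) \<cdot> ((\<i> \<boxtimes> \<i>) \<boxtimes> g))"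
    using facts by (simp add: Hom_def Comp_assoc_Arr tensor_Comp)
  also have "\<dots> = ev \<cdot> ((\<i> \<boxtimes> c) \<cdot> (\<alpha> P \<cdot> ((\<i> \<boxtimes> \<i>) \<boxtimes> g)))"
    using facts by (intro ev_action_left[symmetric]) (simp_all add: Hom_def)
  also have "\<alpha> P \<cdot> ((\<i> \<boxtimes> \<i>) \<boxtimes> g) = (\<i> \<boxtimes> (\<i> \<boxtimes> g)) \<cdot> \<alpha> W"
    using Assoc_natural_Arr[of \<i> \<i> g] facts by (simp add: Hom_def)
  also have "ev \<cdot> ((\<i> \<boxtimes> c) \<cdot> ((\<i> \<boxtimes> (\<i> \<boxtimes> g)) \<cdot> \<alpha> W)) = (ev \<cdot> (\<i> \<boxtimes> (c \<cdot> (\<i> \<boxtimes> g)))) \<cdot> \<alpha> W"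
    using facts by (simp add: Hom_def Comp_assoc_Arr tensor_Comp_left)
  finally show "ev \<cdot> (\<i> \<boxtimes> (g \<cdot> w)) = ev \<cdot> (\<i> \<boxtimes> (c \<cdot> (\<i> \<boxtimes> g)))"
    by (rule iso_cancel_right[rotated 4, where W = "(Carrier A \<otimes> Carrier A) \<otimes> W"
          and X = "Carrier A \<otimes> (Carrier A \<otimes> W)" and Y = E])
      (use facts in \<open>simp_all add: Hom_def\<close>)
qed (use w g Hom_Obj[OF g] in \<open>simp_all add: Hom_def\<close>)

lemma cofree_module: "left_module C A (P, c)"
proof -
  let ?A = "Carrier A"
  have unit: "c \<cdot> (One A \<boxtimes> Ident C P) = LUnit C P"
  proof (rule transpose_unique)
    have "(ev \<cdot> (\<i> \<boxtimes> (c \<cdot> (One A \<boxtimes> Ident C P)))) \<cdot> Assoc C ?A (Unit C) P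
        = ev \<cdot> ((\<i> \<boxtimes> c) \<cdot> ((\<i> \<boxtimes> (One A \<boxtimes> Ident C P)) \<cdot> Assoc C ?A (Unit C) P))"
      by (simp add: Comp_assoc_Arr tensor_Comp_left)
    also have "(\<i> \<boxtimes> (One A \<boxtimes> Ident C P)) \<cdot> Assoc C ?A (Unit C) P = \<alpha> P \<cdot> ((\<i> \<boxtimes> One A) \<boxtimes> Ident C P)"
      using Assoc_natural_Arr[of \<i> "One A" "Ident C P"] by simp
    also have "ev \<cdot> ((\<i> \<boxtimes> c) \<cdot> (\<alpha> P \<cdot> ((\<i> \<boxtimes> One A) \<boxtimes> Ident C P))) = ev \<cdot> (RUnit C ?A \<boxtimes> Ident C P)"
      by (simp add: ev_action_left tensor_Comp One_right)
    also have "\<dots> = (ev \<cdot> (\<i> \<boxtimes> LUnit C P)) \<cdot> Assoc C ?A (Unit C) P"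
      by (simp add: triangle[symmetric] Comp_assoc_Arr)
    finally show "ev \<cdot> (\<i> \<boxtimes> (c \<cdot> (One A \<boxtimes> Ident C P))) = ev \<cdot> (\<i> \<boxtimes> LUnit C P)"
      by (rule iso_cancel_right[rotated 4, where W = "(?A \<otimes> Unit C) \<otimes> P"
            and X = "?A \<otimes> (Unit C \<otimes> P)" and Y = E]) (simp_all add: Hom_def)
  qed simp_all
  have "c \<cdot> (Mult A \<boxtimes> Ident C P) = c \<cdot> ((\<i> \<boxtimes> c) \<cdot> \<alpha> P)"
  proof (rule transpose_unique)
    let ?e = "Assoc C ?A (?A \<otimes> ?A) P \<cdot> (Assoc C ?A ?A ?A \<boxtimes> Ident C P)"
    let ?m = "Mult A" and ?p = "Ident C P"
    have e: "is_iso C ?e"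
      by (rule is_iso_Comp[of _ _ "((?A \<otimes> ?A) \<otimes> ?A) \<otimes> P" "(?A \<otimes> (?A \<otimes> ?A)) \<otimes> P" "?A \<otimes> ((?A \<otimes> ?A) \<otimes> P)"])
        (simp_all add: is_iso_tensor Hom_def)
    have "(ev \<cdot> (\<i> \<boxtimes> (c \<cdot> (?m \<boxtimes> ?p)))) \<cdot> ?e
        = ev \<cdot> ((\<i> \<boxtimes> c) \<cdot> (((\<i> \<boxtimes> (?m \<boxtimes> ?p)) \<cdot> Assoc C ?A (?A \<otimes> ?A) P) \<cdot> (Assoc C ?A ?A ?A \<boxtimes> ?p)))"
      by (simp add: Comp_assoc_Arr tensor_Comp_left)
    also have "(\<i> \<boxtimes> (?m \<boxtimes> ?p)) \<cdot> Assoc C ?A (?A \<otimes> ?A) P = \<alpha> P \<cdot> ((\<i> \<boxtimes> ?m) \<boxtimes> ?p)"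
      using Assoc_natural_Arr[of \<i> ?m ?p] by simp
    also have "ev \<cdot> ((\<i> \<boxtimes> c) \<cdot> ((\<alpha> P \<cdot> ((\<i> \<boxtimes> ?m) \<boxtimes> ?p)) \<cdot> (Assoc C ?A ?A ?A \<boxtimes> ?p)))
        = ev \<cdot> ((?m \<cdot> ((\<i> \<boxtimes> ?m) \<cdot> Assoc C ?A ?A ?A)) \<boxtimes> ?p)"
      by (simp add: ev_action_left tensor_Comp Comp_assoc_Arr)
    also have "\<dots> = ev \<cdot> ((?m \<boxtimes> ?p) \<cdot> ((?m \<boxtimes> \<i>) \<boxtimes> ?p))"
      by (simp add: Mult_assoc[symmetric] tensor_Comp)
    also have "\<dots> = ev \<cdot> ((\<i> \<boxtimes> c) \<cdot> (\<alpha> P \<cdot> ((?m \<boxtimes> \<i>) \<boxtimes> ?p)))"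
      by (simp add: ev_action_left)
    also have "\<alpha> P \<cdot> ((?m \<boxtimes> \<i>) \<boxtimes> ?p) = (?m \<boxtimes> Ident C (?A \<otimes> P)) \<cdot> Assoc C (?A \<otimes> ?A) ?A P"
      using Assoc_natural_Arr[of ?m \<i> ?p] by simp
    also have "ev \<cdot> ((\<i> \<boxtimes> c) \<cdot> ((?m \<boxtimes> Ident C (?A \<otimes> P)) \<cdot> Assoc C (?A \<otimes> ?A) ?A P))
        = ev \<cdot> ((?m \<boxtimes> ?p) \<cdot> (((\<i> \<boxtimes> \<i>) \<boxtimes> c) \<cdot> Assoc C (?A \<otimes> ?A) ?A P))"
      by (simp add: tensor_Comp_left)
    also have "\<dots> = ev \<cdot> ((\<i> \<boxtimes> c) \<cdot> (\<alpha> P \<cdot> (((\<i> \<boxtimes> \<i>) \<boxtimes> c) \<cdot> Assoc C (?A \<otimes> ?A) ?A P)))"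
      by (rule ev_action_left[symmetric]) simp_all
    also have "\<alpha> P \<cdot> (((\<i> \<boxtimes> \<i>) \<boxtimes> c) \<cdot> Assoc C (?A \<otimes> ?A) ?A P)
        = (\<alpha> P \<cdot> ((\<i> \<boxtimes> \<i>) \<boxtimes> c)) \<cdot> Assoc C (?A \<otimes> ?A) ?A P"
      by (rule Comp_assoc_Arr[symmetric]) simp_all
    also have "\<alpha> P \<cdot> ((\<i> \<boxtimes> \<i>) \<boxtimes> c) = (\<i> \<boxtimes> (\<i> \<boxtimes> c)) \<cdot> \<alpha> (?A \<otimes> P)"
      using Assoc_natural_Arr[of \<i> \<i> c] by simp
    also have "((\<i> \<boxtimes> (\<i> \<boxtimes> c)) \<cdot> \<alpha> (?A \<otimes> P)) \<cdot> Assoc C (?A \<otimes> ?A) ?A P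
        = (\<i> \<boxtimes> (\<i> \<boxtimes> c)) \<cdot> ((\<i> \<boxtimes> \<alpha> P) \<cdot> ?e)"
      by (simp add: Comp_assoc_Arr pentagon)
    also have "ev \<cdot> ((\<i> \<boxtimes> c) \<cdot> ((\<i> \<boxtimes> (\<i> \<boxtimes> c)) \<cdot> ((\<i> \<boxtimes> \<alpha> P) \<cdot> ?e)))
        = (ev \<cdot> (\<i> \<boxtimes> (c \<cdot> ((\<i> \<boxtimes> c) \<cdot> \<alpha> P)))) \<cdot> ?e"
      by (simp add: Comp_assoc_Arr tensor_Comp_left)
    finally show "ev \<cdot> (\<i> \<boxtimes> (c \<cdot> (?m \<boxtimes> ?p))) = ev \<cdot> (\<i> \<boxtimes> (c \<cdot> ((\<i> \<boxtimes> c) \<cdot> \<alpha> P)))"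
      by (rule iso_cancel_right[OF e, rotated 3]) (simp_all add: Hom_def)
  qed simp_all
  with unit show ?thesis by (simp add: left_module_pair Hom_def)
qed

text \<open>The counit \<open>P \<rightarrow> E\<close> of the cofree module is evaluation at the unit of \<open>A\<close>.\<close>

definition counit :: 'a where
  "counit = ev \<cdot> ((One A \<boxtimes> Ident C P) \<cdot> inv_arr C (LUnit C P))"

lemma counit_Arr [simp]: "counit \<in> Arr C" "Dom C counit = P" "Cod C counit = E"
  by (simp_all add: counit_def)

lemma counit_Comp_LUnit:
  assumes g: "g \<in> Hom C W P"
  shows "(counit \<cdot> g) \<cdot> LUnit C W = (ev \<cdot> (\<i> \<boxtimes> g)) \<cdot> (One A \<boxtimes> Ident C W)"
proof -
  note facts = g Hom_Obj[OF g]
  have "(counit \<cdot> g) \<cdot> LUnit C W = counit \<cdot> (LUnit C P \<cdot> (Ident C (Unit C) \<boxtimes> g))"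
    using facts LUnit_natural_Arr[of g] by (simp add: Hom_def Comp_assoc_Arr)
  also have "\<dots> = (counit \<cdot> LUnit C P) \<cdot> (Ident C (Unit C) \<boxtimes> g)"
    using facts by (simp add: Hom_def Comp_assoc_Arr)
  also have "counit \<cdot> LUnit C P = ev \<cdot> (One A \<boxtimes> Ident C P)"
    by (simp add: counit_def Comp_assoc_Arr)
  also have "(ev \<cdot> (One A \<boxtimes> Ident C P)) \<cdot> (Ident C (Unit C) \<boxtimes> g)
      = (ev \<cdot> (\<i> \<boxtimes> g)) \<cdot> (One A \<boxtimes> Ident C W)"
    using facts by (simp add: Hom_def Comp_assoc_Arr tensor_Comp)
  finally show ?thesis .
qed

lemma counit_Comp_action: "counit \<cdot> c = ev"
proof -
  let ?A = "Carrier A"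
  let ?e = "LUnit C (?A \<otimes> P) \<cdot> Assoc C (Unit C) ?A P"
  have e: "is_iso C ?e"
    by (rule is_iso_Comp[of _ _ "(Unit C \<otimes> ?A) \<otimes> P" "Unit C \<otimes> (?A \<otimes> P)" "?A \<otimes> P"])
      (simp_all add: Hom_def)
  have "(counit \<cdot> c) \<cdot> ?e = ((counit \<cdot> c) \<cdot> LUnit C (?A \<otimes> P)) \<cdot> Assoc C (Unit C) ?A P"
    by (simp add: Comp_assoc_Arr)
  also have "\<dots> = ev \<cdot> ((\<i> \<boxtimes> c) \<cdot> ((One A \<boxtimes> (\<i> \<boxtimes> Ident C P)) \<cdot> Assoc C (Unit C) ?A P))"
    by (simp add: counit_Comp_LUnit[OF action_in] Comp_assoc_Arr)
  also have "(One A \<boxtimes> (\<i> \<boxtimes> Ident C P)) \<cdot> Assoc C (Unit C) ?A P = \<alpha> P \<cdot> ((One A \<boxtimes> \<i>) \<boxtimes> Ident C P)"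
    using Assoc_natural_Arr[of "One A" \<i> "Ident C P"] by simp
  also have "ev \<cdot> ((\<i> \<boxtimes> c) \<cdot> (\<alpha> P \<cdot> ((One A \<boxtimes> \<i>) \<boxtimes> Ident C P))) = ev \<cdot> (LUnit C ?A \<boxtimes> Ident C P)"
    by (simp add: ev_action_left tensor_Comp One_left)
  also have "\<dots> = ev \<cdot> ?e" by (simp add: LUnit_tensor)
  finally show ?thesis
    by (rule iso_cancel_right[OF e, rotated 3]) (simp_all add: Hom_def)
qed

text \<open>The module map corresponding to \<open>f : X \<rightarrow> E\<close> is the transpose of \<open>A \<otimes> X \<rightarrow> X \<rightarrow> E\<close>.\<close>

lemma cofree_couniversal:
  "couniversal (module_cat C A) C forget E (P, c) counit"
  unfolding couniversal_def
proof (intro conjI ballI)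
  show "(P, c) \<in> Obj (module_cat C A)" using cofree_module by simp
  show "counit \<in> Hom C (obmap forget (P, c)) E" by (simp add: Hom_def)
next
  fix X f assume "X \<in> Obj (module_cat C A)" and f: "f \<in> Hom C (obmap forget X) E"
  then have X: "left_module C A X" by simp
  note facts [simp] = left_moduleD(1-4)[OF X]
  have f_Arr [simp]: "f \<in> Arr C" "Dom C f = fst X" "Cod C f = E" using f by (auto simp: Hom_def)
  have "f \<cdot> snd X \<in> Hom C (obmap (partial_funct C (Tensor C) (Carrier A)) (fst X)) E"
    by (simp add: Hom_def)
  then obtain g where g: "g \<in> Hom C (fst X) P" "ev \<cdot> (\<i> \<boxtimes> g) = f \<cdot> snd X"
    using couniversal_exists[OF ev_couniversal, of "fst X" "f \<cdot> snd X"] by auto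
  have "g \<cdot> snd X = c \<cdot> (\<i> \<boxtimes> g)"
    by (rule linear_if_balanced[OF _ g])
      (use left_moduleD(5)[OF X] in \<open>simp_all add: Hom_def Comp_assoc_Arr\<close>)
  then have g_mod: "(X, (P, c), g) \<in> Hom (module_cat C A) X (P, c)"
    using g X cofree_module by simp
  have "(counit \<cdot> g) \<cdot> LUnit C (fst X) = f \<cdot> LUnit C (fst X)"
    using left_moduleD(6)[OF X] by (simp add: counit_Comp_LUnit[OF g(1)] g(2) Comp_assoc_Arr)
  then have counit_g: "counit \<cdot> g = f"
    by (rule iso_cancel_right[rotated 4]) (use g(1) in \<open>simp_all add: Hom_def\<close>)
  show "\<exists>!\<gamma>. \<gamma> \<in> Hom (module_cat C A) X (P, c) \<and> counit \<cdot> armap forget \<gamma> = f"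
  proof (rule ex1I[of _ "(X, (P, c), g)"])
    show "(X, (P, c), g) \<in> Hom (module_cat C A) X (P, c) \<and> counit \<cdot> armap forget (X, (P, c), g) = f"
      using g_mod counit_g by simp
  next
    fix \<gamma> assume \<gamma>: "\<gamma> \<in> Hom (module_cat C A) X (P, c) \<and> counit \<cdot> armap forget \<gamma> = f"
    then obtain g' where g': "\<gamma> = (X, (P, c), g')" "g' \<in> Hom C (fst X) P"
        "g' \<cdot> snd X = c \<cdot> (\<i> \<boxtimes> g')"
      by (auto elim: module_HomE)
    have "ev \<cdot> (\<i> \<boxtimes> g') = (counit \<cdot> c) \<cdot> (\<i> \<boxtimes> g')" by (simp only: counit_Comp_action)
    also have "\<dots> = counit \<cdot> (c \<cdot> (\<i> \<boxtimes> g'))"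
      using g'(2) by (intro Comp_assoc_Arr) (simp_all add: Hom_def)
    also have "\<dots> = (counit \<cdot> g') \<cdot> snd X"
      unfolding g'(3)[symmetric] using g'(2) by (simp add: Hom_def Comp_assoc_Arr)
    also have "\<dots> = ev \<cdot> (\<i> \<boxtimes> g)" using \<gamma> g'(1) g(2) by simp
    finally have "ev \<cdot> (\<i> \<boxtimes> g') = ev \<cdot> (\<i> \<boxtimes> g)" .
    then have "g' = g"
      by (rule transpose_unique[rotated 5]) (use g(1) g'(2) in \<open>simp_all add: Hom_def\<close>)
    then show "\<gamma> = (X, (P, c), g)" using g'(1) by simp
  qed
qed

end


subsection \<open>Cofibrant and fibrant modules\<close>

lemma module_model_simps [simp]:
  "(X, Y, f) \<in> Weq (module_model C M A) \<longleftrightarrow> (X, Y, f) \<in> Arr (module_cat C A) \<and> f \<in> Weq M"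
  "(X, Y, f) \<in> Fib (module_model C M A) \<longleftrightarrow> (X, Y, f) \<in> Arr (module_cat C A) \<and> f \<in> Fib M"
  "Cof (module_model C M A) =
     llp (module_cat C A) (Fib (module_model C M A) \<inter> Weq (module_model C M A))"
  by (simp_all add: module_model_def Let_def)

text \<open>Forgetting the action of a monoid that is cofibrant as an object preserves cofibrations: the
  cofree module functor, which is the internal hom out of the monoid, preserves trivial fibrations.\<close>

lemma (in monoidal_model_category) forget_Cof:
  assumes A: "monoid_object C A" "cofibrant C M (Carrier A)" and i: "i \<in> Cof (module_model C M A)"
  shows "armap forget i \<in> Cof M"
proof -
  interpret A: monoid_object C A by (rule A)
  interpret forget: is_functor "module_cat C A" C forget by (rule forget_is_functor[OF A.Carrier_in])
  let ?T = "partial_funct C (Tensor C) (Carrier A)"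
  have i_Arr: "i \<in> Arr (module_cat C A)"
    and lift: "\<And>p. p \<in> Fib (module_model C M A) \<inter> Weq (module_model C M A) \<Longrightarrow> has_lift (module_cat C A) i p"
    using i by (auto simp: llp_def)
  have "has_lift C (armap forget i) p" if p: "p \<in> Fib M \<inter> Weq M" for p
  proof -
    have p_Arr [simp]: "p \<in> Arr C" using p classes by blast
    let ?E = "Dom C p" and ?B = "Cod C p"
    have p_Hom: "p \<in> Hom C ?E ?B" by (simp add: Hom_def)
    obtain P ev where ev: "couniversal C C ?T ?E P ev"
      using tensor_left_couniversal[of "Carrier A" ?E] by auto
    obtain P' ev' where ev': "couniversal C C ?T ?B P' ev'"
      using tensor_left_couniversal[of "Carrier A" ?B] by auto
    obtain c c' where "cofree_action C A ?E P ev c" "cofree_action C A ?B P' ev' c'"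
      using A.cofree_action_exists[OF ev] A.cofree_action_exists[OF ev'] by blast
    then interpret E: cofree_action C A ?E P ev c + B: cofree_action C A ?B P' ev' c' by simp_all
    have "p \<cdot> ev \<in> Hom C (obmap ?T P) ?B" by (simp add: Hom_def)
    then obtain q where q: "q \<in> Hom C P P'" and ev_q: "ev' \<cdot> (Ident C (Carrier A) \<boxtimes> q) = p \<cdot> ev"
      using couniversal_exists[OF ev', of P "p \<cdot> ev"] by auto
    have q_Arr [simp]: "q \<in> Arr C" "Dom C q = P" "Cod C q = P'" using q by (auto simp: Hom_def)
    \<comment> \<open>\<open>q\<close> is the map \<open>[A, p]\<close> of internal homs.\<close>
    have q_trivial_Fib: "q \<in> Fib M \<inter> Weq M"
      by (rule couniversal_trivial_Fib[OF model_category_axioms model_category_axioms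
            tensor_left_is_functor[OF A.Carrier_in] _ p p_Hom ev ev' q])
        (simp_all add: Cof_tensor_left[OF A(2)] ev_q)
    have "q \<cdot> c = c' \<cdot> (Ident C (Carrier A) \<boxtimes> q)"
      by (rule B.linear_if_balanced[OF E.action_in q ev_q]) (simp add: Comp_assoc_Arr E.ev_action)
    then have q_mod: "((P, c), (P', c'), q) \<in> Arr (module_cat C A)"
      using E.cofree_module B.cofree_module q by simp
    have "(B.counit \<cdot> q) \<cdot> LUnit C P = p \<cdot> (ev \<cdot> (One A \<boxtimes> Ident C P))"
      using B.counit_Comp_LUnit[OF q] by (simp add: ev_q Comp_assoc_Arr)
    also have "ev \<cdot> (One A \<boxtimes> Ident C P) = E.counit \<cdot> LUnit C P"
      using E.counit_Comp_LUnit[of "Ident C P" P] by (simp add: Hom_def)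
    also have "p \<cdot> (E.counit \<cdot> LUnit C P) = (p \<cdot> E.counit) \<cdot> LUnit C P"
      by (simp add: Comp_assoc_Arr)
    finally have "B.counit \<cdot> q = p \<cdot> E.counit"
      by (rule iso_cancel_right[rotated 4]) (simp_all add: Hom_def)
    then have "has_lift C (armap forget i) p \<longleftrightarrow> has_lift (module_cat C A) i ((P, c), (P', c'), q)"
      using q_mod
      by (intro forget.has_lift_transpose[OF i_Arr p_Hom E.cofree_couniversal B.cofree_couniversal]) auto
    moreover have "((P, c), (P', c'), q) \<in> Fib (module_model C M A) \<inter> Weq (module_model C M A)"
      using q_mod q_trivial_Fib by (simp del: module_cat_simps)
    ultimately show ?thesis using lift by blast
  qed
  then show ?thesis using i_Arr by (simp add: Cof_eq_llp llp_def)
qed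

text \<open>As a left adjoint, the forgetful functor also preserves initial objects.\<close>

lemma (in monoidal_model_category) cofibrant_forget:
  assumes A: "monoid_object C A" "cofibrant C M (Carrier A)"
    and X: "cofibrant (module_cat C A) (module_model C M A) X"
  shows "cofibrant C M (fst X)"
proof -
  interpret A: monoid_object C A by (rule A)
  interpret forget: is_functor "module_cat C A" C forget by (rule forget_is_functor[OF A.Carrier_in])
  obtain Z z where Z: "initial (module_cat C A) Z" and z: "z \<in> Hom (module_cat C A) Z X"
      "z \<in> Cof (module_model C M A)"
    using X by (auto simp: cofibrant_def)
  have "\<exists>V \<epsilon>. couniversal (module_cat C A) C forget Y V \<epsilon>" if Y: "Y \<in> Obj C" for Y
  proof -
    obtain P ev where ev: "couniversal C C (partial_funct C (Tensor C) (Carrier A)) Y P ev"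
      using tensor_left_couniversal[OF A.Carrier_in Y] by blast
    obtain c where "cofree_action C A Y P ev c" using A.cofree_action_exists[OF ev] by blast
    from cofree_action.cofree_couniversal[OF this] show ?thesis by blast
  qed
  from forget.initial_obmap[OF this Z] have "initial C (fst Z)" by simp
  moreover have "armap forget z \<in> Hom C (fst Z) (fst X)" using forget.armap_in[OF z(1)] by simp
  moreover have "armap forget z \<in> Cof M" by (rule forget_Cof[OF A z(2)])
  ultimately show ?thesis using Hom_Obj unfolding cofibrant_def by blast
qed

text \<open>A terminal object is a limit of the empty diagram, which is small since \<open>\<kappa>\<close> is infinite.\<close>

lemma (in model_category) terminal_exists:
  assumes "universe \<kappa>"
  shows "\<exists>T. terminal C T"
proof -
  define J :: "('u, 'u) category" where
    "J = \<lparr>Obj = {}, Arr = {}, Dom = undefined, Cod = undefined, Ident = undefined, Comp = undefined\<rparr>"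
  \<comment> \<open>Every \<open>G\<close> is a functor on the empty category.\<close>
  define G :: "('u, 'u, 'o, 'a) funct" where "G = undefined"
  have J: "category J" by unfold_locales (auto simp: J_def Hom_def)
  have "|{} :: 'u set| <o \<kappa>"
    using assms by (intro finite_ordLess_infinite[OF card_of_Well_order])
      (auto simp: universe_def card_order_on_def Field_card_of)
  then have "small_cat \<kappa> J" using J by (simp add: small_cat_def J_def)
  moreover have "is_functor J C G"
    by (intro is_functor.intro is_functor_axioms.intro J category_axioms) (auto simp: J_def Hom_def)
  ultimately obtain L \<pi> where L: "is_limit C J G L \<pi>"
    using bicomplete unfolding bicomplete_def by blast
  have cocone: "is_cocone (op_cat C) (op_cat J) G Y \<pi>" if "Y \<in> Obj C" for Y
    using that by (simp add: is_cocone_def op_cat_def J_def)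
  have "terminal C L"
    unfolding terminal_def
  proof (intro conjI ballI)
    show "L \<in> Obj C" using L by (simp add: is_limit_def is_colimit_def is_cocone_def op_cat_def)
    fix Y assume "Y \<in> Obj C"
    then have "\<exists>!h. h \<in> Hom (op_cat C) L Y \<and> (\<forall>i\<in>Obj (op_cat J). h \<cdot>\<^bsub>op_cat C\<^esub> \<pi> i = \<pi> i)"
      using L cocone unfolding is_limit_def is_colimit_def by blast
    moreover have "Hom (op_cat C) L Y = Hom C Y L" by (auto simp: Hom_def op_cat_def)
    ultimately show "\<exists>!h. h \<in> Hom C Y L" by (simp add: op_cat_def J_def)
  qed
  then show ?thesis ..
qed

text \<open>A terminal object carries an action, and the resulting module is terminal. So the object underlying
  any terminal module is isomorphic to a terminal object.\<close>

lemma (in monoidal_category) terminal_forget: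
  assumes A: "Carrier A \<in> Obj C" "Mult A \<in> Hom C (Carrier A \<otimes> Carrier A) (Carrier A)"
      "One A \<in> Hom C (Unit C) (Carrier A)"
    and T: "terminal C T" and Z: "terminal (module_cat C A) Z"
  shows "terminal C (fst Z)"
proof -
  interpret mod: category "module_cat C A" by (rule module_cat_category[OF A(1)])
  have T_Obj [simp]: "T \<in> Obj C" using T by (simp add: terminal_def)
  have eq: "f = g" if "f \<in> Hom C X T" "g \<in> Hom C X T" for f g X
    using T that Hom_Obj[OF that(1)] unfolding terminal_def by blast
  have Z_mod: "left_module C A Z" using Z by (simp add: terminal_def)
  note Z_Arr [simp] = left_moduleD(1-4)[OF Z_mod]
  note A_Arr [simp] = A(1)
  have AT: "Carrier A \<otimes> T \<in> Obj C" by simp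
  then obtain t where t: "t \<in> Hom C (Carrier A \<otimes> T) T" using T unfolding terminal_def by blast
  have T_mod: "left_module C A (T, t)"
    unfolding left_module_pair
  proof (intro conjI)
    show "t \<cdot> (Mult A \<boxtimes> Ident C T) = t \<cdot> ((Ident C (Carrier A) \<boxtimes> t) \<cdot> Assoc C (Carrier A) (Carrier A) T)"
      by (rule eq[of _ "(Carrier A \<otimes> Carrier A) \<otimes> T"]) (use t A in \<open>simp_all add: Hom_def\<close>)
    show "t \<cdot> (One A \<boxtimes> Ident C T) = LUnit C T"
      by (rule eq[of _ "Unit C \<otimes> T"]) (use t A in \<open>simp_all add: Hom_def\<close>)
  qed (use t in simp_all)
  have "\<exists>!\<rho>. \<rho> \<in> Hom (module_cat C A) (T, t) Z" using Z T_mod by (simp add: terminal_def)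
  then obtain \<rho> where \<rho>: "\<rho> \<in> Hom (module_cat C A) (T, t) Z" by blast
  then obtain r where r: "((T, t), Z, r) \<in> Hom (module_cat C A) (T, t) Z"
    by (metis module_HomE)
  have r_Arr [simp]: "r \<in> Arr C" "Dom C r = T" "Cod C r = fst Z" using r by (auto simp: Hom_def)
  have "\<exists>!s. s \<in> Hom C (fst Z) T" using T unfolding terminal_def by simp
  then obtain s where s: "s \<in> Hom C (fst Z) T" by blast
  have s_Arr [simp]: "s \<in> Arr C" "Dom C s = fst Z" "Cod C s = T" using s by (auto simp: Hom_def)
  have "s \<cdot> snd Z = t \<cdot> (Ident C (Carrier A) \<boxtimes> s)"
    by (rule eq[of _ "Carrier A \<otimes> fst Z"]) (use t in \<open>simp_all add: Hom_def\<close>)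
  then have s_mod: "(Z, (T, t), s) \<in> Hom (module_cat C A) Z (T, t)" using Z_mod T_mod s by simp
  have "(Z, Z, r \<cdot> s) \<in> Hom (module_cat C A) Z Z" using mod.Comp_in[OF s_mod r] by simp
  moreover have "(Z, Z, Ident C (fst Z)) \<in> Hom (module_cat C A) Z Z"
    using mod.Ident_in[of Z] Z_mod by simp
  ultimately have "(Z, Z, r \<cdot> s) = (Z, Z, Ident C (fst Z))"
    using Z Z_mod unfolding terminal_def by blast
  then have rs: "r \<cdot> s = Ident C (fst Z)" by simp
  show ?thesis
    unfolding terminal_def
  proof (intro conjI ballI)
    fix Y assume Y: "Y \<in> Obj C"
    then obtain y where y: "y \<in> Hom C Y T" using T unfolding terminal_def by blast
    have "f = r \<cdot> y" if "f \<in> Hom C Y (fst Z)" for f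
    proof -
      have "f = (r \<cdot> s) \<cdot> f" unfolding rs using that by (simp add: Hom_def)
      also have "\<dots> = r \<cdot> (s \<cdot> f)" using that by (simp add: Hom_def Comp_assoc_Arr)
      also have "s \<cdot> f = y" by (rule eq[of _ Y]) (use that y in \<open>simp_all add: Hom_def\<close>)
      finally show ?thesis .
    qed
    moreover have "r \<cdot> y \<in> Hom C Y (fst Z)" using y by (simp add: Hom_def)
    ultimately show "\<exists>!f. f \<in> Hom C Y (fst Z)" by blast
  qed simp
qed

lemma (in monoidal_model_category) fibrant_forget:
  assumes \<kappa>: "universe \<kappa>"
    and A: "Carrier A \<in> Obj C" "Mult A \<in> Hom C (Carrier A \<otimes> Carrier A) (Carrier A)"
      "One A \<in> Hom C (Unit C) (Carrier A)"
    and Y: "fibrant (module_cat C A) (module_model C M A) Y"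
  shows "fibrant C M (fst Y)"
proof -
  obtain T where T: "terminal C T" using terminal_exists[OF \<kappa>] ..
  obtain Z f where Z: "terminal (module_cat C A) Z" and f: "f \<in> Hom (module_cat C A) Y Z"
      "f \<in> Fib (module_model C M A)"
    using Y by (auto simp: fibrant_def)
  from f(1) obtain f' where "f = (Y, Z, f')" "f' \<in> Hom C (fst Y) (fst Z)" by (rule module_HomE)
  moreover from this f(2) have "f' \<in> Fib M" by simp
  ultimately show ?thesis
    using terminal_forget[OF A T Z] Hom_Obj[of f'] unfolding fibrant_def by blast
qed

section \<open>The functor on modules\<close>

lemma image_monoid_simps [simp]:
  "Carrier (image_monoid F D A) = obmap F (Carrier A)"
  "Mult (image_monoid F D A) = armap F (Mult A) \<cdot>\<^bsub>D\<^esub> mult_map F (Carrier A) (Carrier A)"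
  "One (image_monoid F D A) = armap F (One A) \<cdot>\<^bsub>D\<^esub> unit_map F"
  by (simp_all add: image_monoid_def)

lemma image_module_simps [simp]:
  "fst (image_module F D A X) = obmap F (fst X)"
  "snd (image_module F D A X) = armap F (snd X) \<cdot>\<^bsub>D\<^esub> mult_map F (Carrier A) (fst X)"
  by (simp_all add: image_module_def split: prod.splits)

lemma module_funct_simps [simp]:
  "obmap (module_funct F D A) X = image_module F D A X"
  "armap (module_funct F D A) (X, Y, f) = (image_module F D A X, image_module F D A Y, armap F f)"
  by (simp_all add: module_funct_def)

context monoidal_functor
begin

lemma mult_map_Arr [simp]:
  assumes "X \<in> Obj C" "Y \<in> Obj C"
  shows "mult_map F X Y \<in> Arr D" "Dom D (mult_map F X Y) = obmap F X \<otimes>\<^bsub>D\<^esub> obmap F Y"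
    "Cod D (mult_map F X Y) = obmap F (X \<otimes>\<^bsub>C\<^esub> Y)" "is_iso D (mult_map F X Y)"
  using mult_map_in[OF assms] by (auto simp: Hom_def)

lemma unit_map_Arr [simp]:
  "unit_map F \<in> Arr D" "Dom D (unit_map F) = Unit D" "Cod D (unit_map F) = obmap F (Unit C)"
  using unit_map_in by (auto simp: Hom_def)

lemma mult_map_natural_Arr:
  assumes "f \<in> Arr C" "g \<in> Arr C"
  shows "mult_map F (Cod C f) (Cod C g) \<cdot>\<^bsub>D\<^esub> (armap F f \<boxtimes>\<^bsub>D\<^esub> armap F g)
    = armap F (f \<boxtimes>\<^bsub>C\<^esub> g) \<cdot>\<^bsub>D\<^esub> mult_map F (Dom C f) (Dom C g)"
  by (rule mult_map_natural) (use assms in \<open>auto simp: Hom_def\<close>)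

lemma image_monoid_in:
  assumes "monoid_object C A"
  defines "B \<equiv> image_monoid F D A"
  shows "Carrier B \<in> Obj D" "Mult B \<in> Hom D (Carrier B \<otimes>\<^bsub>D\<^esub> Carrier B) (Carrier B)"
    "One B \<in> Hom D (Unit D) (Carrier B)"
proof -
  interpret A: monoid_object C A by (rule assms)
  show "Carrier B \<in> Obj D" "Mult B \<in> Hom D (Carrier B \<otimes>\<^bsub>D\<^esub> Carrier B) (Carrier B)"
    "One B \<in> Hom D (Unit D) (Carrier B)"
    by (simp_all add: B_def Hom_def)
qed

lemma image_module_left_module:
  assumes A: "monoid_object C A" and X: "left_module C A X"
  shows "left_module D (image_monoid F D A) (image_module F D A X)"
proof -
  interpret A: monoid_object C A by (rule A)
  obtain W a where Wa: "X = (W, a)" by (cases X)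
  note a [simp] = left_moduleD(1-4)[OF X, unfolded Wa fst_conv snd_conv]
  note a_assoc = left_moduleD(5)[OF X, unfolded Wa fst_conv snd_conv]
  note a_unit = left_moduleD(6)[OF X, unfolded Wa fst_conv snd_conv]
  let ?A = "Carrier A" and ?\<mu> = "mult_map F"
  let ?i = "Ident C ?A" and ?w = "Ident C W"
  let ?fi = "Ident D (obmap F ?A)" and ?fw = "Ident D (obmap F W)"
  note [simp] = armap_Comp_Arr source.Comp_assoc_Arr target.Comp_assoc_Arr
  have "(armap F a \<cdot>\<^bsub>D\<^esub> ?\<mu> ?A W) \<cdot>\<^bsub>D\<^esub> ((armap F (Mult A) \<cdot>\<^bsub>D\<^esub> ?\<mu> ?A ?A) \<boxtimes>\<^bsub>D\<^esub> ?fw)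
      = armap F a \<cdot>\<^bsub>D\<^esub> ((?\<mu> ?A W \<cdot>\<^bsub>D\<^esub> (armap F (Mult A) \<boxtimes>\<^bsub>D\<^esub> armap F ?w)) \<cdot>\<^bsub>D\<^esub> (?\<mu> ?A ?A \<boxtimes>\<^bsub>D\<^esub> ?fw))"
    by (simp add: target.tensor_Comp)
  also have "?\<mu> ?A W \<cdot>\<^bsub>D\<^esub> (armap F (Mult A) \<boxtimes>\<^bsub>D\<^esub> armap F ?w)
      = armap F (Mult A \<boxtimes>\<^bsub>C\<^esub> ?w) \<cdot>\<^bsub>D\<^esub> ?\<mu> (?A \<otimes>\<^bsub>C\<^esub> ?A) W"
    using mult_map_natural_Arr[of "Mult A" ?w] by simp
  also have "armap F a \<cdot>\<^bsub>D\<^esub> ((armap F (Mult A \<boxtimes>\<^bsub>C\<^esub> ?w) \<cdot>\<^bsub>D\<^esub> ?\<mu> (?A \<otimes>\<^bsub>C\<^esub> ?A) W) \<cdot>\<^bsub>D\<^esub> (?\<mu> ?A ?A \<boxtimes>\<^bsub>D\<^esub> ?fw))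
      = armap F (a \<cdot>\<^bsub>C\<^esub> (Mult A \<boxtimes>\<^bsub>C\<^esub> ?w)) \<cdot>\<^bsub>D\<^esub> (?\<mu> (?A \<otimes>\<^bsub>C\<^esub> ?A) W \<cdot>\<^bsub>D\<^esub> (?\<mu> ?A ?A \<boxtimes>\<^bsub>D\<^esub> ?fw))"
    by simp
  also have "\<dots> = armap F a \<cdot>\<^bsub>D\<^esub> (armap F (?i \<boxtimes>\<^bsub>C\<^esub> a) \<cdot>\<^bsub>D\<^esub>
      (armap F (Assoc C ?A ?A W) \<cdot>\<^bsub>D\<^esub> (?\<mu> (?A \<otimes>\<^bsub>C\<^esub> ?A) W \<cdot>\<^bsub>D\<^esub> (?\<mu> ?A ?A \<boxtimes>\<^bsub>D\<^esub> ?fw))))"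
    unfolding a_assoc by simp
  also have "\<dots> = armap F a \<cdot>\<^bsub>D\<^esub> ((armap F (?i \<boxtimes>\<^bsub>C\<^esub> a) \<cdot>\<^bsub>D\<^esub> ?\<mu> ?A (?A \<otimes>\<^bsub>C\<^esub> W)) \<cdot>\<^bsub>D\<^esub>
      ((?fi \<boxtimes>\<^bsub>D\<^esub> ?\<mu> ?A W) \<cdot>\<^bsub>D\<^esub> Assoc D (obmap F ?A) (obmap F ?A) (obmap F W)))"
    by (simp add: mult_map_assoc)
  also have "armap F (?i \<boxtimes>\<^bsub>C\<^esub> a) \<cdot>\<^bsub>D\<^esub> ?\<mu> ?A (?A \<otimes>\<^bsub>C\<^esub> W) = ?\<mu> ?A W \<cdot>\<^bsub>D\<^esub> (?fi \<boxtimes>\<^bsub>D\<^esub> armap F a)"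
    using mult_map_natural_Arr[of ?i a] by simp
  finally have assoc: "(armap F a \<cdot>\<^bsub>D\<^esub> ?\<mu> ?A W) \<cdot>\<^bsub>D\<^esub> ((armap F (Mult A) \<cdot>\<^bsub>D\<^esub> ?\<mu> ?A ?A) \<boxtimes>\<^bsub>D\<^esub> ?fw)
      = (armap F a \<cdot>\<^bsub>D\<^esub> ?\<mu> ?A W) \<cdot>\<^bsub>D\<^esub> ((?fi \<boxtimes>\<^bsub>D\<^esub> (armap F a \<cdot>\<^bsub>D\<^esub> ?\<mu> ?A W)) \<cdot>\<^bsub>D\<^esub>
          Assoc D (obmap F ?A) (obmap F ?A) (obmap F W))"
    by (simp add: target.tensor_Comp_left)
  have "(armap F a \<cdot>\<^bsub>D\<^esub> ?\<mu> ?A W) \<cdot>\<^bsub>D\<^esub> ((armap F (One A) \<cdot>\<^bsub>D\<^esub> unit_map F) \<boxtimes>\<^bsub>D\<^esub> ?fw)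
      = armap F a \<cdot>\<^bsub>D\<^esub> ((?\<mu> ?A W \<cdot>\<^bsub>D\<^esub> (armap F (One A) \<boxtimes>\<^bsub>D\<^esub> armap F ?w)) \<cdot>\<^bsub>D\<^esub> (unit_map F \<boxtimes>\<^bsub>D\<^esub> ?fw))"
    by (simp add: target.tensor_Comp)
  also have "?\<mu> ?A W \<cdot>\<^bsub>D\<^esub> (armap F (One A) \<boxtimes>\<^bsub>D\<^esub> armap F ?w)
      = armap F (One A \<boxtimes>\<^bsub>C\<^esub> ?w) \<cdot>\<^bsub>D\<^esub> ?\<mu> (Unit C) W"
    using mult_map_natural_Arr[of "One A" ?w] by simp
  also have "armap F a \<cdot>\<^bsub>D\<^esub> ((armap F (One A \<boxtimes>\<^bsub>C\<^esub> ?w) \<cdot>\<^bsub>D\<^esub> ?\<mu> (Unit C) W) \<cdot>\<^bsub>D\<^esub> (unit_map F \<boxtimes>\<^bsub>D\<^esub> ?fw))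
      = armap F (a \<cdot>\<^bsub>C\<^esub> (One A \<boxtimes>\<^bsub>C\<^esub> ?w)) \<cdot>\<^bsub>D\<^esub> (?\<mu> (Unit C) W \<cdot>\<^bsub>D\<^esub> (unit_map F \<boxtimes>\<^bsub>D\<^esub> ?fw))"
    by simp
  also have "\<dots> = LUnit D (obmap F W)" unfolding a_unit by (simp add: unit_map_left)
  finally show ?thesis
    using assoc by (simp add: left_module_def image_module_def Wa Hom_def del: target.Comp_assoc_Arr)
qed

lemma module_funct_is_functor:
  assumes A: "monoid_object C A"
  shows "is_functor (module_cat C A) (module_cat D (image_monoid F D A)) (module_funct F D A)"
proof -
  interpret A: monoid_object C A by (rule A)
  interpret modC: category "module_cat C A" by (rule source.module_cat_category[OF A.Carrier_in])
  interpret modD: category "module_cat D (image_monoid F D A)"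
    by (rule target.module_cat_category) simp
  show ?thesis
  proof
    fix X assume X: "X \<in> Obj (module_cat C A)"
    then show "obmap (module_funct F D A) X \<in> Obj (module_cat D (image_monoid F D A))"
      using image_module_left_module[OF A] by simp
    show "armap (module_funct F D A) (Ident (module_cat C A) X)
        = Ident (module_cat D (image_monoid F D A)) (obmap (module_funct F D A) X)"
      using X left_moduleD(1)[of C A X] by simp
  next
    fix f X Y assume "f \<in> Hom (module_cat C A) X Y"
    then obtain f' where f: "f = (X, Y, f')" "left_module C A X" "left_module C A Y"
        "f' \<in> Hom C (fst X) (fst Y)" "f' \<cdot>\<^bsub>C\<^esub> snd X = snd Y \<cdot>\<^bsub>C\<^esub> (Ident C (Carrier A) \<boxtimes>\<^bsub>C\<^esub> f')"
      by (rule module_HomE)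
    note facts = f(4) left_moduleD(1-4)[OF f(2)] left_moduleD(1-4)[OF f(3)]
    have "armap F f' \<cdot>\<^bsub>D\<^esub> (armap F (snd X) \<cdot>\<^bsub>D\<^esub> mult_map F (Carrier A) (fst X))
        = armap F (f' \<cdot>\<^bsub>C\<^esub> snd X) \<cdot>\<^bsub>D\<^esub> mult_map F (Carrier A) (fst X)"
      using facts by (simp add: Hom_def armap_Comp_Arr target.Comp_assoc_Arr)
    also have "\<dots> = armap F (snd Y) \<cdot>\<^bsub>D\<^esub>
        (armap F (Ident C (Carrier A) \<boxtimes>\<^bsub>C\<^esub> f') \<cdot>\<^bsub>D\<^esub> mult_map F (Carrier A) (fst X))"
      unfolding f(5) using facts by (simp add: Hom_def armap_Comp_Arr target.Comp_assoc_Arr)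
    also have "armap F (Ident C (Carrier A) \<boxtimes>\<^bsub>C\<^esub> f') \<cdot>\<^bsub>D\<^esub> mult_map F (Carrier A) (fst X)
        = mult_map F (Carrier A) (fst Y) \<cdot>\<^bsub>D\<^esub> (Ident D (obmap F (Carrier A)) \<boxtimes>\<^bsub>D\<^esub> armap F f')"
      using mult_map_natural_Arr[of "Ident C (Carrier A)" f'] facts by (simp add: Hom_def)
    finally show "armap (module_funct F D A) f \<in> Hom (module_cat D (image_monoid F D A))
        (obmap (module_funct F D A) X) (obmap (module_funct F D A) Y)"
      using f(1-3) facts image_module_left_module[OF A]
      by (simp add: Hom_def target.Comp_assoc_Arr)
  next
    fix f X Y g Z assume "f \<in> Hom (module_cat C A) X Y" "g \<in> Hom (module_cat C A) Y Z"
    then show "armap (module_funct F D A) (g \<cdot>\<^bsub>module_cat C A\<^esub> f)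
        = armap (module_funct F D A) g \<cdot>\<^bsub>module_cat D (image_monoid F D A)\<^esub> armap (module_funct F D A) f"
      by (elim module_HomE) (simp add: armap_Comp)
  qed
qed


text \<open>The right adjoint on modules acts as \<open>U\<close> on underlying objects: a couniversal arrow
  \<open>\<epsilon> : F P \<rightarrow> Y\<close> to the object underlying a module over \<open>F A\<close> lifts to modules, where \<open>A\<close> acts on \<open>P\<close>
  by the transpose of \<open>F A \<otimes> F P \<rightarrow> F A \<otimes> Y \<rightarrow> Y\<close>.\<close>

lemma module_funct_couniversal:
  assumes A: "monoid_object C A" and Y: "left_module D (image_monoid F D A) (Y, b)"
    and \<epsilon>: "couniversal C D F Y P \<epsilon>"
  shows "\<exists>d. couniversal (module_cat C A) (module_cat D (image_monoid F D A)) (module_funct F D A)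
    (Y, b) (P, d) (image_module F D A (P, d), (Y, b), \<epsilon>)"
proof -
  interpret A: monoid_object C A by (rule A)
  let ?A = "Carrier A" and ?\<mu> = "mult_map F" and ?B = "image_monoid F D A"
  let ?i = "Ident C ?A" and ?p = "Ident C P"
  let ?fi = "Ident D (obmap F ?A)" and ?fp = "Ident D (obmap F P)"
  note [simp] = armap_Comp_Arr source.Comp_assoc_Arr target.Comp_assoc_Arr
  note b [simp] = left_moduleD(1-4)[OF Y, simplified]
  have P [simp]: "P \<in> Obj C" "\<epsilon> \<in> Arr D" "Dom D \<epsilon> = obmap F P" "Cod D \<epsilon> = Y"
    using couniversalD[OF \<epsilon>] by (auto simp: Hom_def)
  let ?k = "b \<cdot>\<^bsub>D\<^esub> ((?fi \<boxtimes>\<^bsub>D\<^esub> \<epsilon>) \<cdot>\<^bsub>D\<^esub> inv_arr D (?\<mu> ?A P))"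
  have "?k \<in> Hom D (obmap F (?A \<otimes>\<^bsub>C\<^esub> P)) Y" by (simp add: Hom_def)
  then obtain d where d: "d \<in> Hom C (?A \<otimes>\<^bsub>C\<^esub> P) P" and \<epsilon>_d: "\<epsilon> \<cdot>\<^bsub>D\<^esub> armap F d = ?k"
    using couniversal_exists[OF \<epsilon>, of "?A \<otimes>\<^bsub>C\<^esub> P" ?k] by auto
  have d_Arr [simp]: "d \<in> Arr C" "Dom C d = ?A \<otimes>\<^bsub>C\<^esub> P" "Cod C d = P" using d by (auto simp: Hom_def)
  have \<epsilon>_action: "\<epsilon> \<cdot>\<^bsub>D\<^esub> (armap F d \<cdot>\<^bsub>D\<^esub> (?\<mu> ?A P \<cdot>\<^bsub>D\<^esub> x)) = b \<cdot>\<^bsub>D\<^esub> ((?fi \<boxtimes>\<^bsub>D\<^esub> \<epsilon>) \<cdot>\<^bsub>D\<^esub> x)"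
    if "x \<in> Arr D" "Cod D x = obmap F ?A \<otimes>\<^bsub>D\<^esub> obmap F P" for x
  proof -
    have "\<epsilon> \<cdot>\<^bsub>D\<^esub> (armap F d \<cdot>\<^bsub>D\<^esub> (?\<mu> ?A P \<cdot>\<^bsub>D\<^esub> x)) = ?k \<cdot>\<^bsub>D\<^esub> (?\<mu> ?A P \<cdot>\<^bsub>D\<^esub> x)"
      unfolding \<epsilon>_d[symmetric] using that by simp
    also have "\<dots> = b \<cdot>\<^bsub>D\<^esub> ((?fi \<boxtimes>\<^bsub>D\<^esub> \<epsilon>) \<cdot>\<^bsub>D\<^esub> ((inv_arr D (?\<mu> ?A P) \<cdot>\<^bsub>D\<^esub> ?\<mu> ?A P) \<cdot>\<^bsub>D\<^esub> x))"
      using that by (simp del: target.inv_arr_Arr(4))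
    finally show ?thesis using that by simp
  qed
  \<comment> \<open>The module axioms for \<open>d\<close> are checked on transposes, after composition with an isomorphism \<open>?e\<close> built from
    the structure maps of \<open>F\<close>; they become the module axioms for \<open>b\<close>.\<close>
  have unit: "d \<cdot>\<^bsub>C\<^esub> (One A \<boxtimes>\<^bsub>C\<^esub> ?p) = LUnit C P"
  proof (rule couniversal_unique[OF \<epsilon>, of _ "Unit C \<otimes>\<^bsub>C\<^esub> P"])
    let ?e = "?\<mu> (Unit C) P \<cdot>\<^bsub>D\<^esub> (unit_map F \<boxtimes>\<^bsub>D\<^esub> ?fp)"
    have e: "is_iso D ?e"
      by (rule target.is_iso_Comp[of _ _ "Unit D \<otimes>\<^bsub>D\<^esub> obmap F P" "obmap F (Unit C) \<otimes>\<^bsub>D\<^esub> obmap F P"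
            "obmap F (Unit C \<otimes>\<^bsub>C\<^esub> P)"]) (simp_all add: Hom_def target.is_iso_tensor unit_map_in)
    have "(\<epsilon> \<cdot>\<^bsub>D\<^esub> armap F (d \<cdot>\<^bsub>C\<^esub> (One A \<boxtimes>\<^bsub>C\<^esub> ?p))) \<cdot>\<^bsub>D\<^esub> ?e
        = \<epsilon> \<cdot>\<^bsub>D\<^esub> (armap F d \<cdot>\<^bsub>D\<^esub> ((armap F (One A \<boxtimes>\<^bsub>C\<^esub> ?p) \<cdot>\<^bsub>D\<^esub> ?\<mu> (Unit C) P) \<cdot>\<^bsub>D\<^esub> (unit_map F \<boxtimes>\<^bsub>D\<^esub> ?fp)))"
      by simp
    also have "armap F (One A \<boxtimes>\<^bsub>C\<^esub> ?p) \<cdot>\<^bsub>D\<^esub> ?\<mu> (Unit C) P = ?\<mu> ?A P \<cdot>\<^bsub>D\<^esub> (armap F (One A) \<boxtimes>\<^bsub>D\<^esub> ?fp)"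
      using mult_map_natural_Arr[of "One A" ?p] by simp
    also have "\<epsilon> \<cdot>\<^bsub>D\<^esub> (armap F d \<cdot>\<^bsub>D\<^esub> ((?\<mu> ?A P \<cdot>\<^bsub>D\<^esub> (armap F (One A) \<boxtimes>\<^bsub>D\<^esub> ?fp)) \<cdot>\<^bsub>D\<^esub> (unit_map F \<boxtimes>\<^bsub>D\<^esub> ?fp)))
        = b \<cdot>\<^bsub>D\<^esub> ((armap F (One A) \<cdot>\<^bsub>D\<^esub> unit_map F) \<boxtimes>\<^bsub>D\<^esub> \<epsilon>)"
      by (simp add: \<epsilon>_action target.tensor_Comp)
    also have "\<dots> = (b \<cdot>\<^bsub>D\<^esub> (One ?B \<boxtimes>\<^bsub>D\<^esub> Ident D Y)) \<cdot>\<^bsub>D\<^esub> (Ident D (Unit D) \<boxtimes>\<^bsub>D\<^esub> \<epsilon>)"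
      by (simp add: target.tensor_Comp)
    also have "\<dots> = \<epsilon> \<cdot>\<^bsub>D\<^esub> LUnit D (obmap F P)"
      using left_moduleD(6)[OF Y] target.LUnit_natural_Arr[of \<epsilon>] by simp
    also have "\<dots> = (\<epsilon> \<cdot>\<^bsub>D\<^esub> armap F (LUnit C P)) \<cdot>\<^bsub>D\<^esub> ?e"
      by (simp add: unit_map_left)
    finally show "\<epsilon> \<cdot>\<^bsub>D\<^esub> armap F (d \<cdot>\<^bsub>C\<^esub> (One A \<boxtimes>\<^bsub>C\<^esub> ?p)) = \<epsilon> \<cdot>\<^bsub>D\<^esub> armap F (LUnit C P)"
      by (rule target.iso_cancel_right[OF e, rotated 3]) (simp_all add: Hom_def)
  qed (simp_all add: Hom_def)
  have "d \<cdot>\<^bsub>C\<^esub> (Mult A \<boxtimes>\<^bsub>C\<^esub> ?p) = d \<cdot>\<^bsub>C\<^esub> ((?i \<boxtimes>\<^bsub>C\<^esub> d) \<cdot>\<^bsub>C\<^esub> Assoc C ?A ?A P)"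
  proof (rule couniversal_unique[OF \<epsilon>, of _ "(?A \<otimes>\<^bsub>C\<^esub> ?A) \<otimes>\<^bsub>C\<^esub> P"])
    let ?e = "?\<mu> (?A \<otimes>\<^bsub>C\<^esub> ?A) P \<cdot>\<^bsub>D\<^esub> (?\<mu> ?A ?A \<boxtimes>\<^bsub>D\<^esub> ?fp)"
    let ?a = "Assoc D (obmap F ?A) (obmap F ?A)"
    have e: "is_iso D ?e"
      by (rule target.is_iso_Comp[of _ _ "(obmap F ?A \<otimes>\<^bsub>D\<^esub> obmap F ?A) \<otimes>\<^bsub>D\<^esub> obmap F P"
            "obmap F (?A \<otimes>\<^bsub>C\<^esub> ?A) \<otimes>\<^bsub>D\<^esub> obmap F P" "obmap F ((?A \<otimes>\<^bsub>C\<^esub> ?A) \<otimes>\<^bsub>C\<^esub> P)"])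
        (simp_all add: Hom_def target.is_iso_tensor)
    have "(\<epsilon> \<cdot>\<^bsub>D\<^esub> armap F (d \<cdot>\<^bsub>C\<^esub> (Mult A \<boxtimes>\<^bsub>C\<^esub> ?p))) \<cdot>\<^bsub>D\<^esub> ?e
        = \<epsilon> \<cdot>\<^bsub>D\<^esub> (armap F d \<cdot>\<^bsub>D\<^esub> ((armap F (Mult A \<boxtimes>\<^bsub>C\<^esub> ?p) \<cdot>\<^bsub>D\<^esub> ?\<mu> (?A \<otimes>\<^bsub>C\<^esub> ?A) P) \<cdot>\<^bsub>D\<^esub> (?\<mu> ?A ?A \<boxtimes>\<^bsub>D\<^esub> ?fp)))"
      by simp
    also have "armap F (Mult A \<boxtimes>\<^bsub>C\<^esub> ?p) \<cdot>\<^bsub>D\<^esub> ?\<mu> (?A \<otimes>\<^bsub>C\<^esub> ?A) P = ?\<mu> ?A P \<cdot>\<^bsub>D\<^esub> (armap F (Mult A) \<boxtimes>\<^bsub>D\<^esub> ?fp)"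
      using mult_map_natural_Arr[of "Mult A" ?p] by simp
    also have "\<epsilon> \<cdot>\<^bsub>D\<^esub> (armap F d \<cdot>\<^bsub>D\<^esub> ((?\<mu> ?A P \<cdot>\<^bsub>D\<^esub> (armap F (Mult A) \<boxtimes>\<^bsub>D\<^esub> ?fp)) \<cdot>\<^bsub>D\<^esub> (?\<mu> ?A ?A \<boxtimes>\<^bsub>D\<^esub> ?fp)))
        = b \<cdot>\<^bsub>D\<^esub> ((armap F (Mult A) \<cdot>\<^bsub>D\<^esub> ?\<mu> ?A ?A) \<boxtimes>\<^bsub>D\<^esub> \<epsilon>)"
      by (simp add: \<epsilon>_action target.tensor_Comp)
    also have "\<dots> = (b \<cdot>\<^bsub>D\<^esub> (Mult ?B \<boxtimes>\<^bsub>D\<^esub> Ident D Y)) \<cdot>\<^bsub>D\<^esub> ((?fi \<boxtimes>\<^bsub>D\<^esub> ?fi) \<boxtimes>\<^bsub>D\<^esub> \<epsilon>)"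
      by (simp add: target.tensor_Comp)
    also have "\<dots> = (b \<cdot>\<^bsub>D\<^esub> ((?fi \<boxtimes>\<^bsub>D\<^esub> b) \<cdot>\<^bsub>D\<^esub> ?a Y)) \<cdot>\<^bsub>D\<^esub> ((?fi \<boxtimes>\<^bsub>D\<^esub> ?fi) \<boxtimes>\<^bsub>D\<^esub> \<epsilon>)"
      using left_moduleD(5)[OF Y] by simp
    also have "\<dots> = b \<cdot>\<^bsub>D\<^esub> ((?fi \<boxtimes>\<^bsub>D\<^esub> b) \<cdot>\<^bsub>D\<^esub> (?a Y \<cdot>\<^bsub>D\<^esub> ((?fi \<boxtimes>\<^bsub>D\<^esub> ?fi) \<boxtimes>\<^bsub>D\<^esub> \<epsilon>)))"
      by simp
    also have "?a Y \<cdot>\<^bsub>D\<^esub> ((?fi \<boxtimes>\<^bsub>D\<^esub> ?fi) \<boxtimes>\<^bsub>D\<^esub> \<epsilon>) = (?fi \<boxtimes>\<^bsub>D\<^esub> (?fi \<boxtimes>\<^bsub>D\<^esub> \<epsilon>)) \<cdot>\<^bsub>D\<^esub> ?a (obmap F P)"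
      using target.Assoc_natural_Arr[of ?fi ?fi \<epsilon>] by simp
    also have "b \<cdot>\<^bsub>D\<^esub> ((?fi \<boxtimes>\<^bsub>D\<^esub> b) \<cdot>\<^bsub>D\<^esub> ((?fi \<boxtimes>\<^bsub>D\<^esub> (?fi \<boxtimes>\<^bsub>D\<^esub> \<epsilon>)) \<cdot>\<^bsub>D\<^esub> ?a (obmap F P)))
        = b \<cdot>\<^bsub>D\<^esub> ((?fi \<boxtimes>\<^bsub>D\<^esub> (b \<cdot>\<^bsub>D\<^esub> ((?fi \<boxtimes>\<^bsub>D\<^esub> \<epsilon>) \<cdot>\<^bsub>D\<^esub> (?fi \<boxtimes>\<^bsub>D\<^esub> ?fp)))) \<cdot>\<^bsub>D\<^esub> ?a (obmap F P))"
      by (simp add: target.tensor_Comp_left)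
    also have "b \<cdot>\<^bsub>D\<^esub> ((?fi \<boxtimes>\<^bsub>D\<^esub> \<epsilon>) \<cdot>\<^bsub>D\<^esub> (?fi \<boxtimes>\<^bsub>D\<^esub> ?fp)) = \<epsilon> \<cdot>\<^bsub>D\<^esub> (armap F d \<cdot>\<^bsub>D\<^esub> (?\<mu> ?A P \<cdot>\<^bsub>D\<^esub> (?fi \<boxtimes>\<^bsub>D\<^esub> ?fp)))"
      by (rule \<epsilon>_action[symmetric]) simp_all
    also have "b \<cdot>\<^bsub>D\<^esub> ((?fi \<boxtimes>\<^bsub>D\<^esub> (\<epsilon> \<cdot>\<^bsub>D\<^esub> (armap F d \<cdot>\<^bsub>D\<^esub> (?\<mu> ?A P \<cdot>\<^bsub>D\<^esub> (?fi \<boxtimes>\<^bsub>D\<^esub> ?fp))))) \<cdot>\<^bsub>D\<^esub> ?a (obmap F P))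
        = b \<cdot>\<^bsub>D\<^esub> ((?fi \<boxtimes>\<^bsub>D\<^esub> \<epsilon>) \<cdot>\<^bsub>D\<^esub> ((?fi \<boxtimes>\<^bsub>D\<^esub> armap F d) \<cdot>\<^bsub>D\<^esub> ((?fi \<boxtimes>\<^bsub>D\<^esub> ?\<mu> ?A P) \<cdot>\<^bsub>D\<^esub> ?a (obmap F P))))"
      by (simp add: target.tensor_Comp_left)
    also have "\<dots> = \<epsilon> \<cdot>\<^bsub>D\<^esub> (armap F d \<cdot>\<^bsub>D\<^esub> (?\<mu> ?A P \<cdot>\<^bsub>D\<^esub>
        ((?fi \<boxtimes>\<^bsub>D\<^esub> armap F d) \<cdot>\<^bsub>D\<^esub> ((?fi \<boxtimes>\<^bsub>D\<^esub> ?\<mu> ?A P) \<cdot>\<^bsub>D\<^esub> ?a (obmap F P)))))"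
      by (rule \<epsilon>_action[symmetric]) simp_all
    also have "\<dots> = \<epsilon> \<cdot>\<^bsub>D\<^esub> (armap F d \<cdot>\<^bsub>D\<^esub> ((?\<mu> ?A P \<cdot>\<^bsub>D\<^esub> (?fi \<boxtimes>\<^bsub>D\<^esub> armap F d)) \<cdot>\<^bsub>D\<^esub>
        ((?fi \<boxtimes>\<^bsub>D\<^esub> ?\<mu> ?A P) \<cdot>\<^bsub>D\<^esub> ?a (obmap F P))))"
      by simp
    also have "?\<mu> ?A P \<cdot>\<^bsub>D\<^esub> (?fi \<boxtimes>\<^bsub>D\<^esub> armap F d) = armap F (?i \<boxtimes>\<^bsub>C\<^esub> d) \<cdot>\<^bsub>D\<^esub> ?\<mu> ?A (?A \<otimes>\<^bsub>C\<^esub> P)"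
      using mult_map_natural_Arr[of ?i d] by simp
    also have "\<epsilon> \<cdot>\<^bsub>D\<^esub> (armap F d \<cdot>\<^bsub>D\<^esub> ((armap F (?i \<boxtimes>\<^bsub>C\<^esub> d) \<cdot>\<^bsub>D\<^esub> ?\<mu> ?A (?A \<otimes>\<^bsub>C\<^esub> P)) \<cdot>\<^bsub>D\<^esub>
        ((?fi \<boxtimes>\<^bsub>D\<^esub> ?\<mu> ?A P) \<cdot>\<^bsub>D\<^esub> ?a (obmap F P))))
        = (\<epsilon> \<cdot>\<^bsub>D\<^esub> armap F (d \<cdot>\<^bsub>C\<^esub> ((?i \<boxtimes>\<^bsub>C\<^esub> d) \<cdot>\<^bsub>C\<^esub> Assoc C ?A ?A P))) \<cdot>\<^bsub>D\<^esub> ?e"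
      by (simp add: mult_map_assoc)
    finally show "\<epsilon> \<cdot>\<^bsub>D\<^esub> armap F (d \<cdot>\<^bsub>C\<^esub> (Mult A \<boxtimes>\<^bsub>C\<^esub> ?p))
        = \<epsilon> \<cdot>\<^bsub>D\<^esub> armap F (d \<cdot>\<^bsub>C\<^esub> ((?i \<boxtimes>\<^bsub>C\<^esub> d) \<cdot>\<^bsub>C\<^esub> Assoc C ?A ?A P))"
      by (rule target.iso_cancel_right[OF e, rotated 3]) (simp_all add: Hom_def)
  qed (simp_all add: Hom_def)
  with unit have P_mod: "left_module C A (P, d)" by (simp add: left_module_pair Hom_def)
  \<comment> \<open>A map into \<open>P\<close> is linear over \<open>A\<close> if and only if its transpose is linear over \<open>F A\<close>.\<close>
  have linear_iff: "g \<cdot>\<^bsub>C\<^esub> snd X = d \<cdot>\<^bsub>C\<^esub> (?i \<boxtimes>\<^bsub>C\<^esub> g) \<longleftrightarrow>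
      (\<epsilon> \<cdot>\<^bsub>D\<^esub> armap F g) \<cdot>\<^bsub>D\<^esub> (armap F (snd X) \<cdot>\<^bsub>D\<^esub> ?\<mu> ?A (fst X)) = b \<cdot>\<^bsub>D\<^esub> (?fi \<boxtimes>\<^bsub>D\<^esub> (\<epsilon> \<cdot>\<^bsub>D\<^esub> armap F g))"
    if X: "left_module C A X" and g: "g \<in> Hom C (fst X) P" for X g
  proof -
    note facts [simp] = left_moduleD(1-4)[OF X]
    have g_Arr [simp]: "g \<in> Arr C" "Dom C g = fst X" "Cod C g = P" using g by (auto simp: Hom_def)
    let ?\<mu>X = "?\<mu> ?A (fst X)"
    have left: "(\<epsilon> \<cdot>\<^bsub>D\<^esub> armap F g) \<cdot>\<^bsub>D\<^esub> (armap F (snd X) \<cdot>\<^bsub>D\<^esub> ?\<mu>X)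
        = (\<epsilon> \<cdot>\<^bsub>D\<^esub> armap F (g \<cdot>\<^bsub>C\<^esub> snd X)) \<cdot>\<^bsub>D\<^esub> ?\<mu>X"
      by simp
    have "b \<cdot>\<^bsub>D\<^esub> (?fi \<boxtimes>\<^bsub>D\<^esub> (\<epsilon> \<cdot>\<^bsub>D\<^esub> armap F g)) = b \<cdot>\<^bsub>D\<^esub> ((?fi \<boxtimes>\<^bsub>D\<^esub> \<epsilon>) \<cdot>\<^bsub>D\<^esub> (?fi \<boxtimes>\<^bsub>D\<^esub> armap F g))"
      by (simp add: target.tensor_Comp)
    also have "\<dots> = \<epsilon> \<cdot>\<^bsub>D\<^esub> (armap F d \<cdot>\<^bsub>D\<^esub> (?\<mu> ?A P \<cdot>\<^bsub>D\<^esub> (?fi \<boxtimes>\<^bsub>D\<^esub> armap F g)))"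
      by (rule \<epsilon>_action[symmetric]) simp_all
    also have "?\<mu> ?A P \<cdot>\<^bsub>D\<^esub> (?fi \<boxtimes>\<^bsub>D\<^esub> armap F g) = armap F (?i \<boxtimes>\<^bsub>C\<^esub> g) \<cdot>\<^bsub>D\<^esub> ?\<mu>X"
      using mult_map_natural_Arr[of ?i g] by simp
    also have "\<epsilon> \<cdot>\<^bsub>D\<^esub> (armap F d \<cdot>\<^bsub>D\<^esub> (armap F (?i \<boxtimes>\<^bsub>C\<^esub> g) \<cdot>\<^bsub>D\<^esub> ?\<mu>X))
        = (\<epsilon> \<cdot>\<^bsub>D\<^esub> armap F (d \<cdot>\<^bsub>C\<^esub> (?i \<boxtimes>\<^bsub>C\<^esub> g))) \<cdot>\<^bsub>D\<^esub> ?\<mu>X"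
      by simp
    finally have right: "b \<cdot>\<^bsub>D\<^esub> (?fi \<boxtimes>\<^bsub>D\<^esub> (\<epsilon> \<cdot>\<^bsub>D\<^esub> armap F g)) = (\<epsilon> \<cdot>\<^bsub>D\<^esub> armap F (d \<cdot>\<^bsub>C\<^esub> (?i \<boxtimes>\<^bsub>C\<^esub> g))) \<cdot>\<^bsub>D\<^esub> ?\<mu>X" .
    show ?thesis
    proof
      assume "g \<cdot>\<^bsub>C\<^esub> snd X = d \<cdot>\<^bsub>C\<^esub> (?i \<boxtimes>\<^bsub>C\<^esub> g)"
      then show "(\<epsilon> \<cdot>\<^bsub>D\<^esub> armap F g) \<cdot>\<^bsub>D\<^esub> (armap F (snd X) \<cdot>\<^bsub>D\<^esub> ?\<mu>X) = b \<cdot>\<^bsub>D\<^esub> (?fi \<boxtimes>\<^bsub>D\<^esub> (\<epsilon> \<cdot>\<^bsub>D\<^esub> armap F g))"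
        unfolding left right by (simp only:)
    next
      assume "(\<epsilon> \<cdot>\<^bsub>D\<^esub> armap F g) \<cdot>\<^bsub>D\<^esub> (armap F (snd X) \<cdot>\<^bsub>D\<^esub> ?\<mu>X) = b \<cdot>\<^bsub>D\<^esub> (?fi \<boxtimes>\<^bsub>D\<^esub> (\<epsilon> \<cdot>\<^bsub>D\<^esub> armap F g))"
      then have "\<epsilon> \<cdot>\<^bsub>D\<^esub> armap F (g \<cdot>\<^bsub>C\<^esub> snd X) = \<epsilon> \<cdot>\<^bsub>D\<^esub> armap F (d \<cdot>\<^bsub>C\<^esub> (?i \<boxtimes>\<^bsub>C\<^esub> g))"
        unfolding left right
        by (rule target.iso_cancel_right[rotated 4]) (simp_all add: Hom_def)
      then show "g \<cdot>\<^bsub>C\<^esub> snd X = d \<cdot>\<^bsub>C\<^esub> (?i \<boxtimes>\<^bsub>C\<^esub> g)"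
        by (rule couniversal_unique[OF \<epsilon>, rotated 2, where X = "?A \<otimes>\<^bsub>C\<^esub> fst X"]) (simp_all add: Hom_def)
    qed
  qed
  have "couniversal (module_cat C A) (module_cat D ?B) (module_funct F D A)
    (Y, b) (P, d) (image_module F D A (P, d), (Y, b), \<epsilon>)"
    unfolding couniversal_def
  proof (intro conjI ballI)
    show "(P, d) \<in> Obj (module_cat C A)" using P_mod by simp
    show "(image_module F D A (P, d), (Y, b), \<epsilon>)
        \<in> Hom (module_cat D ?B) (obmap (module_funct F D A) (P, d)) (Y, b)"
      using linear_iff[OF P_mod, of ?p] Y image_module_left_module[OF A P_mod] by (simp add: Hom_def)
  next
    fix X k assume "X \<in> Obj (module_cat C A)"
      and "k \<in> Hom (module_cat D ?B) (obmap (module_funct F D A) X) (Y, b)"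
    then obtain f where X: "left_module C A X" and k: "k = (image_module F D A X, (Y, b), f)"
        "f \<in> Hom D (obmap F (fst X)) Y"
        "f \<cdot>\<^bsub>D\<^esub> (armap F (snd X) \<cdot>\<^bsub>D\<^esub> ?\<mu> ?A (fst X)) = b \<cdot>\<^bsub>D\<^esub> (?fi \<boxtimes>\<^bsub>D\<^esub> f)"
      by (auto elim!: module_HomE)
    obtain g where g: "g \<in> Hom C (fst X) P" "\<epsilon> \<cdot>\<^bsub>D\<^esub> armap F g = f"
      using couniversal_exists[OF \<epsilon> left_moduleD(1)[OF X] k(2)] .
    have g_lin: "g \<cdot>\<^bsub>C\<^esub> snd X = d \<cdot>\<^bsub>C\<^esub> (?i \<boxtimes>\<^bsub>C\<^esub> g)"
      using linear_iff[OF X g(1)] k(3) unfolding g(2) by blast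
    show "\<exists>!\<gamma>. \<gamma> \<in> Hom (module_cat C A) X (P, d) \<and>
        (image_module F D A (P, d), (Y, b), \<epsilon>) \<cdot>\<^bsub>module_cat D ?B\<^esub> armap (module_funct F D A) \<gamma> = k"
    proof (rule ex1I[of _ "(X, (P, d), g)"])
      show "(X, (P, d), g) \<in> Hom (module_cat C A) X (P, d) \<and>
          (image_module F D A (P, d), (Y, b), \<epsilon>) \<cdot>\<^bsub>module_cat D ?B\<^esub>
            armap (module_funct F D A) (X, (P, d), g) = k"
        using X P_mod g g_lin k(1) by simp
    next
      fix \<gamma> assume \<gamma>: "\<gamma> \<in> Hom (module_cat C A) X (P, d) \<and>
        (image_module F D A (P, d), (Y, b), \<epsilon>) \<cdot>\<^bsub>module_cat D ?B\<^esub> armap (module_funct F D A) \<gamma> = k"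
      then obtain g' where g': "\<gamma> = (X, (P, d), g')" "g' \<in> Hom C (fst X) P"
        by (auto elim: module_HomE)
      have "\<epsilon> \<cdot>\<^bsub>D\<^esub> armap F g' = \<epsilon> \<cdot>\<^bsub>D\<^esub> armap F g" using \<gamma> g'(1) k(1) g(2) by simp
      then have "g' = g" by (rule couniversal_unique[OF \<epsilon> g'(2) g(1)])
      then show "\<gamma> = (X, (P, d), g)" using g'(1) by simp
    qed
  qed
  then show ?thesis ..
qed

end

section \<open>The Quillen equivalence\<close>

theorem theorem2p7:
  fixes \<kappa> :: "'u rel"
    and C :: "('o, 'a) monoidal" and M :: "'a model_structure" and Q :: "('o, 'a) replacement"
    and D :: "('p, 'b) monoidal" and N :: "'b model_structure" and R :: "('p, 'b) replacement"
    and F :: "('o, 'a, 'p, 'b) monoidal_funct" and U :: "('p, 'b, 'o, 'a) funct"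
    and \<Phi> :: "'o \<Rightarrow> 'p \<Rightarrow> 'b \<Rightarrow> 'a"
    and A :: "('o, 'a) monoid_data"
  assumes "universe \<kappa>"
    and "monoidal_model_category C \<kappa> M Q" and "cofibrantly_generated \<kappa> C M"
    and "monoidal_model_category D \<kappa> N R" and "cofibrantly_generated \<kappa> D N"
    and "monoidal_Quillen_equivalence C M Q D N F U \<Phi>"
    and "monoid_object C A" and "cofibrant C M (Carrier A)"
  shows "\<exists>(V :: ('p \<times> 'b, ('p \<times> 'b) \<times> ('p \<times> 'b) \<times> 'b, 'o \<times> 'a, ('o \<times> 'a) \<times> ('o \<times> 'a) \<times> 'a) funct) \<Psi>.
    Quillen_equivalence
      (module_cat C A) (module_model C M A)
      (module_cat D (image_monoid F D A)) (module_model D N (image_monoid F D A))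
      (module_funct F D A) V \<Psi>"
proof -
  interpret C: monoidal_model_category C \<kappa> M Q by (rule assms)
  interpret D: monoidal_model_category D \<kappa> N R by (rule assms)
  have F: "monoidal_functor C D F" and adj: "adjunction C D F U \<Phi>"
    and F_Cof: "\<And>i. i \<in> Cof M \<Longrightarrow> armap F i \<in> Cof N"
    and F_trivial_Cof: "\<And>i. i \<in> Cof M \<inter> Weq M \<Longrightarrow> armap F i \<in> Weq N"
    and equiv: "\<And>X Y f. cofibrant C M X \<Longrightarrow> fibrant D N Y \<Longrightarrow> f \<in> Hom D (obmap F X) Y \<Longrightarrow>
      f \<in> Weq N \<longleftrightarrow> \<Phi> X Y f \<in> Weq M"
    using assms(6) unfolding monoidal_Quillen_equivalence_def monoidal_Quillen_functor_def
      Quillen_equivalence_def left_Quillen_def by blast+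
  interpret F: monoidal_functor C D F by (rule F)
  interpret A: monoid_object C A by (rule assms)
  let ?B = "image_monoid F D A" and ?MF = "module_funct F D A"
  let ?C = "module_cat C A" and ?D = "module_cat D (image_monoid F D A)"
  let ?M = "module_model C M A" and ?N = "module_model D N (image_monoid F D A)"
  interpret MF: is_functor ?C ?D ?MF by (rule F.module_funct_is_functor[OF assms(7)])
  obtain \<epsilon> where \<epsilon>: "\<And>Y. Y \<in> Obj D \<Longrightarrow> couniversal C D F Y (obmap U Y) (\<epsilon> Y)"
    and \<Phi>: "\<And>X Y f. Y \<in> Obj D \<Longrightarrow> X \<in> Obj C \<Longrightarrow> f \<in> Hom D (obmap F X) Y \<Longrightarrow>
      \<Phi> X Y f \<in> Hom C X (obmap U Y) \<and> \<epsilon> Y \<cdot>\<^bsub>D\<^esub> armap F (\<Phi> X Y f) = f"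
    using adjunction_couniversal[OF adj] by metis
  \<comment> \<open>The right adjoint \<open>V\<close> on modules equips \<open>U Y\<close> with an action \<open>d Y\<close>, and its counit is \<open>\<epsilon>\<close>.\<close>
  have "\<exists>d. couniversal ?C ?D ?MF Y (obmap U (fst Y), d)
      (image_module F D A (obmap U (fst Y), d), Y, \<epsilon> (fst Y))" if "Y \<in> Obj ?D" for Y
    using F.module_funct_couniversal[OF assms(7), of "fst Y" "snd Y"] \<epsilon> that left_moduleD(1)[of D ?B Y]
    by simp
  then obtain d where d: "\<And>Y. Y \<in> Obj ?D \<Longrightarrow> couniversal ?C ?D ?MF Y (obmap U (fst Y), d Y)
      (image_module F D A (obmap U (fst Y), d Y), Y, \<epsilon> (fst Y))"
    by metis
  define V where "V Y = (obmap U (fst Y), d Y)" for Y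
  have couniv: "couniversal ?C ?D ?MF Y (V Y) (image_module F D A (V Y), Y, \<epsilon> (fst Y))"
    if "Y \<in> Obj ?D" for Y
    using d[OF that] by (simp add: V_def)
  obtain V' :: "('p \<times> 'b, ('p \<times> 'b) \<times> ('p \<times> 'b) \<times> 'b, 'o \<times> 'a, ('o \<times> 'a) \<times> ('o \<times> 'a) \<times> 'a) funct"
      and \<Psi> where adj': "adjunction ?C ?D ?MF V' \<Psi>"
    and \<Psi>: "\<And>X Y f. X \<in> Obj ?C \<Longrightarrow> Y \<in> Obj ?D \<Longrightarrow> f \<in> Hom ?D (obmap ?MF X) Y \<Longrightarrow>
      \<Psi> X Y f \<in> Hom ?C X (V Y) \<and>
      (image_module F D A (V Y), Y, \<epsilon> (fst Y)) \<cdot>\<^bsub>?D\<^esub> armap ?MF (\<Psi> X Y f) = f"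
    using MF.couniversal_adjunction[of V "\<lambda>Y. (image_module F D A (V Y), Y, \<epsilon> (fst Y))", OF couniv]
    by blast
  \<comment> \<open>\<open>V\<close> preserves trivial fibrations since \<open>U\<close> does, so \<open>F\<close> preserves cofibrations of modules.\<close>
  have MF_Cof: "armap ?MF i \<in> Cof ?N" if i: "i \<in> Cof ?M" for i
  proof -
    have i_Arr: "i \<in> Arr ?C" and lift: "\<And>q. q \<in> Fib ?M \<inter> Weq ?M \<Longrightarrow> has_lift ?C i q"
      using i by (auto simp: llp_def)
    have "has_lift ?D (armap ?MF i) p" if p: "p \<in> Fib ?N \<inter> Weq ?N" for p
    proof -
      obtain E B p' where p_eq: "p = (E, B, p')" by (cases p)
      have p_Hom: "p \<in> Hom ?D E B" and p': "p' \<in> Fib N \<inter> Weq N" "p' \<in> Hom D (fst E) (fst B)"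
        and EB: "E \<in> Obj ?D" "B \<in> Obj ?D" "fst E \<in> Obj D" "fst B \<in> Obj D"
        using p left_moduleD(1)[of D ?B] by (auto simp: p_eq)
      let ?\<epsilon>E = "(image_module F D A (V E), E, \<epsilon> (fst E))"
      let ?\<epsilon>B = "(image_module F D A (V B), B, \<epsilon> (fst B))"
      have "p \<cdot>\<^bsub>?D\<^esub> ?\<epsilon>E \<in> Hom ?D (obmap ?MF (V E)) B"
        by (rule MF.target.Comp_in[OF couniversalD(2)[OF couniv[OF EB(1)]] p_Hom])
      then obtain q where q: "q \<in> Hom ?C (V E) (V B)" "?\<epsilon>B \<cdot>\<^bsub>?D\<^esub> armap ?MF q = p \<cdot>\<^bsub>?D\<^esub> ?\<epsilon>E"
        using couniversal_exists[OF couniv[OF EB(2)] couniversalD(1)[OF couniv[OF EB(1)]]] by blast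
      obtain q' where q': "q = (V E, V B, q')" "q' \<in> Hom C (obmap U (fst E)) (obmap U (fst B))"
        using q(1) by (rule module_HomE) (simp add: V_def)
      have "\<epsilon> (fst B) \<cdot>\<^bsub>D\<^esub> armap F q' = p' \<cdot>\<^bsub>D\<^esub> \<epsilon> (fst E)" using q(2) by (simp add: q'(1) p_eq)
      then have "q' \<in> Fib M \<inter> Weq M"
        by (intro couniversal_trivial_Fib[OF C.model_category_axioms D.model_category_axioms
              F.is_functor_axioms F_Cof p' \<epsilon>[OF EB(3)] \<epsilon>[OF EB(4)] q'(2)])
      then have "q \<in> Fib ?M \<inter> Weq ?M" using q(1) by (simp add: q'(1) del: module_cat_simps)
      then have "has_lift ?C i q" by (rule lift)
      then show ?thesis
        using MF.has_lift_transpose[OF i_Arr p_Hom couniv[OF EB(1)] couniv[OF EB(2)] q] by blast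
    qed
    then show ?thesis using i_Arr by (simp add: llp_def)
  qed
  \<comment> \<open>The map underlying a trivial cofibration of modules is one in \<open>C\<close>, so \<open>F\<close> takes it to a weak equivalence.\<close>
  have MF_trivial_Cof: "armap ?MF i \<in> Cof ?N \<inter> Weq ?N" if i: "i \<in> Cof ?M \<inter> Weq ?M" for i
  proof -
    obtain X Y f where i_eq: "i = (X, Y, f)" by (cases i)
    have i_Arr: "i \<in> Arr ?C" and "f \<in> Weq M" using i by (auto simp: i_eq)
    moreover have "armap forget i \<in> Cof M" using C.forget_Cof[OF assms(7,8)] i by blast
    then have "f \<in> Cof M" by (simp add: i_eq)
    ultimately have "armap F f \<in> Weq N" by (intro F_trivial_Cof) simp
    then have "armap ?MF i \<in> Weq ?N"
      using MF.armap_Arr(1)[OF i_Arr] by (simp add: i_eq del: module_cat_simps)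
    then show ?thesis using MF_Cof i by blast
  qed
  have "f \<in> Weq ?N \<longleftrightarrow> \<Psi> X Y f \<in> Weq ?M"
    if X: "cofibrant ?C ?M X" and Y: "fibrant ?D ?N Y" and f: "f \<in> Hom ?D (obmap ?MF X) Y" for X Y f
  proof -
    have X_Obj: "X \<in> Obj ?C" and Y_Obj: "Y \<in> Obj ?D" using X Y by (auto simp: cofibrant_def fibrant_def)
    have Obj: "fst X \<in> Obj C" "fst Y \<in> Obj D"
      using X_Obj Y_Obj left_moduleD(1) by (auto intro: left_moduleD(1))
    obtain f' where f': "f = (image_module F D A X, Y, f')" "f' \<in> Hom D (obmap F (fst X)) (fst Y)"
      using f by (auto elim: module_HomE)
    note \<Psi>f = \<Psi>[OF X_Obj Y_Obj f]
    then obtain g where g: "\<Psi> X Y f = (X, V Y, g)" "g \<in> Hom C (fst X) (obmap U (fst Y))"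
      by (auto elim!: module_HomE simp: V_def)
    \<comment> \<open>Both \<open>g\<close> and \<open>\<Phi> f'\<close> are the transpose of \<open>f'\<close> along the counit \<open>\<epsilon>\<close>.\<close>
    have "\<epsilon> (fst Y) \<cdot>\<^bsub>D\<^esub> armap F g = f'" using \<Psi>f unfolding g(1) by (simp add: f'(1))
    then have "g = \<Phi> (fst X) (fst Y) f'"
      using \<Phi>[OF Obj(2,1) f'(2)] g(2) by (intro F.couniversal_unique[OF \<epsilon>[OF Obj(2)]]) auto
    moreover have "f' \<in> Weq N \<longleftrightarrow> \<Phi> (fst X) (fst Y) f' \<in> Weq M"
      by (rule equiv[OF C.cofibrant_forget[OF assms(7,8) X]
            D.fibrant_forget[OF assms(1) F.image_monoid_in[OF assms(7)] Y] f'(2)])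
    moreover have "f \<in> Arr ?D" "\<Psi> X Y f \<in> Arr ?C" using f \<Psi>f by (auto simp: Hom_def)
    ultimately show ?thesis unfolding g(1) by (simp add: f'(1) del: module_cat_simps)
  qed
  then have "Quillen_equivalence ?C ?M ?D ?N ?MF V' \<Psi>"
    unfolding Quillen_equivalence_def left_Quillen_def using adj' MF_Cof MF_trivial_Cof by blast
  then show ?thesis by blast
qed

end
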